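(* Let $(\mathscr{C},\mathbb{E},\mathfrak{s})$ be an extriangulated category satisfying Condition (WIC). Then admissible model structures on $\mathscr{C}$ and Hovey twin cotorsion pairs on $\mathscr{C}$ correspond bijectively. Explicitly, the assignment sending an admissible model structure $(\mathit{Fib},\mathit{Cof},\mathbb{W})$ to the pair $((\mathcal{S},\mathcal{T}),(\mathcal{U},\mathcal{V}))$, where $\mathcal{S},\mathcal{T},\mathcal{U},\mathcal{V}$ are respectively the full subcategories of trivially cofibrant, fibrant, cofibrant, and trivially fibrant objects, and the assignment sending a Hovey twin cotorsion pair $((\mathcal{S},\mathcal{T}),(\mathcal{U},\mathcal{V}))$ to the triple $(\mathit{Fib},\mathit{Cof},\mathbb{W})$ of classes of morphisms associated with it in the context, are well-defined and mutually inverse.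
   Context: Extriangulated categories. Let $\mathscr{C}$ be an additive category and $\mathbb{E}\colon\mathscr{C}^{\mathrm{op}}\times\mathscr{C}\to\mathit{Ab}$ a functor. Elements $\delta\in\mathbb{E}(C,A)$ are called $\mathbb{E}$-extensions; for $a\colon A\to A'$ and $c\colon C'\to C$ put $a_*\delta=\mathbb{E}(C,a)(\delta)$ and $c^*\delta=\mathbb{E}(c,A)(\delta)$. A morphism $(a,c)\colon\delta\to\delta'$ from $\delta\in\mathbb{E}(C,A)$ to $\delta'\in\mathbb{E}(C',A')$ is a pair $a\colon A\to A'$, $c\colon C\to C'$ with $a_*\delta=c^*\delta'$. Sequences $A\xrightarrow{x}B\xrightarrow{y}C$ and $A\xrightarrow{x'}B'\xrightarrow{y'}C$ are equivalent if there is an isomorphism $b\colon B\to B'$ with $bx=x'$, $y'b=y$; the class is written $[A\xrightarrow{x}B\xrightarrow{y}C]$. A realization $\mathfrak{s}$ assigns to each $\delta\in\mathbb{E}(C,A)$ such a class $\mathfrak{s}(\delta)=[A\xrightarrow{x}B\xrightarrow{y}C]$ so that for every morphism $(a,c)\colon\delta\to\delta'$, with $\mathfrak{s}(\delta')=[A'\xrightarrow{x'}B'\xrightarrow{y'}C']$, there is $b\colon B\to B'$ with $bx=x'a$, $y'b=cy$ (then $(a,b,c)$ is said to realize $(a,c)$). It is additive if $\mathfrak{s}(0)=[A\to A\oplus C\to C]$ (canonical inclusion and projection) and $\mathfrak{s}(\delta\oplus\delta')=[A\oplus A'\xrightarrow{x\oplus x'}B\oplus B'\xrightarrow{y\oplus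 y'}C\oplus C']$, where $\delta\oplus\delta'\in\mathbb{E}(C\oplus C',A\oplus A')$ corresponds to $(\delta,0,0,\delta')$. If $\mathfrak{s}(\delta)=[A\xrightarrow{x}B\xrightarrow{y}C]$, the sequence is called a conflation, $x$ an inflation, $y$ a deflation, and one speaks of the $\mathbb{E}$-triangle $A\xrightarrow{x}B\xrightarrow{y}C\overset{\delta}{\dashrightarrow}$. The triple $(\mathscr{C},\mathbb{E},\mathfrak{s})$ is an extriangulated category if: (ET1) $\mathbb{E}$ is biadditive; (ET2) $\mathfrak{s}$ is an additive realization; (ET3) for $\mathbb{E}$-triangles $A\xrightarrow{x}B\xrightarrow{y}C\overset{\delta}{\dashrightarrow}$, $A'\xrightarrow{x'}B'\xrightarrow{y'}C'\overset{\delta'}{\dashrightarrow}$ and $a,b$ with $bx=x'a$ there is $c$ such that $(a,c)\colon\delta\to\delta'$ is a morphism realized by $(a,b,c)$; (ET3)$^{\mathrm{op}}$ for $b,c$ with $y'b=cy$ there is $a$ such that $(a,c)\colon\delta\to\delta'$ is a morphism realized by $(a,b,c)$; (ET4) for $\mathbb{E}$-triangles $A\xrightarrow{f}B\xrightarrow{f'}D\overset{\delta}{\dashrightarrow}$ and $B\xrightarrow{g}C\xrightarrow{g'}F\overset{\delta'}{\dashrightarrow}$ there are an $\mathbb{E}$-triangle $A\xrightarrow{h}C\xrightarrow{h'}E\overset{\delta''}{\dashrightarrow}$ with $h=gf$ and $d\colon D\to E$, $e\colon E\to F$ with $df'=h'g$, $eh'=g'$, such that $D\xrightarrow{d}E\xrightarrow{e}F$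 realizes $f'_*\delta'$, $d^*\delta''=\delta$ and $f_*\delta''=e^*\delta'$; (ET4)$^{\mathrm{op}}$ for $\mathbb{E}$-triangles $D\xrightarrow{f'}A\xrightarrow{f}B\overset{\delta}{\dashrightarrow}$ and $F\xrightarrow{g'}B\xrightarrow{g}C\overset{\delta'}{\dashrightarrow}$ there are an $\mathbb{E}$-triangle $E\xrightarrow{h'}A\xrightarrow{h}C\overset{\delta''}{\dashrightarrow}$ with $h=gf$ and $d\colon D\to E$, $e\colon E\to F$ with $h'd=f'$, $fh'=g'e$, such that $D\xrightarrow{d}E\xrightarrow{e}F$ realizes $g'^*\delta$, $\delta'=e_*\delta''$ and $d_*\delta=g^*\delta''$. Condition (WIC): for all composable $f\colon A\to B$, $g\colon B\to C$: if $gf$ is an inflation then so is $f$; if $gf$ is a deflation then so is $g$. For an inflation $f\colon A\to B$, $\mathrm{Cone}(f)$ is the third term $C$ (unique up to isomorphism) of a conflation $A\xrightarrow{f}B\to C$; for a deflation $f\colon A\to B$, $\mathrm{CoCone}(f)$ is the first term $K$ of a conflation $K\to A\xrightarrow{f}B$. Cotorsion pairs. A cotorsion pair on $\mathscr{C}$ is a pair $(\mathcal{U},\mathcal{V})$ of full additive subcategories closed under isomorphisms and direct summands such that $\mathbb{E}(U,V)=0$ for all $U\in\mathcal{U},V\in\mathcal{V}$, and every $C\in\mathscr{C}$ admits conflations $V^C\to U^C\to C$ and $C\to V_C\to U_C$ with $U^C,U_C\in\mathcal{U}$, $V^C,V_C\in\mathcal{V}$. A twin cotorsion pair is a pair $((\mathcal{S},\mathcal{T}),(\mathcal{U},\mathcal{V}))$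 of cotorsion pairs with $\mathbb{E}(\mathcal{S},\mathcal{V})=0$. Let $\mathcal{N}^i$ (resp. $\mathcal{N}^f$) be the full subcategory of objects $X$ admitting a conflation $V\to S\to X$ (resp. $X\to V\to S$) with $V\in\mathcal{V},S\in\mathcal{S}$. The twin cotorsion pair is Hovey if $\mathcal{N}^i=\mathcal{N}^f$. Model structures. A model structure $(\mathit{Fib},\mathit{Cof},\mathbb{W})$ on $\mathscr{C}$ consists of classes of fibrations, cofibrations and weak equivalences satisfying the usual model category axioms (2-out-of-3, retracts, lifting, factorization), with no completeness or cocompleteness of $\mathscr{C}$ required; $w\mathit{Fib}=\mathit{Fib}\cap\mathbb{W}$, $w\mathit{Cof}=\mathit{Cof}\cap\mathbb{W}$. Put $C\in\mathcal{S}\Leftrightarrow(0\to C)\in w\mathit{Cof}$; $C\in\mathcal{T}\Leftrightarrow(C\to0)\in\mathit{Fib}$; $C\in\mathcal{U}\Leftrightarrow(0\to C)\in\mathit{Cof}$; $C\in\mathcal{V}\Leftrightarrow(C\to 0)\in w\mathit{Fib}$ (trivially cofibrant, fibrant, cofibrant, trivially fibrant objects). The model structure is admissible if for every morphism $f$: $f\in w\mathit{Cof}$ iff $f$ is an inflation with $\mathrm{Cone}(f)\in\mathcal{S}$; $f\in\mathit{Fib}$ iff $f$ is a deflation with $\mathrm{CoCone}(f)\in\mathcal{T}$; $f\in\mathit{Cof}$ iff $f$ is an inflation with $\mathrm{Cone}(f)\in\mathcal{U}$; $f\in w\mathit{Fib}$ iff $f$ is a deflation with $\mathrm{CoCone}(f)\in\mathcal{V}$.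 Classes associated with a Hovey twin cotorsion pair $((\mathcal{S},\mathcal{T}),(\mathcal{U},\mathcal{V}))$: $\mathit{Fib}$ (resp. $w\mathit{Fib}$) is the class of deflations $f$ with $\mathrm{CoCone}(f)\in\mathcal{T}$ (resp. $\in\mathcal{V}$); $\mathit{Cof}$ (resp. $w\mathit{Cof}$) is the class of inflations $f$ with $\mathrm{Cone}(f)\in\mathcal{U}$ (resp. $\in\mathcal{S}$); $\mathbb{W}=w\mathit{Fib}\circ w\mathit{Cof}$ is the class of composites $p\circ i$ with $i\in w\mathit{Cof}$, $p\in w\mathit{Fib}$. *)

theory Defs
  imports "HOL-Algebra.Group"
begin

section \<open>Categories\<close>

text \<open>Composition is written in the usual order: \<open>g \<cdot> f\<close> is \<open>f\<close> followed by \<open>g\<close>.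
  Each arrow has one domain and one codomain, so a class of morphisms is a set of arrows.\<close>

record ('o, 'm) category =
  Obj :: "'o set"
  Arr :: "'m set"
  Dom :: "'m \<Rightarrow> 'o"
  Cod :: "'m \<Rightarrow> 'o"
  Ident :: "'o \<Rightarrow> 'm"
  Comp :: "'m \<Rightarrow> 'm \<Rightarrow> 'm" (infixl \<open>\<cdot>\<index>\<close> 70)

definition Hom :: "('o, 'm, 'x) category_scheme \<Rightarrow> 'o \<Rightarrow> 'o \<Rightarrow> 'm set" where
  "Hom X A B = {f \<in> Arr X. Dom X f = A \<and> Cod X f = B}"

locale category =
  fixes X :: "('o, 'm, 'x) category_scheme" (structure)
  assumes Dom_Obj: "f \<in> Arr X \<Longrightarrow> Dom X f \<in> Obj X"
    and Cod_Obj: "f \<in> Arr X \<Longrightarrow> Cod X f \<in> Obj X"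
    and Ident_Hom: "A \<in> Obj X \<Longrightarrow> Ident X A \<in> Hom X A A"
    and Comp_Hom: "\<lbrakk>f \<in> Hom X A B; g \<in> Hom X B C\<rbrakk> \<Longrightarrow> g \<cdot> f \<in> Hom X A C"
    and Comp_Ident: "f \<in> Hom X A B \<Longrightarrow> f \<cdot> Ident X A = f"
    and Ident_Comp: "f \<in> Hom X A B \<Longrightarrow> Ident X B \<cdot> f = f"
    and Comp_assoc: "\<lbrakk>f \<in> Hom X A B; g \<in> Hom X B C; h \<in> Hom X C D\<rbrakk>
          \<Longrightarrow> h \<cdot> (g \<cdot> f) = (h \<cdot> g) \<cdot> f"

definition iso_arr :: "('o, 'm, 'x) category_scheme \<Rightarrow> 'm \<Rightarrow> bool" where
  "iso_arr X f \<longleftrightarrow> f \<in> Arr X \<and>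
     (\<exists>g \<in> Hom X (Cod X f) (Dom X f).
        g \<cdot>\<^bsub>X\<^esub> f = Ident X (Dom X f) \<and> f \<cdot>\<^bsub>X\<^esub> g = Ident X (Cod X f))"

definition zero_object :: "('o, 'm, 'x) category_scheme \<Rightarrow> 'o \<Rightarrow> bool" where
  "zero_object X Z \<longleftrightarrow> Z \<in> Obj X \<and>
     (\<forall>A \<in> Obj X. (\<exists>!f. f \<in> Hom X Z A) \<and> (\<exists>!f. f \<in> Hom X A Z))"


section \<open>Additive categories\<close>

record ('o, 'm) preadditive_category = "('o, 'm) category" +
  Add :: "'m \<Rightarrow> 'm \<Rightarrow> 'm" (infixl \<open>\<^bold>+\<index>\<close> 65)
  Zmor :: "'o \<Rightarrow> 'o \<Rightarrow> 'm"

text \<open>Abelian groups are \<open>comm_group\<close>s of HOL-Algebra, whose notation is multiplicative.\<close>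

definition HomGrp :: "('o, 'm, 'x) preadditive_category_scheme \<Rightarrow> 'o \<Rightarrow> 'o \<Rightarrow> 'm monoid" where
  "HomGrp X A B = \<lparr>carrier = Hom X A B, mult = Add X, one = Zmor X A B\<rparr>"

definition biproduct ::
  "('o, 'm, 'x) preadditive_category_scheme \<Rightarrow> 'o \<Rightarrow> 'o \<Rightarrow> 'o \<Rightarrow> 'm \<Rightarrow> 'm \<Rightarrow> 'm \<Rightarrow> 'm \<Rightarrow> bool" where
  "biproduct X A B P i j p q \<longleftrightarrow>
     i \<in> Hom X A P \<and> j \<in> Hom X B P \<and> p \<in> Hom X P A \<and> q \<in> Hom X P B \<and>
     p \<cdot>\<^bsub>X\<^esub> i = Ident X A \<and> q \<cdot>\<^bsub>X\<^esub> j = Ident X B \<and>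
     q \<cdot>\<^bsub>X\<^esub> i = Zmor X A B \<and> p \<cdot>\<^bsub>X\<^esub> j = Zmor X B A \<and>
     i \<cdot>\<^bsub>X\<^esub> p \<^bold>+\<^bsub>X\<^esub> j \<cdot>\<^bsub>X\<^esub> q = Ident X P"

locale additive_category = category X
  for X :: "('o, 'm, 'x) preadditive_category_scheme" (structure) +
  assumes Hom_group: "\<lbrakk>A \<in> Obj X; B \<in> Obj X\<rbrakk> \<Longrightarrow> comm_group (HomGrp X A B)"
    and Comp_Add: "\<lbrakk>f \<in> Hom X A B; f' \<in> Hom X A B; g \<in> Hom X B C\<rbrakk>
          \<Longrightarrow> g \<cdot> (f \<^bold>+ f') = g \<cdot> f \<^bold>+ g \<cdot> f'"
    and Add_Comp: "\<lbrakk>f \<in> Hom X A B; g \<in> Hom X B C; g' \<in> Hom X B C\<rbrakk>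
          \<Longrightarrow> (g \<^bold>+ g') \<cdot> f = g \<cdot> f \<^bold>+ g' \<cdot> f"
    and ex_zero_object: "\<exists>Z. zero_object X Z"
    and ex_biproduct: "\<lbrakk>A \<in> Obj X; B \<in> Obj X\<rbrakk> \<Longrightarrow> \<exists>P i j p q. biproduct X A B P i j p q"


section \<open>Extriangulated categories\<close>

text \<open>\<open>Ext X C A\<close> is the group \<open>\<bbbE>(C,A)\<close>, contravariant in \<open>C\<close> and covariant in \<open>A\<close>;
  \<open>ExtMap X c a\<close> is \<open>\<bbbE>(c,a)\<close>. The groups for different pairs of objects may share elements,
  so \<open>Realize X C A \<delta>\<close> is \<open>\<ss>(\<delta>)\<close> for \<open>\<delta>\<close> regarded as an element of \<open>\<bbbE>(C,A)\<close>; its value is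
  an equivalence class of sequences, as a set of pairs of arrows.\<close>

record ('o, 'm, 'e) extri_data = "('o, 'm) preadditive_category" +
  Ext :: "'o \<Rightarrow> 'o \<Rightarrow> 'e monoid"
  ExtMap :: "'m \<Rightarrow> 'm \<Rightarrow> 'e \<Rightarrow> 'e"
  Realize :: "'o \<Rightarrow> 'o \<Rightarrow> 'e \<Rightarrow> ('m \<times> 'm) set"

definition ext_bifunctor :: "('o, 'm, 'e, 'x) extri_data_scheme \<Rightarrow> bool" where
  "ext_bifunctor X \<longleftrightarrow>
     (\<forall>C \<in> Obj X. \<forall>A \<in> Obj X. comm_group (Ext X C A)) \<and>
     (\<forall>C C' A A' c a. c \<in> Hom X C' C \<and> a \<in> Hom X A A' \<longrightarrow>
        ExtMap X c a \<in> hom (Ext X C A) (Ext X C' A')) \<and>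
     (\<forall>C \<in> Obj X. \<forall>A \<in> Obj X. \<forall>\<delta> \<in> carrier (Ext X C A).
        ExtMap X (Ident X C) (Ident X A) \<delta> = \<delta>) \<and>
     (\<forall>C C' C'' A A' A'' c c' a a' \<delta>.
        c \<in> Hom X C' C \<and> c' \<in> Hom X C'' C' \<and> a \<in> Hom X A A' \<and> a' \<in> Hom X A' A'' \<and>
        \<delta> \<in> carrier (Ext X C A) \<longrightarrow>
        ExtMap X (c \<cdot>\<^bsub>X\<^esub> c') (a' \<cdot>\<^bsub>X\<^esub> a) \<delta> = ExtMap X c' a' (ExtMap X c a \<delta>))"

definition biadditive_ext :: "('o, 'm, 'e, 'x) extri_data_scheme \<Rightarrow> bool" where
  "biadditive_ext X \<longleftrightarrow>
     (\<forall>C C' A A' c a a' \<delta>.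
        c \<in> Hom X C' C \<and> a \<in> Hom X A A' \<and> a' \<in> Hom X A A' \<and> \<delta> \<in> carrier (Ext X C A) \<longrightarrow>
        ExtMap X c (a \<^bold>+\<^bsub>X\<^esub> a') \<delta> = ExtMap X c a \<delta> \<otimes>\<^bsub>Ext X C' A'\<^esub> ExtMap X c a' \<delta>) \<and>
     (\<forall>C C' A A' c c' a \<delta>.
        c \<in> Hom X C' C \<and> c' \<in> Hom X C' C \<and> a \<in> Hom X A A' \<and> \<delta> \<in> carrier (Ext X C A) \<longrightarrow>
        ExtMap X (c \<^bold>+\<^bsub>X\<^esub> c') a \<delta> = ExtMap X c a \<delta> \<otimes>\<^bsub>Ext X C' A'\<^esub> ExtMap X c' a \<delta>)"

text \<open>\<open>push X C a \<delta>\<close> is \<open>a\<^sub>*\<delta>\<close> and \<open>pull X A c \<delta>\<close> is \<open>c\<^sup>*\<delta>\<close>, for \<open>\<delta> \<in> \<bbbE>(C,A)\<close>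
  (resp. \<open>\<delta> \<in> \<bbbE>(Cod c,A)\<close>).\<close>

abbreviation push :: "('o, 'm, 'e, 'x) extri_data_scheme \<Rightarrow> 'o \<Rightarrow> 'm \<Rightarrow> 'e \<Rightarrow> 'e" where
  "push X C a \<equiv> ExtMap X (Ident X C) a"

abbreviation pull :: "('o, 'm, 'e, 'x) extri_data_scheme \<Rightarrow> 'o \<Rightarrow> 'm \<Rightarrow> 'e \<Rightarrow> 'e" where
  "pull X A c \<equiv> ExtMap X c (Ident X A)"

definition ext_morphism ::
  "('o, 'm, 'e, 'x) extri_data_scheme \<Rightarrow> 'm \<Rightarrow> 'm \<Rightarrow> 'e \<Rightarrow> 'e \<Rightarrow> bool" where
  "ext_morphism X a c \<delta> \<delta>' \<longleftrightarrow> a \<in> Arr X \<and> c \<in> Arr X \<and>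
     \<delta> \<in> carrier (Ext X (Dom X c) (Dom X a)) \<and> \<delta>' \<in> carrier (Ext X (Cod X c) (Cod X a)) \<and>
     push X (Dom X c) a \<delta> = pull X (Cod X a) c \<delta>'"

definition is_sequence ::
  "('o, 'm, 'x) category_scheme \<Rightarrow> 'o \<Rightarrow> 'o \<Rightarrow> 'o \<Rightarrow> 'm \<Rightarrow> 'm \<Rightarrow> bool" where
  "is_sequence X A B C x y \<longleftrightarrow> x \<in> Hom X A B \<and> y \<in> Hom X B C"

definition seq_class :: "('o, 'm, 'x) category_scheme \<Rightarrow> 'm \<Rightarrow> 'm \<Rightarrow> ('m \<times> 'm) set" where
  "seq_class X x y =
     {(x', y'). \<exists>B'. is_sequence X (Dom X x) B' (Cod X y) x' y' \<and>
        (\<exists>b \<in> Hom X (Cod X x) B'. iso_arr X b \<and> b \<cdot>\<^bsub>X\<^esub> x = x' \<and> y' \<cdot>\<^bsub>X\<^esub> b = y)}"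

text \<open>Since \<open>\<ss>(\<delta>)\<close> is an equivalence class, \<open>\<ss>(\<delta>) = [A \<rightarrow> B \<rightarrow> C]\<close> is expressed by membership.\<close>

definition triangle ::
  "('o, 'm, 'e, 'x) extri_data_scheme \<Rightarrow> 'o \<Rightarrow> 'o \<Rightarrow> 'o \<Rightarrow> 'm \<Rightarrow> 'm \<Rightarrow> 'e \<Rightarrow> bool" where
  "triangle X A B C x y \<delta> \<longleftrightarrow> is_sequence X A B C x y \<and>
     \<delta> \<in> carrier (Ext X C A) \<and> (x, y) \<in> Realize X C A \<delta>"

definition realization :: "('o, 'm, 'e, 'x) extri_data_scheme \<Rightarrow> bool" where
  "realization X \<longleftrightarrow>
     (\<forall>C \<in> Obj X. \<forall>A \<in> Obj X. \<forall>\<delta> \<in> carrier (Ext X C A).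
        \<exists>B x y. is_sequence X A B C x y \<and> Realize X C A \<delta> = seq_class X x y) \<and>
     (\<forall>A B C x y \<delta> A' B' C' x' y' \<delta>' a c.
        triangle X A B C x y \<delta> \<and> triangle X A' B' C' x' y' \<delta>' \<and>
        a \<in> Hom X A A' \<and> c \<in> Hom X C C' \<and> ext_morphism X a c \<delta> \<delta>' \<longrightarrow>
        (\<exists>b \<in> Hom X B B'. b \<cdot>\<^bsub>X\<^esub> x = x' \<cdot>\<^bsub>X\<^esub> a \<and> y' \<cdot>\<^bsub>X\<^esub> b = c \<cdot>\<^bsub>X\<^esub> y))"

text \<open>In the direct-sum clause, the biproducts of \<open>A, A'\<close>, of \<open>B, B'\<close> and of \<open>C, C'\<close> have index
  \<open>A\<close>, \<open>B\<close>, \<open>C\<close>, and \<open>\<epsilon>\<close> is \<open>\<delta> \<oplus> \<delta>'\<close>, the element with components \<open>(\<delta>, 0, 0, \<delta>')\<close>.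
  Clauses are required for every choice of biproducts.\<close>

definition additive_realization :: "('o, 'm, 'e, 'x) extri_data_scheme \<Rightarrow> bool" where
  "additive_realization X \<longleftrightarrow> realization X \<and>
     (\<forall>A C P i j p q. A \<in> Obj X \<and> C \<in> Obj X \<and> biproduct X A C P i j p q \<longrightarrow>
        Realize X C A \<one>\<^bsub>Ext X C A\<^esub> = seq_class X i q) \<and>
     (\<forall>A B C x y \<delta> A' B' C' x' y' \<delta>'
        PA iA jA pA qA PB iB jB pB qB PC iC jC pC qC \<epsilon>.
        triangle X A B C x y \<delta> \<and> triangle X A' B' C' x' y' \<delta>' \<and>
        biproduct X A A' PA iA jA pA qA \<and>
        biproduct X B B' PB iB jB pB qB \<and>
        biproduct X C C' PC iC jC pC qC \<and>
        \<epsilon> \<in> carrier (Ext X PC PA) \<and>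
        ExtMap X iC pA \<epsilon> = \<delta> \<and> ExtMap X iC qA \<epsilon> = \<one>\<^bsub>Ext X C A'\<^esub> \<and>
        ExtMap X jC pA \<epsilon> = \<one>\<^bsub>Ext X C' A\<^esub> \<and> ExtMap X jC qA \<epsilon> = \<delta>' \<longrightarrow>
        Realize X PC PA \<epsilon> =
          seq_class X (iB \<cdot>\<^bsub>X\<^esub> x \<cdot>\<^bsub>X\<^esub> pA \<^bold>+\<^bsub>X\<^esub> jB \<cdot>\<^bsub>X\<^esub> x' \<cdot>\<^bsub>X\<^esub> qA)
                      (iC \<cdot>\<^bsub>X\<^esub> y \<cdot>\<^bsub>X\<^esub> pB \<^bold>+\<^bsub>X\<^esub> jC \<cdot>\<^bsub>X\<^esub> y' \<cdot>\<^bsub>X\<^esub> qB))"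

locale extriangulated_category = additive_category X
  for X :: "('o, 'm, 'e, 'x) extri_data_scheme" (structure) +
  assumes Ext_bifunctor: "ext_bifunctor X"
    and ET1: "biadditive_ext X"
    and ET2: "additive_realization X"
    and ET3:
      "\<lbrakk>triangle X A B C x y \<delta>; triangle X A' B' C' x' y' \<delta>';
        a \<in> Hom X A A'; b \<in> Hom X B B'; b \<cdot> x = x' \<cdot> a\<rbrakk>
       \<Longrightarrow> \<exists>c \<in> Hom X C C'. ext_morphism X a c \<delta> \<delta>' \<and> y' \<cdot> b = c \<cdot> y"
    and ET3_op:
      "\<lbrakk>triangle X A B C x y \<delta>; triangle X A' B' C' x' y' \<delta>';
        b \<in> Hom X B B'; c \<in> Hom X C C'; y' \<cdot> b = c \<cdot> y\<rbrakk>
       \<Longrightarrow> \<exists>a \<in> Hom X A A'. ext_morphism X a c \<delta> \<delta>' \<and> b \<cdot> x = x' \<cdot> a"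
    and ET4:
      "\<lbrakk>triangle X A B D f f' \<delta>; triangle X B C F g g' \<delta>'\<rbrakk>
       \<Longrightarrow> \<exists>E h' \<delta>'' d e.
             triangle X A C E (g \<cdot> f) h' \<delta>'' \<and>
             d \<in> Hom X D E \<and> e \<in> Hom X E F \<and>
             d \<cdot> f' = h' \<cdot> g \<and> e \<cdot> h' = g' \<and>
             triangle X D E F d e (push X F f' \<delta>') \<and>
             pull X A d \<delta>'' = \<delta> \<and>
             push X E f \<delta>'' = pull X B e \<delta>'"
    and ET4_op:
      "\<lbrakk>triangle X D A B f' f \<delta>; triangle X F B C g' g \<delta>'\<rbrakk>
       \<Longrightarrow> \<exists>E h' \<delta>'' d e.
             triangle X E A C h' (g \<cdot> f) \<delta>'' \<and>
             d \<in> Hom X D E \<and> e \<in> Hom X E F \<and>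
             h' \<cdot> d = f' \<and> f \<cdot> h' = g' \<cdot> e \<and>
             triangle X D E F d e (pull X D g' \<delta>) \<and>
             \<delta>' = push X C e \<delta>'' \<and>
             push X B d \<delta> = pull X E g \<delta>''"

definition conflation ::
  "('o, 'm, 'e, 'x) extri_data_scheme \<Rightarrow> 'o \<Rightarrow> 'o \<Rightarrow> 'o \<Rightarrow> 'm \<Rightarrow> 'm \<Rightarrow> bool" where
  "conflation X A B C x y \<longleftrightarrow> (\<exists>\<delta>. triangle X A B C x y \<delta>)"

definition inflation :: "('o, 'm, 'e, 'x) extri_data_scheme \<Rightarrow> 'm \<Rightarrow> bool" where
  "inflation X f \<longleftrightarrow> (\<exists>A B C y. conflation X A B C f y)"

definition deflation :: "('o, 'm, 'e, 'x) extri_data_scheme \<Rightarrow> 'm \<Rightarrow> bool" where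
  "deflation X f \<longleftrightarrow> (\<exists>A B C x. conflation X A B C x f)"

definition WIC :: "('o, 'm, 'e, 'x) extri_data_scheme \<Rightarrow> bool" where
  "WIC X \<longleftrightarrow>
     (\<forall>A B C f g. f \<in> Hom X A B \<and> g \<in> Hom X B C \<longrightarrow>
        (inflation X (g \<cdot>\<^bsub>X\<^esub> f) \<longrightarrow> inflation X f) \<and>
        (deflation X (g \<cdot>\<^bsub>X\<^esub> f) \<longrightarrow> deflation X g))"

text \<open>\<open>Cone(f)\<close> and \<open>CoCone(f)\<close> are determined up to isomorphism only, hence relations.\<close>

definition is_Cone :: "('o, 'm, 'e, 'x) extri_data_scheme \<Rightarrow> 'm \<Rightarrow> 'o \<Rightarrow> bool" where
  "is_Cone X f C \<longleftrightarrow> (\<exists>A B y. conflation X A B C f y)"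

definition is_CoCone :: "('o, 'm, 'e, 'x) extri_data_scheme \<Rightarrow> 'm \<Rightarrow> 'o \<Rightarrow> bool" where
  "is_CoCone X f K \<longleftrightarrow> (\<exists>A B x. conflation X K A B x f)"

definition inflations_with_Cone_in ::
  "('o, 'm, 'e, 'x) extri_data_scheme \<Rightarrow> 'o set \<Rightarrow> 'm set" where
  "inflations_with_Cone_in X \<U> = {f \<in> Arr X. inflation X f \<and> (\<exists>C \<in> \<U>. is_Cone X f C)}"

definition deflations_with_CoCone_in ::
  "('o, 'm, 'e, 'x) extri_data_scheme \<Rightarrow> 'o set \<Rightarrow> 'm set" where
  "deflations_with_CoCone_in X \<V> = {f \<in> Arr X. deflation X f \<and> (\<exists>K \<in> \<V>. is_CoCone X f K)}"


section \<open>Cotorsion pairs\<close>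

text \<open>Full subcategories are given by their sets of objects.\<close>

definition additive_subcategory ::
  "('o, 'm, 'x) preadditive_category_scheme \<Rightarrow> 'o set \<Rightarrow> bool" where
  "additive_subcategory X \<U> \<longleftrightarrow> \<U> \<subseteq> Obj X \<and>
     (\<exists>Z \<in> \<U>. zero_object X Z) \<and>
     (\<forall>A \<in> \<U>. \<forall>B \<in> \<U>. \<exists>P \<in> \<U>. \<exists>i j p q. biproduct X A B P i j p q)"

definition closed_under_isos :: "('o, 'm, 'x) category_scheme \<Rightarrow> 'o set \<Rightarrow> bool" where
  "closed_under_isos X \<U> \<longleftrightarrow> (\<forall>f. iso_arr X f \<and> Dom X f \<in> \<U> \<longrightarrow> Cod X f \<in> \<U>)"

definition closed_under_summands ::
  "('o, 'm, 'x) preadditive_category_scheme \<Rightarrow> 'o set \<Rightarrow> bool" where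
  "closed_under_summands X \<U> \<longleftrightarrow>
     (\<forall>A B P i j p q. A \<in> Obj X \<and> B \<in> Obj X \<and> biproduct X A B P i j p q \<and> P \<in> \<U>
        \<longrightarrow> A \<in> \<U> \<and> B \<in> \<U>)"

definition Ext_vanishes ::
  "('o, 'm, 'e, 'x) extri_data_scheme \<Rightarrow> 'o set \<Rightarrow> 'o set \<Rightarrow> bool" where
  "Ext_vanishes X \<U> \<V> \<longleftrightarrow> (\<forall>U \<in> \<U>. \<forall>V \<in> \<V>. carrier (Ext X U V) = {\<one>\<^bsub>Ext X U V\<^esub>})"

fun cotorsion_pair :: "('o, 'm, 'e, 'x) extri_data_scheme \<Rightarrow> 'o set \<times> 'o set \<Rightarrow> bool" where
  "cotorsion_pair X (\<U>, \<V>) \<longleftrightarrow>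
     additive_subcategory X \<U> \<and> closed_under_isos X \<U> \<and> closed_under_summands X \<U> \<and>
     additive_subcategory X \<V> \<and> closed_under_isos X \<V> \<and> closed_under_summands X \<V> \<and>
     Ext_vanishes X \<U> \<V> \<and>
     (\<forall>C \<in> Obj X. \<exists>V \<in> \<V>. \<exists>U \<in> \<U>. \<exists>x y. conflation X V U C x y) \<and>
     (\<forall>C \<in> Obj X. \<exists>V \<in> \<V>. \<exists>U \<in> \<U>. \<exists>x y. conflation X C V U x y)"

type_synonym 'o pair_of_pairs = "('o set \<times> 'o set) \<times> ('o set \<times> 'o set)"

fun twin_cotorsion_pair :: "('o, 'm, 'e, 'x) extri_data_scheme \<Rightarrow> 'o pair_of_pairs \<Rightarrow> bool" where
  "twin_cotorsion_pair X ((\<S>, \<T>), (\<U>, \<V>)) \<longleftrightarrow>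
     cotorsion_pair X (\<S>, \<T>) \<and> cotorsion_pair X (\<U>, \<V>) \<and> Ext_vanishes X \<S> \<V>"

fun N_i :: "('o, 'm, 'e, 'x) extri_data_scheme \<Rightarrow> 'o pair_of_pairs \<Rightarrow> 'o set" where
  "N_i X ((\<S>, \<T>), (\<U>, \<V>)) =
     {A \<in> Obj X. \<exists>V \<in> \<V>. \<exists>S \<in> \<S>. \<exists>x y. conflation X V S A x y}"

fun N_f :: "('o, 'm, 'e, 'x) extri_data_scheme \<Rightarrow> 'o pair_of_pairs \<Rightarrow> 'o set" where
  "N_f X ((\<S>, \<T>), (\<U>, \<V>)) =
     {A \<in> Obj X. \<exists>V \<in> \<V>. \<exists>S \<in> \<S>. \<exists>x y. conflation X A V S x y}"

definition Hovey_twin_cotorsion_pair ::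
  "('o, 'm, 'e, 'x) extri_data_scheme \<Rightarrow> 'o pair_of_pairs \<Rightarrow> bool" where
  "Hovey_twin_cotorsion_pair X \<P> \<longleftrightarrow> twin_cotorsion_pair X \<P> \<and> N_i X \<P> = N_f X \<P>"


section \<open>Model structures\<close>

definition has_lifting :: "('o, 'm, 'x) category_scheme \<Rightarrow> 'm set \<Rightarrow> 'm set \<Rightarrow> bool" where
  "has_lifting X L R \<longleftrightarrow>
     (\<forall>i \<in> L. \<forall>p \<in> R. \<forall>u \<in> Hom X (Dom X i) (Dom X p). \<forall>v \<in> Hom X (Cod X i) (Cod X p).
        p \<cdot>\<^bsub>X\<^esub> u = v \<cdot>\<^bsub>X\<^esub> i \<longrightarrow>
        (\<exists>h \<in> Hom X (Cod X i) (Dom X p). h \<cdot>\<^bsub>X\<^esub> i = u \<and> p \<cdot>\<^bsub>X\<^esub> h = v))"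

definition has_factorization :: "('o, 'm, 'x) category_scheme \<Rightarrow> 'm set \<Rightarrow> 'm set \<Rightarrow> bool" where
  "has_factorization X L R \<longleftrightarrow>
     (\<forall>f \<in> Arr X. \<exists>i \<in> L. \<exists>p \<in> R. Cod X i = Dom X p \<and> f = p \<cdot>\<^bsub>X\<^esub> i)"

definition two_out_of_three :: "('o, 'm, 'x) category_scheme \<Rightarrow> 'm set \<Rightarrow> bool" where
  "two_out_of_three X W \<longleftrightarrow>
     (\<forall>A B C f g. f \<in> Hom X A B \<and> g \<in> Hom X B C \<longrightarrow>
        (f \<in> W \<and> g \<in> W \<longrightarrow> g \<cdot>\<^bsub>X\<^esub> f \<in> W) \<and>
        (f \<in> W \<and> g \<cdot>\<^bsub>X\<^esub> f \<in> W \<longrightarrow> g \<in> W) \<and>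
        (g \<in> W \<and> g \<cdot>\<^bsub>X\<^esub> f \<in> W \<longrightarrow> f \<in> W))"

definition retract_of :: "('o, 'm, 'x) category_scheme \<Rightarrow> 'm \<Rightarrow> 'm \<Rightarrow> bool" where
  "retract_of X f g \<longleftrightarrow> f \<in> Arr X \<and> g \<in> Arr X \<and>
     (\<exists>i \<in> Hom X (Dom X f) (Dom X g). \<exists>r \<in> Hom X (Dom X g) (Dom X f).
      \<exists>j \<in> Hom X (Cod X f) (Cod X g). \<exists>s \<in> Hom X (Cod X g) (Cod X f).
        r \<cdot>\<^bsub>X\<^esub> i = Ident X (Dom X f) \<and> s \<cdot>\<^bsub>X\<^esub> j = Ident X (Cod X f) \<and>
        g \<cdot>\<^bsub>X\<^esub> i = j \<cdot>\<^bsub>X\<^esub> f \<and> f \<cdot>\<^bsub>X\<^esub> r = s \<cdot>\<^bsub>X\<^esub> g)"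

definition closed_under_retracts :: "('o, 'm, 'x) category_scheme \<Rightarrow> 'm set \<Rightarrow> bool" where
  "closed_under_retracts X W \<longleftrightarrow> (\<forall>f g. retract_of X f g \<and> g \<in> W \<longrightarrow> f \<in> W)"

text \<open>Triples are ordered \<open>(Fib, Cof, W)\<close>. Closure of the three classes under composition and
  identities is not listed, since it follows from these axioms. Factorizations are not required
  to be functorial.\<close>

type_synonym 'm class_triple = "'m set \<times> 'm set \<times> 'm set"

fun model_structure :: "('o, 'm, 'x) category_scheme \<Rightarrow> 'm class_triple \<Rightarrow> bool" where
  "model_structure X (Fib, Cof, W) \<longleftrightarrow>
     Fib \<subseteq> Arr X \<and> Cof \<subseteq> Arr X \<and> W \<subseteq> Arr X \<and>
     two_out_of_three X W \<and>
     closed_under_retracts X Fib \<and> closed_under_retracts X Cof \<and> closed_under_retracts X W \<and>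
     has_lifting X (Cof \<inter> W) Fib \<and> has_lifting X Cof (Fib \<inter> W) \<and>
     has_factorization X (Cof \<inter> W) Fib \<and> has_factorization X Cof (Fib \<inter> W)"

text \<open>The objects \<open>C\<close> with \<open>(0 \<rightarrow> C) \<in> K\<close>, resp. \<open>(C \<rightarrow> 0) \<in> K\<close>; when \<open>K\<close> is closed under
  retracts, the choice of the zero object does not matter.\<close>

definition objects_from_zero :: "('o, 'm, 'x) category_scheme \<Rightarrow> 'm set \<Rightarrow> 'o set" where
  "objects_from_zero X K = {C \<in> Obj X. \<exists>Z. zero_object X Z \<and> (\<exists>f \<in> Hom X Z C. f \<in> K)}"

definition objects_to_zero :: "('o, 'm, 'x) category_scheme \<Rightarrow> 'm set \<Rightarrow> 'o set" where
  "objects_to_zero X K = {C \<in> Obj X. \<exists>Z. zero_object X Z \<and> (\<exists>f \<in> Hom X C Z. f \<in> K)}"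

fun twin_of_model ::
  "('o, 'm, 'x) category_scheme \<Rightarrow> 'm class_triple \<Rightarrow> 'o pair_of_pairs" where
  "twin_of_model X (Fib, Cof, W) =
     ((objects_from_zero X (Cof \<inter> W), objects_to_zero X Fib),
      (objects_from_zero X Cof, objects_to_zero X (Fib \<inter> W)))"

fun admissible_model_structure ::
  "('o, 'm, 'e, 'x) extri_data_scheme \<Rightarrow> 'm class_triple \<Rightarrow> bool" where
  "admissible_model_structure X (Fib, Cof, W) \<longleftrightarrow>
     model_structure X (Fib, Cof, W) \<and>
     (case twin_of_model X (Fib, Cof, W) of ((\<S>, \<T>), (\<U>, \<V>)) \<Rightarrow>
        Cof \<inter> W = inflations_with_Cone_in X \<S> \<and>
        Fib = deflations_with_CoCone_in X \<T> \<and>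
        Cof = inflations_with_Cone_in X \<U> \<and>
        Fib \<inter> W = deflations_with_CoCone_in X \<V>)"

fun model_of_twin ::
  "('o, 'm, 'e, 'x) extri_data_scheme \<Rightarrow> 'o pair_of_pairs \<Rightarrow> 'm class_triple" where
  "model_of_twin X ((\<S>, \<T>), (\<U>, \<V>)) =
     (deflations_with_CoCone_in X \<T>,
      inflations_with_Cone_in X \<U>,
      {p \<cdot>\<^bsub>X\<^esub> i | p i. i \<in> inflations_with_Cone_in X \<S> \<and>
         p \<in> deflations_with_CoCone_in X \<V> \<and> Cod X i = Dom X p})"

end

theory Submission
  imports Defs
begin

text \<open>
  Weak pullbacks, built by realizing \<open>\<delta>\<^sub>1 \<oplus> \<delta>\<^sub>2\<close> pulled back along the diagonal and dividing by either
  summand with (ET4), replace pullbacks; together with (WIC), which makes every first factor of an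
  inflation an inflation, they yield the octahedra relating the cones of \<open>u\<close> and \<open>\<pi> u\<close>.

  From a model structure to a twin cotorsion pair: lifting makes \<open>\<bbbE>\<close> vanish, the retract argument
  applied to \<open>0 \<rightarrow> C\<close> and \<open>C \<rightarrow> 0\<close> shows that each class of objects is an \<open>\<bbbE>\<close>-orthogonal, and both \<open>\<N>\<^sup>i\<close>
  and \<open>\<N>\<^sup>f\<close> consist of the objects weakly equivalent to \<open>0\<close>.

  From a Hovey twin cotorsion pair to a model structure: \<open>\<N> = \<N>\<^sup>i = \<N>\<^sup>f\<close> satisfies
  \<open>\<U> \<inter> \<N> = \<S>\<close> and \<open>\<T> \<inter> \<N> = \<V>\<close> and contains the cone of any inflation between its objects. The
  decisive point is that \<open>p j = q i\<close> with \<open>j\<close> a cofibration, \<open>p, q \<in> wFib\<close> and \<open>i \<in> wCof\<close> forces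
  \<open>j \<in> wCof\<close>: the weak pullback of \<open>p\<close> and \<open>q\<close> receives an inflation whose cone \<open>D\<close> is an extension of
  \<open>Cone i \<in> \<S>\<close> by an object of \<open>\<V>\<close>, and \<open>Cone j\<close> is the quotient of \<open>D\<close> by an object of \<open>\<V>\<close>, so
  \<open>Cone j \<in> \<U> \<inter> \<N> = \<S>\<close>. Two-out-of-three reduces to this statement, to its dual, and to
  \<open>wCof \<circ> wFib \<subseteq> wFib \<circ> wCof\<close>, proved in the same way with a homotopy pullback.
\<close>

section \<open>Categories and additive categories\<close>

text \<open>The obstacle is that an extriangulated category has no kernels, no cokernels and no five
  lemma: (ET3), (ET4) and their duals only assert existence, so induced maps on cones are neither
  unique nor functorial. Whenever a comparison has to be invertible, it is shown to fix the
  remaining data of the conflation, which forces its deviation from the identity to square to zero.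
  All notions are self-dual. Reversing arrows sends ((S,T),(U,V)) to ((V,U),(T,S)), exchanges
  fibrations with cofibrations and preserves both N and the weak equivalences; half of the
  statements are obtained in this way. Closure of the weak equivalences under retracts does not
  follow from the closure of the single classes: a retract diagram of composites \<open>p i\<close>
  is not one of their factors. Lifting supplies maps between the middle objects, but their composite
  induces on the cone only an identity up to an error, which is absorbed by using E(U,V) = 0 and
  then E(S,T) = 0.\<close>

context category
begin

lemma HomI: "\<lbrakk>f \<in> Arr X; Dom X f = A; Cod X f = B\<rbrakk> \<Longrightarrow> f \<in> Hom X A B"
  by (simp add: Hom_def)

lemma arr_id [simp]: "A \<in> Obj X \<Longrightarrow> Ident X A \<in> Arr X"
  and dom_id [simp]: "A \<in> Obj X \<Longrightarrow> Dom X (Ident X A) = A"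
  and cod_id [simp]: "A \<in> Obj X \<Longrightarrow> Cod X (Ident X A) = A"
  using Ident_Hom by (auto simp: Hom_def)

lemma arr_comp [simp]: "\<lbrakk>f \<in> Arr X; g \<in> Arr X; Cod X f = Dom X g\<rbrakk> \<Longrightarrow> g \<cdot> f \<in> Arr X"
  and dom_comp [simp]: "\<lbrakk>f \<in> Arr X; g \<in> Arr X; Cod X f = Dom X g\<rbrakk> \<Longrightarrow> Dom X (g \<cdot> f) = Dom X f"
  and cod_comp [simp]: "\<lbrakk>f \<in> Arr X; g \<in> Arr X; Cod X f = Dom X g\<rbrakk> \<Longrightarrow> Cod X (g \<cdot> f) = Cod X g"
  using Comp_Hom[of f "Dom X f" "Cod X f" g "Cod X g"] by (auto simp: Hom_def)

lemma comp_id [simp]: "\<lbrakk>f \<in> Arr X; Dom X f = A\<rbrakk> \<Longrightarrow> f \<cdot> Ident X A = f"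
  and id_comp [simp]: "\<lbrakk>f \<in> Arr X; Cod X f = B\<rbrakk> \<Longrightarrow> Ident X B \<cdot> f = f"
  using Comp_Ident Ident_Comp by (auto simp: Hom_def)

lemma assoc [simp]: "\<lbrakk>f \<in> Arr X; g \<in> Arr X; h \<in> Arr X; Cod X f = Dom X g; Cod X g = Dom X h\<rbrakk>
    \<Longrightarrow> (h \<cdot> g) \<cdot> f = h \<cdot> (g \<cdot> f)"
  using Comp_assoc[of f "Dom X f" "Cod X f" g "Cod X g" h "Cod X h"] by (auto simp: Hom_def)

lemma Hom_obj: "f \<in> Hom X A B \<Longrightarrow> A \<in> Obj X \<and> B \<in> Obj X"
  using Dom_Obj Cod_Obj by (auto simp: Hom_def)

lemma HomD: "f \<in> Hom X A B \<Longrightarrow> f \<in> Arr X \<and> Dom X f = A \<and> Cod X f = B \<and> A \<in> Obj X \<and> B \<in> Obj X"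
  using Hom_obj by (auto simp: Hom_def)

text \<open>The simplifier nests composites to the right, which hides the redex
  \<open>g \<cdot> f\<close> inside \<open>g \<cdot> (f \<cdot> k)\<close>; carrying the tail
  \<open>k\<close> along restores it.\<close>

lemma comp_reduce: "\<lbrakk>g \<cdot> f = h; f \<in> Arr X; g \<in> Arr X; k \<in> Arr X; Cod X k = Dom X f; Cod X f = Dom X g\<rbrakk>
    \<Longrightarrow> g \<cdot> (f \<cdot> k) = h \<cdot> k"
  using assoc by metis

lemma comp_square: "\<lbrakk>g \<cdot> f = h \<cdot> l; f \<in> Arr X; g \<in> Arr X; h \<in> Arr X; l \<in> Arr X; k \<in> Arr X;
    Cod X k = Dom X f; Cod X f = Dom X g; Cod X k = Dom X l; Cod X l = Dom X h\<rbrakk>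
    \<Longrightarrow> g \<cdot> (f \<cdot> k) = h \<cdot> (l \<cdot> k)"
  using assoc by metis

lemma iso_arrI: "\<lbrakk>f \<in> Hom X A B; g \<in> Hom X B A; g \<cdot> f = Ident X A; f \<cdot> g = Ident X B\<rbrakk> \<Longrightarrow> iso_arr X f"
  unfolding iso_arr_def by (auto simp: Hom_def)

lemma iso_arrE:
  assumes "iso_arr X f" "f \<in> Hom X A B"
  obtains g where "g \<in> Hom X B A" "g \<cdot> f = Ident X A" "f \<cdot> g = Ident X B" "iso_arr X g"
proof -
  obtain g where g: "g \<in> Hom X B A" "g \<cdot> f = Ident X A" "f \<cdot> g = Ident X B"
    using assms by (auto simp: iso_arr_def Hom_def)
  moreover have "iso_arr X g" using iso_arrI[OF g(1) assms(2)] g by simp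
  ultimately show thesis using that by blast
qed

lemma iso_arr_comp:
  assumes "iso_arr X f" "f \<in> Hom X A B" "iso_arr X g" "g \<in> Hom X B C"
  shows "iso_arr X (g \<cdot> f)"
proof -
  obtain f' where f': "f' \<in> Hom X B A" "f' \<cdot> f = Ident X A" "f \<cdot> f' = Ident X B"
    using iso_arrE assms by metis
  obtain g' where g': "g' \<in> Hom X C B" "g' \<cdot> g = Ident X B" "g \<cdot> g' = Ident X C"
    using iso_arrE assms by metis
  note d = HomD[OF assms(2)] HomD[OF assms(4)] HomD[OF f'(1)] HomD[OF g'(1)]
  show ?thesis
    by (rule iso_arrI[of _ A C "f' \<cdot> g'"])
      (use d in \<open>auto simp: Hom_def f' g' comp_reduce[OF g'(2)] comp_reduce[OF f'(3)]\<close>)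
qed

lemma iso_ident [simp]: "A \<in> Obj X \<Longrightarrow> iso_arr X (Ident X A)"
  by (rule iso_arrI[of _ A A "Ident X A"]) (auto simp: Hom_def)

text \<open>The left inverse \<open>u \<cdot> g\<close> and the right inverse
  \<open>g \<cdot> v\<close> of \<open>f\<close> coincide. Comparison maps come in pairs whose
  composites are only known to be invertible, not to be identities.\<close>

lemma iso_if_inverses_of_composites:
  assumes f: "f \<in> Hom X A B" and g: "g \<in> Hom X B A"
    and i1: "iso_arr X (g \<cdot> f)" and i2: "iso_arr X (f \<cdot> g)"
  shows "iso_arr X f"
proof -
  note d = HomD[OF f] HomD[OF g]
  have "g \<cdot> f \<in> Hom X A A" "f \<cdot> g \<in> Hom X B B" using d by (auto simp: Hom_def)
  then obtain u v where u: "u \<in> Hom X A A" "u \<cdot> (g \<cdot> f) = Ident X A"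
    and v: "v \<in> Hom X B B" "(f \<cdot> g) \<cdot> v = Ident X B"
    using iso_arrE i1 i2 by metis
  note d = d HomD[OF u(1)] HomD[OF v(1)]
  have v': "f \<cdot> (g \<cdot> v) = Ident X B" using v d by simp
  have "u \<cdot> g = (u \<cdot> g) \<cdot> (f \<cdot> (g \<cdot> v))" using v' d by simp
  also have "\<dots> = (u \<cdot> (g \<cdot> f)) \<cdot> (g \<cdot> v)" using d by simp
  also have "\<dots> = g \<cdot> v" using u d by simp
  finally have "u \<cdot> g = g \<cdot> v" .
  then have "f \<cdot> (u \<cdot> g) = Ident X B" using v' by simp
  moreover have "(u \<cdot> g) \<cdot> f = Ident X A" using u(2) d by simp
  ultimately show ?thesis
    using d by (intro iso_arrI[OF f]) (auto simp: Hom_def simp del: assoc)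
qed

end

context additive_category
begin

lemma arr_zero [simp]: "\<lbrakk>A \<in> Obj X; B \<in> Obj X\<rbrakk> \<Longrightarrow> Zmor X A B \<in> Arr X"
  and dom_zero [simp]: "\<lbrakk>A \<in> Obj X; B \<in> Obj X\<rbrakk> \<Longrightarrow> Dom X (Zmor X A B) = A"
  and cod_zero [simp]: "\<lbrakk>A \<in> Obj X; B \<in> Obj X\<rbrakk> \<Longrightarrow> Cod X (Zmor X A B) = B"
proof -
  assume "A \<in> Obj X" "B \<in> Obj X"
  then interpret comm_group "HomGrp X A B" by (rule Hom_group)
  have "Zmor X A B \<in> Hom X A B" using one_closed by (simp add: HomGrp_def)
  then show "Zmor X A B \<in> Arr X" "Dom X (Zmor X A B) = A" "Cod X (Zmor X A B) = B"
    by (auto simp: Hom_def)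
qed

definition neg :: "'m \<Rightarrow> 'm" where
  "neg f = inv\<^bsub>HomGrp X (Dom X f) (Cod X f)\<^esub> f"

lemma Hom_arith:
  assumes "A \<in> Obj X" "B \<in> Obj X"
  shows "\<And>f g. \<lbrakk>f \<in> Hom X A B; g \<in> Hom X A B\<rbrakk> \<Longrightarrow> f \<^bold>+ g \<in> Hom X A B"
    and "\<And>f g. \<lbrakk>f \<in> Hom X A B; g \<in> Hom X A B\<rbrakk> \<Longrightarrow> f \<^bold>+ g = g \<^bold>+ f"
    and "\<And>f g h. \<lbrakk>f \<in> Hom X A B; g \<in> Hom X A B; h \<in> Hom X A B\<rbrakk> \<Longrightarrow> (f \<^bold>+ g) \<^bold>+ h = f \<^bold>+ (g \<^bold>+ h)"
    and "\<And>f. f \<in> Hom X A B \<Longrightarrow> Zmor X A B \<^bold>+ f = f"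
    and "\<And>f. f \<in> Hom X A B \<Longrightarrow> f \<^bold>+ Zmor X A B = f"
    and "\<And>f. f \<in> Hom X A B \<Longrightarrow> neg f \<in> Hom X A B"
    and "\<And>f. f \<in> Hom X A B \<Longrightarrow> f \<^bold>+ neg f = Zmor X A B"
    and "\<And>f g h. \<lbrakk>f \<in> Hom X A B; g \<in> Hom X A B; h \<in> Hom X A B\<rbrakk> \<Longrightarrow> f \<^bold>+ g = f \<^bold>+ h \<longleftrightarrow> g = h"
proof -
  interpret G: comm_group "HomGrp X A B" using assms by (rule Hom_group)
  note c = G.m_closed G.m_comm G.m_assoc G.l_one G.r_one G.inv_closed G.r_inv G.Units_l_cancel[unfolded G.Units_eq]
  note c' = c[unfolded HomGrp_def, simplified]
  fix f g h
  show "\<lbrakk>f \<in> Hom X A B; g \<in> Hom X A B\<rbrakk> \<Longrightarrow> f \<^bold>+ g \<in> Hom X A B"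
    "\<lbrakk>f \<in> Hom X A B; g \<in> Hom X A B\<rbrakk> \<Longrightarrow> f \<^bold>+ g = g \<^bold>+ f"
    "\<lbrakk>f \<in> Hom X A B; g \<in> Hom X A B; h \<in> Hom X A B\<rbrakk> \<Longrightarrow> (f \<^bold>+ g) \<^bold>+ h = f \<^bold>+ (g \<^bold>+ h)"
    "f \<in> Hom X A B \<Longrightarrow> Zmor X A B \<^bold>+ f = f"
    "f \<in> Hom X A B \<Longrightarrow> f \<^bold>+ Zmor X A B = f"
    using c' by auto
  show "\<lbrakk>f \<in> Hom X A B; g \<in> Hom X A B; h \<in> Hom X A B\<rbrakk> \<Longrightarrow> f \<^bold>+ g = f \<^bold>+ h \<longleftrightarrow> g = h"
    using c' by auto
  show "f \<in> Hom X A B \<Longrightarrow> neg f \<in> Hom X A B"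
    "f \<in> Hom X A B \<Longrightarrow> f \<^bold>+ neg f = Zmor X A B"
    using c' HomD[of f A B] by (auto simp: neg_def HomGrp_def)
qed

lemma arr_add [simp]: "\<lbrakk>f \<in> Arr X; g \<in> Arr X; Dom X f = Dom X g; Cod X f = Cod X g\<rbrakk> \<Longrightarrow> f \<^bold>+ g \<in> Arr X"
  and dom_add [simp]: "\<lbrakk>f \<in> Arr X; g \<in> Arr X; Dom X f = Dom X g; Cod X f = Cod X g\<rbrakk> \<Longrightarrow> Dom X (f \<^bold>+ g) = Dom X g"
  and cod_add [simp]: "\<lbrakk>f \<in> Arr X; g \<in> Arr X; Dom X f = Dom X g; Cod X f = Cod X g\<rbrakk> \<Longrightarrow> Cod X (f \<^bold>+ g) = Cod X g"
  using Hom_arith(1)[of "Dom X f" "Cod X f" f g] Dom_Obj Cod_Obj by (auto simp: Hom_def)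

lemma arr_neg [simp]: "f \<in> Arr X \<Longrightarrow> neg f \<in> Arr X"
  and dom_neg [simp]: "f \<in> Arr X \<Longrightarrow> Dom X (neg f) = Dom X f"
  and cod_neg [simp]: "f \<in> Arr X \<Longrightarrow> Cod X (neg f) = Cod X f"
  and add_neg [simp]: "f \<in> Arr X \<Longrightarrow> f \<^bold>+ neg f = Zmor X (Dom X f) (Cod X f)"
  using Hom_arith(6,7)[of "Dom X f" "Cod X f" f] Dom_Obj Cod_Obj by (auto simp: Hom_def)

lemma add_comm: "\<lbrakk>f \<in> Arr X; g \<in> Arr X; Dom X f = Dom X g; Cod X f = Cod X g\<rbrakk> \<Longrightarrow> f \<^bold>+ g = g \<^bold>+ f"
  using Hom_arith(2)[of "Dom X f" "Cod X f" f g] Dom_Obj Cod_Obj by (auto simp: Hom_def)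

lemma neg_add [simp]: "f \<in> Arr X \<Longrightarrow> neg f \<^bold>+ f = Zmor X (Dom X f) (Cod X f)"
  using add_comm[of "neg f" f] by simp

lemma add_assoc: "\<lbrakk>f \<in> Arr X; g \<in> Arr X; h \<in> Arr X; Dom X f = Dom X g; Cod X f = Cod X g; Dom X g = Dom X h; Cod X g = Cod X h\<rbrakk>
    \<Longrightarrow> (f \<^bold>+ g) \<^bold>+ h = f \<^bold>+ (g \<^bold>+ h)"
  using Hom_arith(3)[of "Dom X f" "Cod X f" f g h] Dom_Obj Cod_Obj by (auto simp: Hom_def)

lemma zero_add [simp]: "\<lbrakk>f \<in> Arr X; Dom X f = A; Cod X f = B\<rbrakk> \<Longrightarrow> Zmor X A B \<^bold>+ f = f"
  and add_zero [simp]: "\<lbrakk>f \<in> Arr X; Dom X f = A; Cod X f = B\<rbrakk> \<Longrightarrow> f \<^bold>+ Zmor X A B = f"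
  using Hom_arith(4,5)[of "Dom X f" "Cod X f" f] Dom_Obj Cod_Obj by (auto simp: Hom_def)

lemma add_cancel: "\<lbrakk>f \<^bold>+ g = f \<^bold>+ h; f \<in> Arr X; g \<in> Arr X; h \<in> Arr X; Dom X f = Dom X g; Cod X f = Cod X g; Dom X f = Dom X h; Cod X f = Cod X h\<rbrakk>
    \<Longrightarrow> g = h"
  using Hom_arith(8)[of "Dom X f" "Cod X f" f g h] Dom_Obj Cod_Obj by (auto simp: Hom_def)

lemma add_eq_self: "\<lbrakk>f \<^bold>+ g = f; f \<in> Arr X; g \<in> Arr X; Dom X g = A; Cod X g = B; Dom X f = A; Cod X f = B\<rbrakk>
    \<Longrightarrow> g = Zmor X A B"
  by (rule add_cancel[of f]) (auto simp: Dom_Obj Cod_Obj)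

lemma comp_add [simp]: "\<lbrakk>f \<in> Arr X; g \<in> Arr X; h \<in> Arr X; Dom X f = Dom X g; Cod X f = Cod X g; Cod X g = Dom X h\<rbrakk>
    \<Longrightarrow> h \<cdot> (f \<^bold>+ g) = h \<cdot> f \<^bold>+ h \<cdot> g"
  using Comp_Add[of f "Dom X f" "Cod X f" g h "Cod X h"] by (auto simp: Hom_def)

lemma add_comp [simp]: "\<lbrakk>f \<in> Arr X; g \<in> Arr X; h \<in> Arr X; Dom X f = Dom X g; Cod X f = Cod X g; Cod X h = Dom X g\<rbrakk>
    \<Longrightarrow> (f \<^bold>+ g) \<cdot> h = f \<cdot> h \<^bold>+ g \<cdot> h"
  using Add_Comp[of h "Dom X h" "Cod X h" f "Cod X f" g] by (auto simp: Hom_def)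

lemma comp_zero [simp]: assumes "f \<in> Arr X" "Dom X f = B" "A \<in> Obj X"
  shows "f \<cdot> Zmor X A B = Zmor X A (Cod X f)"
proof -
  have o: "B \<in> Obj X" using assms Dom_Obj by auto
  show ?thesis
  proof (rule add_eq_self)
    show "f \<cdot> Zmor X A B \<^bold>+ f \<cdot> Zmor X A B = f \<cdot> Zmor X A B"
      using comp_add[of "Zmor X A B" "Zmor X A B" f] assms o by (simp del: comp_add)
  qed (use assms o in auto)
qed

lemma zero_comp [simp]: assumes "f \<in> Arr X" "Cod X f = A" "B \<in> Obj X"
  shows "Zmor X A B \<cdot> f = Zmor X (Dom X f) B"
proof -
  have o: "A \<in> Obj X" using assms Cod_Obj by auto
  show ?thesis
  proof (rule add_eq_self)
    show "Zmor X A B \<cdot> f \<^bold>+ Zmor X A B \<cdot> f = Zmor X A B \<cdot> f"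
      using add_comp[of "Zmor X A B" "Zmor X A B" f] assms o by (simp del: add_comp)
  qed (use assms o in auto)
qed

lemma comp_neg [simp]: assumes "f \<in> Arr X" "g \<in> Arr X" "Cod X f = Dom X g"
  shows "g \<cdot> neg f = neg (g \<cdot> f)"
proof -
  have o: "Dom X f \<in> Obj X" using assms Dom_Obj by auto
  show ?thesis
    by (rule add_cancel[of "g \<cdot> f"]) (use assms comp_add[of f "neg f" g] o in \<open>auto simp del: comp_add\<close>)
qed

lemma neg_comp [simp]: assumes "f \<in> Arr X" "g \<in> Arr X" "Cod X f = Dom X g"
  shows "neg g \<cdot> f = neg (g \<cdot> f)"
proof -
  have o: "Cod X g \<in> Obj X" using assms Cod_Obj by auto
  show ?thesis
    by (rule add_cancel[of "g \<cdot> f"]) (use assms add_comp[of g "neg g" f] o in \<open>auto simp del: add_comp\<close>)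
qed

lemma neg_neg [simp]: "f \<in> Arr X \<Longrightarrow> neg (neg f) = f"
  by (rule add_cancel[of "neg f"]) (auto simp: add_comm[of "neg f" f])

lemma neg_zero [simp]: "\<lbrakk>A \<in> Obj X; B \<in> Obj X\<rbrakk> \<Longrightarrow> neg (Zmor X A B) = Zmor X A B"
  by (rule add_cancel[of "Zmor X A B"]) auto

lemma difference:
  assumes "f \<in> Hom X A B" "g \<in> Hom X A B"
  obtains h where "h \<in> Hom X A B" "f = g \<^bold>+ h"
proof -
  note d = HomD[OF assms(1)] HomD[OF assms(2)]
  have "g \<^bold>+ (neg g \<^bold>+ f) = f" using d by (simp add: add_assoc[symmetric])
  then show thesis using that[of "neg g \<^bold>+ f"] d by (auto simp: Hom_def)
qed

lemma zero_object_Obj: "zero_object X Z \<Longrightarrow> Z \<in> Obj X"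
  by (simp add: zero_object_def)

lemma zero_object_from: "\<lbrakk>zero_object X Z; f \<in> Hom X Z A\<rbrakk> \<Longrightarrow> f = Zmor X Z A"
  using HomD[of f Z A] HomI[of "Zmor X Z A" Z A] by (auto simp: zero_object_def)

lemma zero_object_ident: "zero_object X Z \<Longrightarrow> Ident X Z = Zmor X Z Z"
  by (simp add: Ident_Hom zero_object_Obj zero_object_from)

lemma biproductD:
  assumes "biproduct X A B P i j p q"
  shows "i \<in> Arr X \<and> Dom X i = A \<and> Cod X i = P \<and> j \<in> Arr X \<and> Dom X j = B \<and> Cod X j = P \<and>
    p \<in> Arr X \<and> Dom X p = P \<and> Cod X p = A \<and> q \<in> Arr X \<and> Dom X q = P \<and> Cod X q = B \<and>
    A \<in> Obj X \<and> B \<in> Obj X \<and> P \<in> Obj X"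
  using assms HomD[of i A P] HomD[of j B P] HomD[of p P A] HomD[of q P B]
  unfolding biproduct_def by blast

lemma biproduct_eqs:
  assumes "biproduct X A B P i j p q"
  shows "p \<cdot> i = Ident X A" "q \<cdot> j = Ident X B" "q \<cdot> i = Zmor X A B" "p \<cdot> j = Zmor X B A"
    "i \<cdot> p \<^bold>+ j \<cdot> q = Ident X P"
  using assms unfolding biproduct_def by auto

lemma biproduct_swap: assumes "biproduct X A B P i j p q" shows "biproduct X B A P j i q p"
proof -
  note d = biproductD[OF assms]
  have "j \<cdot> q \<^bold>+ i \<cdot> p = Ident X P"
    by (subst add_comm) (use d biproduct_eqs(5)[OF assms] in simp_all)
  then show ?thesis using assms unfolding biproduct_def by blast
qed

text \<open>Only the legs \<open>i\<close> and \<open>q\<close> are tracked, since they form the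
  split sequence; the other two are transported by \<open>b\<close> and its inverse.\<close>

lemma biproduct_iso:
  assumes bp: "biproduct X A B P i j p q" and b: "iso_arr X b" "b \<in> Hom X P Q"
    and that: "q' \<in> Hom X Q B" "q' \<cdot> b = q"
  shows "\<exists>j' p'. biproduct X A B Q (b \<cdot> i) j' p' q'"
proof -
  obtain c where c: "c \<in> Hom X Q P" "c \<cdot> b = Ident X P" "b \<cdot> c = Ident X Q"
    using iso_arrE b by metis
  note d = biproductD[OF bp] HomD[OF b(2)] HomD[OF c(1)] HomD[OF that(1)]
  have q': "q' = q \<cdot> c"
    using c d assoc[of c b q'] that by simp
  have "b \<cdot> (i \<cdot> (p \<cdot> c)) \<^bold>+ b \<cdot> (j \<cdot> (q \<cdot> c)) = b \<cdot> ((i \<cdot> p \<^bold>+ j \<cdot> q) \<cdot> c)"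
    using d by simp
  also have "\<dots> = Ident X Q" using d c biproduct_eqs(5)[OF bp] by simp
  finally have s: "b \<cdot> (i \<cdot> (p \<cdot> c)) \<^bold>+ b \<cdot> (j \<cdot> (q \<cdot> c)) = Ident X Q" .
  have "biproduct X A B Q (b \<cdot> i) (b \<cdot> j) (p \<cdot> c) (q \<cdot> c)"
    unfolding biproduct_def using d s by (auto simp: Hom_def biproduct_eqs[OF bp] comp_reduce[OF c(2)])
  then show ?thesis using q' by blast
qed

lemma biproduct_zero_right: "\<lbrakk>A \<in> Obj X; zero_object X Z\<rbrakk>
    \<Longrightarrow> biproduct X A Z A (Ident X A) (Zmor X Z A) (Ident X A) (Zmor X A Z)"
  using zero_object_Obj[of Z] by (auto simp: biproduct_def Hom_def zero_object_ident)

lemma biproduct_zero_left: "\<lbrakk>A \<in> Obj X; zero_object X Z\<rbrakk>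
    \<Longrightarrow> biproduct X Z A A (Zmor X Z A) (Ident X A) (Zmor X A Z) (Ident X A)"
  using biproduct_swap biproduct_zero_right by blast

text \<open>Stands in for the five lemma: the defect \<open>n = 1 - w\<close> of an endomorphism of a conflation that is
  the identity elsewhere factors on both sides and hence squares to zero.\<close>

lemma iso_if_square_zero_defect:
  assumes w: "w \<in> Hom X A A" and n: "n \<in> Hom X A A" "Ident X A = w \<^bold>+ n" "n \<cdot> n = Zmor X A A"
  shows "iso_arr X w"
proof -
  note d = HomD[OF w] HomD[OF n(1)]
  have "w \<cdot> n \<^bold>+ n \<cdot> n = (w \<^bold>+ n) \<cdot> n" "n \<cdot> w \<^bold>+ n \<cdot> n = n \<cdot> (w \<^bold>+ n)"
    using d by simp_all
  then have "w \<cdot> n = n" "n \<cdot> w = n" using n(3) d by (simp_all add: n(2)[symmetric])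
  \<comment> \<open>\<open>1 + n\<close> inverts \<open>w = 1 - n\<close>, as for any square-zero
    \<open>n\<close>.\<close>
  then have "w \<cdot> (Ident X A \<^bold>+ n) = Ident X A" "(Ident X A \<^bold>+ n) \<cdot> w = Ident X A"
    using d by (simp_all add: n(2)[symmetric])
  then show ?thesis
    using d by (intro iso_arrI[OF w, of "Ident X A \<^bold>+ n"]) (auto simp: Hom_def)
qed

end

section \<open>The opposite extriangulated category\<close>

text \<open>Reversing arrows swaps the two arguments of \<open>Ext\<close> and \<open>ExtMap\<close>
  and reads realizing sequences backwards, so (ET3) and (ET4) trade places with their duals. With
  the rewrite rules that follow, a dual statement is obtained by instantiating at
  \<open>op_data X\<close> and simplifying.\<close>

definition op_data :: "('o, 'm, 'e, 'x) extri_data_scheme \<Rightarrow> ('o, 'm, 'e) extri_data" where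
  "op_data X = \<lparr>Obj = Obj X, Arr = Arr X, Dom = Cod X, Cod = Dom X, Ident = Ident X,
     Comp = (\<lambda>g f. f \<cdot>\<^bsub>X\<^esub> g), Add = Add X, Zmor = (\<lambda>A B. Zmor X B A),
     Ext = (\<lambda>C A. Ext X A C), ExtMap = (\<lambda>c a. ExtMap X a c),
     Realize = (\<lambda>C A \<delta>. prod.swap ` Realize X A C \<delta>)\<rparr>"

lemma op_data_simps [simp]:
  "Obj (op_data X) = Obj X" "Arr (op_data X) = Arr X" "Dom (op_data X) = Cod X"
  "Cod (op_data X) = Dom X" "Ident (op_data X) = Ident X" "Comp (op_data X) g f = f \<cdot>\<^bsub>X\<^esub> g"
  "Add (op_data X) = Add X" "Zmor (op_data X) A B = Zmor X B A" "Ext (op_data X) C A = Ext X A C"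
  "ExtMap (op_data X) c a = ExtMap X a c"
  "Realize (op_data X) C A \<delta> = prod.swap ` Realize X A C \<delta>"
  by (simp_all add: op_data_def)

lemma Hom_op [simp]: "Hom (op_data X) A B = Hom X B A"
  by (auto simp: Hom_def)

lemma HomGrp_op [simp]: "HomGrp (op_data X) A B = HomGrp X B A"
  by (simp add: HomGrp_def)

lemma iso_arr_op [simp]: "iso_arr (op_data X) f \<longleftrightarrow> iso_arr X f"
  by (auto simp: iso_arr_def)

lemma zero_object_op [simp]: "zero_object (op_data X) Z \<longleftrightarrow> zero_object X Z"
  by (auto simp: zero_object_def)

lemma biproduct_op [simp]: "biproduct (op_data X) A B P i j p q \<longleftrightarrow> biproduct X A B P p q i j"
  by (auto simp: biproduct_def)

lemma triangle_op [simp]: "triangle (op_data X) A B C x y \<delta> \<longleftrightarrow> triangle X C B A y x \<delta>"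
  by (auto simp: triangle_def is_sequence_def)

lemma ext_morphism_op [simp]: "ext_morphism (op_data X) a c \<delta> \<delta>' \<longleftrightarrow> ext_morphism X c a \<delta>' \<delta>"
  by (auto simp: ext_morphism_def)

lemma conflation_op [simp]: "conflation (op_data X) A B C x y \<longleftrightarrow> conflation X C B A y x"
  by (simp add: conflation_def)

lemma inflation_op [simp]: "inflation (op_data X) f \<longleftrightarrow> deflation X f"
  by (auto simp: inflation_def deflation_def)

lemma deflation_op [simp]: "deflation (op_data X) f \<longleftrightarrow> inflation X f"
  by (auto simp: inflation_def deflation_def)

lemma WIC_op [simp]: "WIC (op_data X) \<longleftrightarrow> WIC X"
  unfolding WIC_def by auto

context extriangulated_category
begin

text \<open>The isomorphism in \<open>seq_class\<close> points from the representative to the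
  member. Reversal turns it around, hence the inverse \<open>c\<close> in both directions.\<close>

lemma seq_class_op:
  assumes x: "x \<in> Hom X B A" and y: "y \<in> Hom X C B"
  shows "seq_class (op_data X) x y = prod.swap ` seq_class X y x"
proof -
  note d = HomD[OF x] HomD[OF y]
  have "(x', y') \<in> seq_class (op_data X) x y \<longleftrightarrow> (y', x') \<in> seq_class X y x" for x' y'
  proof
    assume "(x', y') \<in> seq_class (op_data X) x y"
    then obtain B' b where h: "x' \<in> Hom X B' A" "y' \<in> Hom X C B'" "b \<in> Hom X B' B" "iso_arr X b"
       "x \<cdot> b = x'" "b \<cdot> y' = y"
      using d by (auto simp: seq_class_def is_sequence_def)
    obtain c where c: "c \<in> Hom X B B'" "c \<cdot> b = Ident X B'" "b \<cdot> c = Ident X B" "iso_arr X c"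
      using iso_arrE[OF h(4,3)] by metis
    note dd = d HomD[OF h(1)] HomD[OF h(2)] HomD[OF h(3)] HomD[OF c(1)]
    have "c \<cdot> y = y'" using dd comp_reduce[OF c(2), of y'] by (simp flip: h(6))
    moreover have "x' \<cdot> c = x" using dd c(3) by (simp flip: h(5))
    ultimately show "(y', x') \<in> seq_class X y x"
      using c h d by (auto simp: seq_class_def is_sequence_def intro!: exI[of _ B'] bexI[of _ c])
  next
    assume "(y', x') \<in> seq_class X y x"
    then obtain B' b where h: "x' \<in> Hom X B' A" "y' \<in> Hom X C B'" "b \<in> Hom X B B'" "iso_arr X b"
       "b \<cdot> y = y'" "x' \<cdot> b = x"
      using d by (auto simp: seq_class_def is_sequence_def)
    obtain c where c: "c \<in> Hom X B' B" "c \<cdot> b = Ident X B" "b \<cdot> c = Ident X B'" "iso_arr X c"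
      using iso_arrE[OF h(4,3)] by metis
    note dd = d HomD[OF h(1)] HomD[OF h(2)] HomD[OF h(3)] HomD[OF c(1)]
    have "c \<cdot> y' = y" using dd comp_reduce[OF c(2), of y] by (simp flip: h(5))
    moreover have "x \<cdot> c = x'" using dd c(3) by (simp flip: h(6))
    ultimately show "(x', y') \<in> seq_class (op_data X) x y"
      using c h d by (auto simp: seq_class_def is_sequence_def intro!: exI[of _ B'] bexI[of _ c])
  qed
  then show ?thesis by (force simp: image_iff)
qed

lemma additive_category_op: fixes Y defines "Y \<equiv> op_data X" shows "additive_category Y"
  unfolding Y_def
proof (intro additive_category.intro category.intro additive_category_axioms.intro, goal_cases)
  case (1 f) then show ?case using Cod_Obj by simp
next
  case (2 f) then show ?case using Dom_Obj by simp
next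
  case (3 A) then show ?case using Ident_Hom by simp
next
  case (4 f A B g C) then show ?case using Comp_Hom by simp
next
  case (5 f A B) then show ?case using Ident_Comp by simp
next
  case (6 f A B) then show ?case using Comp_Ident by simp
next
  case (7 f A B g C h D) then show ?case using Comp_assoc[of h D C g B f A] by simp
next
  case (8 A B) then show ?case using Hom_group by simp
next
  case (9 f A B f' g C) then show ?case using Add_Comp[of g C B f A f'] by simp
next
  case (10 f A B g C g') then show ?case using Comp_Add[of g C B g' f A] by simp
next
  case 11 then show ?case using ex_zero_object by simp
next
  case (12 A B)
  then obtain P i j p q where "biproduct X A B P i j p q" using ex_biproduct by fastforce
  then have "biproduct (op_data X) A B P p q i j" by simp
  then show ?case by blast
qed

section \<open>Arithmetic in the extension groups\<close>

abbreviation null :: "'o \<Rightarrow> 'o \<Rightarrow> 'e" where "null C A \<equiv> \<one>\<^bsub>Ext X C A\<^esub>"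

lemma Ext_group: "\<lbrakk>C \<in> Obj X; A \<in> Obj X\<rbrakk> \<Longrightarrow> comm_group (Ext X C A)"
  using Ext_bifunctor unfolding ext_bifunctor_def by simp

lemma ExtMap_hom: "\<lbrakk>c \<in> Hom X C' C; a \<in> Hom X A A'\<rbrakk> \<Longrightarrow> ExtMap X c a \<in> hom (Ext X C A) (Ext X C' A')"
  using Ext_bifunctor unfolding ext_bifunctor_def by blast

lemma Ext_grp: "\<lbrakk>C \<in> Obj X; A \<in> Obj X\<rbrakk> \<Longrightarrow> group (Ext X C A)"
  by (rule comm_group.axioms(2)[OF Ext_group])

lemma Ext_monoid: "\<lbrakk>C \<in> Obj X; A \<in> Obj X\<rbrakk> \<Longrightarrow> monoid (Ext X C A)"
  by (rule group.is_monoid[OF comm_group.axioms(2)[OF Ext_group]])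

lemma null_closed [simp]: "\<lbrakk>C \<in> Obj X; A \<in> Obj X\<rbrakk> \<Longrightarrow> null C A \<in> carrier (Ext X C A)"
  by (rule monoid.one_closed[OF Ext_monoid])

lemma ext_mult_closed [simp]:
  "\<lbrakk>C \<in> Obj X; A \<in> Obj X; d \<in> carrier (Ext X C A); e \<in> carrier (Ext X C A)\<rbrakk>
    \<Longrightarrow> d \<otimes>\<^bsub>Ext X C A\<^esub> e \<in> carrier (Ext X C A)"
  by (rule monoid.m_closed[OF Ext_monoid])

lemma null_mult [simp]:
  "\<lbrakk>C \<in> Obj X; A \<in> Obj X; d \<in> carrier (Ext X C A)\<rbrakk> \<Longrightarrow> null C A \<otimes>\<^bsub>Ext X C A\<^esub> d = d"
  "\<lbrakk>C \<in> Obj X; A \<in> Obj X; d \<in> carrier (Ext X C A)\<rbrakk> \<Longrightarrow> d \<otimes>\<^bsub>Ext X C A\<^esub> null C A = d"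
  by (simp_all add: monoid.l_one[OF Ext_monoid] monoid.r_one[OF Ext_monoid])

lemma ext_closed [simp]:
  "\<lbrakk>c \<in> Arr X; a \<in> Arr X; d \<in> carrier (Ext X (Cod X c) (Dom X a)); Dom X c = C; Cod X a = A\<rbrakk>
    \<Longrightarrow> ExtMap X c a d \<in> carrier (Ext X C A)"
  using ExtMap_hom[of c "Dom X c" "Cod X c" a "Dom X a" "Cod X a"]
  by (auto simp: Hom_def hom_def)

lemma ext_mult [simp]:
  "\<lbrakk>c \<in> Arr X; a \<in> Arr X; d \<in> carrier (Ext X C A); e \<in> carrier (Ext X C A); Cod X c = C; Dom X a = A\<rbrakk>
    \<Longrightarrow> ExtMap X c a (d \<otimes>\<^bsub>Ext X C A\<^esub> e) = ExtMap X c a d \<otimes>\<^bsub>Ext X (Dom X c) (Cod X a)\<^esub> ExtMap X c a e"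
  using ExtMap_hom[of c "Dom X c" "Cod X c" a "Dom X a" "Cod X a"]
  by (auto simp: Hom_def hom_def)

lemma ext_null [simp]:
  assumes "c \<in> Arr X" "a \<in> Arr X" "Cod X c = C" "Dom X a = A"
  shows "ExtMap X c a (null C A) = null (Dom X c) (Cod X a)"
proof -
  have "group_hom (Ext X C A) (Ext X (Dom X c) (Cod X a)) (ExtMap X c a)"
    using ExtMap_hom[of c "Dom X c" "Cod X c" a "Dom X a" "Cod X a"] assms Dom_Obj Cod_Obj
    by (auto simp: Ext_grp group_hom_def group_hom_axioms_def Hom_def)
  then show ?thesis by (rule group_hom.hom_one)
qed

lemma ext_id [simp]:
  "\<lbrakk>C \<in> Obj X; A \<in> Obj X; d \<in> carrier (Ext X C A)\<rbrakk> \<Longrightarrow> ExtMap X (Ident X C) (Ident X A) d = d"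
  using Ext_bifunctor unfolding ext_bifunctor_def by blast

lemma ext_comp [simp]:
  assumes "c \<in> Arr X" "a \<in> Arr X" "c' \<in> Arr X" "a' \<in> Arr X" "d \<in> carrier (Ext X (Cod X c) (Dom X a))"
    "Cod X c' = Dom X c" "Cod X a = Dom X a'"
  shows "ExtMap X c' a' (ExtMap X c a d) = ExtMap X (c \<cdot> c') (a' \<cdot> a) d"
proof -
  have "c \<in> Hom X (Dom X c) (Cod X c) \<and> c' \<in> Hom X (Dom X c') (Dom X c) \<and> a \<in> Hom X (Dom X a) (Cod X a)
    \<and> a' \<in> Hom X (Cod X a) (Cod X a') \<and> d \<in> carrier (Ext X (Cod X c) (Dom X a))"
    using assms by (auto simp: Hom_def)
  then have "ExtMap X (c \<cdot> c') (a' \<cdot> a) d = ExtMap X c' a' (ExtMap X c a d)"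
    using Ext_bifunctor unfolding ext_bifunctor_def by blast
  then show ?thesis by (rule sym)
qed

lemma ext_add_right [simp]:
  "\<lbrakk>c \<in> Arr X; a \<in> Arr X; a' \<in> Arr X; d \<in> carrier (Ext X (Cod X c) (Dom X a)); Dom X a = Dom X a'; Cod X a = Cod X a'\<rbrakk>
    \<Longrightarrow> ExtMap X c (a \<^bold>+ a') d = ExtMap X c a d \<otimes>\<^bsub>Ext X (Dom X c) (Cod X a)\<^esub> ExtMap X c a' d"
proof goal_cases
  case 1
  then have "c \<in> Hom X (Dom X c) (Cod X c) \<and> a \<in> Hom X (Dom X a) (Cod X a) \<and> a' \<in> Hom X (Dom X a) (Cod X a)
      \<and> d \<in> carrier (Ext X (Cod X c) (Dom X a))"
    by (simp add: Hom_def)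
  then show ?case using ET1 unfolding biadditive_ext_def by blast
qed

lemma ext_add_left [simp]:
  "\<lbrakk>c \<in> Arr X; a \<in> Arr X; c' \<in> Arr X; d \<in> carrier (Ext X (Cod X c) (Dom X a)); Dom X c = Dom X c'; Cod X c = Cod X c'\<rbrakk>
    \<Longrightarrow> ExtMap X (c \<^bold>+ c') a d = ExtMap X c a d \<otimes>\<^bsub>Ext X (Dom X c) (Cod X a)\<^esub> ExtMap X c' a d"
proof goal_cases
  case 1
  then have "c \<in> Hom X (Dom X c) (Cod X c) \<and> c' \<in> Hom X (Dom X c) (Cod X c) \<and> a \<in> Hom X (Dom X a) (Cod X a)
      \<and> d \<in> carrier (Ext X (Cod X c) (Dom X a))"
    by (simp add: Hom_def)
  then show ?case using ET1 unfolding biadditive_ext_def by blast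
qed

lemma ext_idempotent_null:
  assumes "C \<in> Obj X" "A \<in> Obj X" "d \<in> carrier (Ext X C A)" "d \<otimes>\<^bsub>Ext X C A\<^esub> d = d"
  shows "d = null C A"
  using group.l_cancel_one[OF comm_group.axioms(2)[OF Ext_group[OF assms(1,2)]] assms(3,3)] assms(4)
  by simp

lemma ext_zero_right [simp]:
  assumes "c \<in> Arr X" "A \<in> Obj X" "A' \<in> Obj X" "d \<in> carrier (Ext X (Cod X c) A)"
  shows "ExtMap X c (Zmor X A A') d = null (Dom X c) A'"
  using ext_add_right[of c "Zmor X A A'" "Zmor X A A'" d, symmetric] assms Dom_Obj
  by (intro ext_idempotent_null) auto

lemma ext_zero_left [simp]:
  assumes "a \<in> Arr X" "C \<in> Obj X" "C' \<in> Obj X" "d \<in> carrier (Ext X C (Dom X a))"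
  shows "ExtMap X (Zmor X C' C) a d = null C' (Cod X a)"
  using ext_add_left[of "Zmor X C' C" a "Zmor X C' C" d, symmetric] assms Cod_Obj
  by (intro ext_idempotent_null) auto

lemma ext_cancel_left:
  assumes "C \<in> Obj X" "A \<in> Obj X" "d \<in> carrier (Ext X C A)" "e \<in> carrier (Ext X C A)" "e' \<in> carrier (Ext X C A)"
   "d \<otimes>\<^bsub>Ext X C A\<^esub> e = d \<otimes>\<^bsub>Ext X C A\<^esub> e'"
  shows "e = e'"
proof -
  interpret comm_group "Ext X C A" using assms Ext_group by blast
  show ?thesis using assms Units_l_cancel Units_eq by auto
qed

section \<open>Triangles, their realizations and their middle terms\<close>

lemma triangleD:
  assumes "triangle X A B C x y \<delta>"
  shows "x \<in> Arr X \<and> Dom X x = A \<and> Cod X x = B \<and> y \<in> Arr X \<and> Dom X y = B \<and> Cod X y = C \<and>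
    A \<in> Obj X \<and> B \<in> Obj X \<and> C \<in> Obj X \<and> \<delta> \<in> carrier (Ext X C A)"
  using assms HomD[of x A B] HomD[of y B C] unfolding triangle_def is_sequence_def by blast

lemma triangle_Hom:
  assumes "triangle X A B C x y \<delta>"
  shows "x \<in> Hom X A B" "y \<in> Hom X B C"
  using assms unfolding triangle_def is_sequence_def by blast+

lemma seq_classI:
  "\<lbrakk>x0 \<in> Hom X A B0; y0 \<in> Hom X B0 C; x \<in> Hom X A B; y \<in> Hom X B C; b \<in> Hom X B0 B; iso_arr X b;
    b \<cdot> x0 = x; y \<cdot> b = y0\<rbrakk> \<Longrightarrow> (x, y) \<in> seq_class X x0 y0"
  using HomD[of x0 A B0] HomD[of y0 B0 C] unfolding seq_class_def is_sequence_def by auto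

lemma mem_seq_class: "\<lbrakk>x \<in> Hom X A B; y \<in> Hom X B C\<rbrakk> \<Longrightarrow> (x, y) \<in> seq_class X x y"
  using HomD[of x A B] HomD[of y B C]
  by (auto simp: seq_class_def is_sequence_def intro!: exI[of _ B] bexI[of _ "Ident X B"] HomI)

lemma Realize_ex:
  assumes "C \<in> Obj X" "A \<in> Obj X" "\<delta> \<in> carrier (Ext X C A)"
  obtains B x y where "x \<in> Hom X A B" "y \<in> Hom X B C" "Realize X C A \<delta> = seq_class X x y"
  using ET2 assms unfolding additive_realization_def realization_def is_sequence_def by meson

lemma triangle_ex:
  assumes "C \<in> Obj X" "A \<in> Obj X" "\<delta> \<in> carrier (Ext X C A)"
  obtains B x y where "triangle X A B C x y \<delta>"
proof -
  obtain B x y where h: "x \<in> Hom X A B" "y \<in> Hom X B C" "Realize X C A \<delta> = seq_class X x y"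
    using Realize_ex assms by metis
  then have "triangle X A B C x y \<delta>"
    using mem_seq_class[OF h(1,2)] assms by (auto simp: triangle_def is_sequence_def)
  then show thesis using that by blast
qed

lemma triangle_morphism:
  assumes "triangle X A B C x y \<delta>" "triangle X A' B' C' x' y' \<delta>'"
    "a \<in> Hom X A A'" "c \<in> Hom X C C'" "ext_morphism X a c \<delta> \<delta>'"
  obtains b where "b \<in> Hom X B B'" "b \<cdot> x = x' \<cdot> a" "y' \<cdot> b = c \<cdot> y"
proof -
  note r = ET2[unfolded additive_realization_def realization_def, THEN conjunct1, THEN conjunct2, rule_format]
  have "\<exists>b \<in> Hom X B B'. b \<cdot> x = x' \<cdot> a \<and> y' \<cdot> b = c \<cdot> y"
    by (rule r[OF conjI[OF assms(1) conjI[OF assms(2) conjI[OF assms(3) conjI[OF assms(4,5)]]]]])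
  then show thesis using that by blast
qed

text \<open>\<open>Realize\<close> is the class of some representative other than the given
  sequence; composing the comparison \<open>c\<close> from it with \<open>b\<close> shows that the
  new sequence lies in the same class.\<close>

lemma triangle_iso_mid:
  assumes t: "triangle X A B C x y \<delta>" and b: "iso_arr X b" "b \<in> Hom X B B'"
    and y': "y' \<in> Hom X B' C" "y' \<cdot> b = y"
  shows "triangle X A B' C (b \<cdot> x) y' \<delta>"
proof -
  note d = triangleD[OF t] HomD[OF b(2)] HomD[OF y'(1)]
  obtain B0 x0 y0 where h: "x0 \<in> Hom X A B0" "y0 \<in> Hom X B0 C" "Realize X C A \<delta> = seq_class X x0 y0"
    using Realize_ex d by metis
  note d = d HomD[OF h(1)] HomD[OF h(2)]
  have "(x, y) \<in> seq_class X x0 y0" using t h by (simp add: triangle_def)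
  then obtain c where c: "c \<in> Hom X B0 B" "iso_arr X c" "c \<cdot> x0 = x" "y \<cdot> c = y0"
    using d by (auto simp: seq_class_def is_sequence_def Hom_def)
  note d = d HomD[OF c(1)]
  have "iso_arr X (b \<cdot> c)" using iso_arr_comp[OF c(2,1) b] .
  moreover have "y' \<cdot> (b \<cdot> c) = y0" using d comp_reduce[OF y'(2), of c] c(4) by simp
  moreover have "b \<cdot> c \<cdot> x0 = b \<cdot> x" using d c(3) by simp
  ultimately have "(b \<cdot> x, y') \<in> seq_class X x0 y0"
    by (intro seq_classI[OF h(1,2), of "b \<cdot> x" B' y' "b \<cdot> c"]) (use d in \<open>simp_all add: Hom_def\<close>)
  then show ?thesis using h t d by (auto simp: triangle_def is_sequence_def Hom_def)
qed

text \<open>Both sequences are compared with a common representative of the class, and the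
  isomorphism runs through it.\<close>

lemma triangle_mid_unique:
  assumes t: "triangle X A B C x y \<delta>" and t': "triangle X A B' C x' y' \<delta>"
  obtains b where "b \<in> Hom X B B'" "iso_arr X b" "b \<cdot> x = x'" "y' \<cdot> b = y"
proof -
  note d = triangleD[OF t] triangleD[OF t']
  obtain B0 x0 y0 where h: "x0 \<in> Hom X A B0" "y0 \<in> Hom X B0 C" "Realize X C A \<delta> = seq_class X x0 y0"
    using Realize_ex d by metis
  note d = d HomD[OF h(1)] HomD[OF h(2)]
  have "(x, y) \<in> seq_class X x0 y0" using t h by (simp add: triangle_def)
  then obtain c where c: "c \<in> Hom X B0 B" "iso_arr X c" "c \<cdot> x0 = x" "y \<cdot> c = y0"
    using d by (auto simp: seq_class_def is_sequence_def Hom_def)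
  have "(x', y') \<in> seq_class X x0 y0" using t' h by (simp add: triangle_def)
  then obtain c' where c': "c' \<in> Hom X B0 B'" "iso_arr X c'" "c' \<cdot> x0 = x'" "y' \<cdot> c' = y0"
    using d by (auto simp: seq_class_def is_sequence_def Hom_def)
  obtain e where e: "e \<in> Hom X B B0" "e \<cdot> c = Ident X B0" "c \<cdot> e = Ident X B" "iso_arr X e"
    using iso_arrE c by metis
  note d = d HomD[OF c(1)] HomD[OF c'(1)] HomD[OF e(1)]
  have "(c' \<cdot> e) \<cdot> x = x'" using d c'(3) comp_reduce[OF e(2), of x0] by (simp flip: c(3))
  moreover have "y' \<cdot> (c' \<cdot> e) = y"
    using d e(3) comp_reduce[OF c'(4), of e] by (simp flip: c(4))
  moreover have "iso_arr X (c' \<cdot> e)" using iso_arr_comp[OF e(4,1) c'(2,1)] .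
  ultimately show thesis using that[of "c' \<cdot> e"] d by (auto simp: Hom_def)
qed

lemma Realize_null:
  assumes "biproduct X A C P i j p q"
  shows "Realize X C A (null C A) = seq_class X i q"
  using biproductD[OF assms] assms
  by (intro ET2[unfolded additive_realization_def, THEN conjunct2, THEN conjunct1, rule_format]) blast

lemma Realize_sum:
  assumes "triangle X A B C x y \<delta>" "triangle X A' B' C' x' y' \<delta>'"
    "biproduct X A A' PA iA jA pA qA" "biproduct X B B' PB iB jB pB qB" "biproduct X C C' PC iC jC pC qC"
    "\<epsilon> \<in> carrier (Ext X PC PA)" "ExtMap X iC pA \<epsilon> = \<delta>" "ExtMap X iC qA \<epsilon> = null C A'"
    "ExtMap X jC pA \<epsilon> = null C' A" "ExtMap X jC qA \<epsilon> = \<delta>'"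
  shows "Realize X PC PA \<epsilon> =
          seq_class X (iB \<cdot> x \<cdot> pA \<^bold>+ jB \<cdot> x' \<cdot> qA) (iC \<cdot> y \<cdot> pB \<^bold>+ jC \<cdot> y' \<cdot> qB)"
  by (rule ET2[unfolded additive_realization_def, THEN conjunct2, THEN conjunct2, rule_format])
    (intro conjI; fact assms)

lemma split_triangle:
  assumes "biproduct X A C P i j p q"
  shows "triangle X A P C i q (null C A)"
proof -
  note d = biproductD[OF assms]
  have "Realize X C A (null C A) = seq_class X i q" by (rule Realize_null[OF assms])
  then show ?thesis using d mem_seq_class[of i A P q C] by (auto simp: triangle_def is_sequence_def Hom_def)
qed

lemma extriangulated_category_op: fixes Y defines "Y \<equiv> op_data X" shows "extriangulated_category Y"
proof -
  have add: "additive_realization (op_data X)"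
    unfolding additive_realization_def realization_def
  proof (intro conjI allI impI ballI, goal_cases)
    case (1 C A \<delta>)
    then obtain B x y where h: "x \<in> Hom X C B" "y \<in> Hom X B A" "Realize X A C \<delta> = seq_class X x y"
      by (auto intro: Realize_ex[of A C \<delta>])
    then have "is_sequence (op_data X) A B C y x" "Realize (op_data X) C A \<delta> = seq_class (op_data X) y x"
      using seq_class_op[of y B A x C] by (auto simp: is_sequence_def)
    then show ?case by blast
  next
    case (2 A B C x y \<delta> A' B' C' x' y' \<delta>' a c)
    then have "triangle X C' B' A' y' x' \<delta>'" "triangle X C B A y x \<delta>" "c \<in> Hom X C' C" "a \<in> Hom X A' A"
       "ext_morphism X c a \<delta>' \<delta>" by simp_all
    from triangle_morphism[OF this] obtain b where "b \<in> Hom X B' B" "b \<cdot> y' = y \<cdot> c" "x \<cdot> b = a \<cdot> x'" .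
    then show ?case by (intro bexI[of _ b]) simp_all
  next
    case (3 A C P i j p q)
    then have "biproduct X A C P p q i j" by simp
    \<comment> \<open>In the opposite category inclusions and projections exchange roles, so the
      split sequence starts at the other summand.\<close>
    then have b: "biproduct X C A P q p j i" by (rule biproduct_swap)
    then have "i \<in> Hom X P A" "q \<in> Hom X C P" unfolding biproduct_def by blast+
    from Realize_null[OF b] seq_class_op[OF this] show ?case by simp
  next
    case (4 A B C x y \<delta> A' B' C' x' y' \<delta>' PA iA jA pA qA PB iB jB pB qB PC iC jC pC qC \<epsilon>)
    then have t: "triangle X C B A y x \<delta>" "triangle X C' B' A' y' x' \<delta>'"
      and b: "biproduct X A A' PA pA qA iA jA" "biproduct X B B' PB pB qB iB jB" "biproduct X C C' PC pC qC iC jC"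
      and e: "\<epsilon> \<in> carrier (Ext X PA PC)" "ExtMap X pA iC \<epsilon> = \<delta>" "ExtMap X qA iC \<epsilon> = null A' C"
        "ExtMap X pA jC \<epsilon> = null A C'" "ExtMap X qA jC \<epsilon> = \<delta>'"
      by simp_all
    note d = triangleD[OF t(1)] triangleD[OF t(2)] biproductD[OF b(1)] biproductD[OF b(2)] biproductD[OF b(3)]
    have R: "Realize X PA PC \<epsilon> =
          seq_class X (pB \<cdot> y \<cdot> iC \<^bold>+ qB \<cdot> y' \<cdot> jC) (pA \<cdot> x \<cdot> iB \<^bold>+ qA \<cdot> x' \<cdot> jB)"
      by (rule Realize_sum) (use t b e in simp_all)
    have "pB \<cdot> y \<cdot> iC \<^bold>+ qB \<cdot> y' \<cdot> jC \<in> Hom X PC PB" "pA \<cdot> x \<cdot> iB \<^bold>+ qA \<cdot> x' \<cdot> jB \<in> Hom X PB PA"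
      using d by (auto simp: Hom_def)
    from seq_class_op[OF this(2,1)] show ?case using d R by simp
  qed
  interpret op: additive_category Y unfolding Y_def by (rule additive_category_op)
  have bif1: "ext_bifunctor Y"
    unfolding Y_def ext_bifunctor_def
  proof (intro conjI allI impI ballI, goal_cases)
    case (4 C C' C'' A A' A'' c c' a a' \<delta>)
    then have d: "c \<in> Hom X C C'" "c' \<in> Hom X C' C''" "a \<in> Hom X A' A" "a' \<in> Hom X A'' A'" "\<delta> \<in> carrier (Ext X A C)"
      by simp_all
    show ?case using d(5) HomD[OF d(1)] HomD[OF d(2)] HomD[OF d(3)] HomD[OF d(4)] by simp
  qed (use Ext_group ExtMap_hom in simp_all)
  have bif2: "biadditive_ext Y"
    unfolding Y_def biadditive_ext_def
  proof (intro conjI allI impI, goal_cases)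
    case (1 C C' A A' c a a' \<delta>)
    then have d: "c \<in> Hom X C C'" "a \<in> Hom X A' A" "a' \<in> Hom X A' A" "\<delta> \<in> carrier (Ext X A C)"
      by simp_all
    show ?case using d(4) HomD[OF d(1)] HomD[OF d(2)] HomD[OF d(3)] by simp
  next
    case (2 C C' A A' c c' a \<delta>)
    then have d: "c \<in> Hom X C C'" "c' \<in> Hom X C C'" "a \<in> Hom X A' A" "\<delta> \<in> carrier (Ext X A C)"
      by simp_all
    show ?case using d(4) HomD[OF d(1)] HomD[OF d(2)] HomD[OF d(3)] by simp
  qed
  note bif = bif1 bif2
  show ?thesis
  proof (unfold_locales, goal_cases)
    case 1 then show ?case using bif by simp
  next
    case 2 then show ?case using bif by simp
  next
    case 3 then show ?case using add Y_def by simp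
  next
    case (4 A B C x y \<delta> A' B' C' x' y' \<delta>' a b)
    then show ?case using ET3_op[of C' B' A' y' x' \<delta>' C B A y x \<delta> b a] by (auto simp: Y_def)
  next
    case (5 A B C x y \<delta> A' B' C' x' y' \<delta>' b c)
    then show ?case using ET3[of C' B' A' y' x' \<delta>' C B A y x \<delta> c b] by (auto simp: Y_def)
  next
    case (6 A B D f f' \<delta> C F g g' \<delta>')
    then have "triangle X D B A f' f \<delta>" "triangle X F C B g' g \<delta>'" by (simp_all add: Y_def)
    from ET4_op[OF this(2,1)] obtain E h' \<delta>'' d e where
      "triangle X E C A h' (f \<cdot> g) \<delta>''" "d \<in> Hom X F E" "e \<in> Hom X E D" "h' \<cdot> d = g'"
      "g \<cdot> h' = f' \<cdot> e" "triangle X F E D d e (pull X F f' \<delta>')" "\<delta> = push X A e \<delta>''"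
      "push X B d \<delta>' = pull X E f \<delta>''" by blast
    then show ?case
      by (intro exI[of _ E] exI[of _ h'] exI[of _ \<delta>''] exI[of _ e] exI[of _ d]) (simp add: Y_def)
  next
    case (7 D A B f' f \<delta> F C g' g \<delta>')
    then have "triangle X B A D f f' \<delta>" "triangle X C B F g g' \<delta>'" by (simp_all add: Y_def)
    from ET4[OF this(2,1)] obtain E h' \<delta>'' d e where
      "triangle X C A E (f \<cdot> g) h' \<delta>''" "d \<in> Hom X F E" "e \<in> Hom X E D" "d \<cdot> g' = h' \<cdot> f"
      "e \<cdot> h' = f'" "triangle X F E D d e (push X D g' \<delta>)" "pull X C d \<delta>'' = \<delta>'"
      "push X E g \<delta>'' = pull X B e \<delta>" by blast
    then show ?case
      by (intro exI[of _ E] exI[of _ h'] exI[of _ \<delta>''] exI[of _ e] exI[of _ d]) (simp add: Y_def)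
  qed
qed

subsection \<open>Exact sequences\<close>

lemma triangle_ident_left: "\<lbrakk>A \<in> Obj X; zero_object X Z\<rbrakk>
    \<Longrightarrow> triangle X A A Z (Ident X A) (Zmor X A Z) (null Z A)"
  using split_triangle[OF biproduct_zero_right] by blast

lemma triangle_ident_right: "\<lbrakk>A \<in> Obj X; zero_object X Z\<rbrakk>
    \<Longrightarrow> triangle X Z A A (Zmor X Z A) (Ident X A) (null A Z)"
  using split_triangle[OF biproduct_zero_left] by blast

text \<open>The identity of \<open>A\<close> and \<open>x\<close> form a morphism from
  \<open>A = A -> 0\<close>; by (ET3) it has a third component, which starts at the zero
  object.\<close>

lemma triangle_comp_zero:
  assumes t: "triangle X A B C x y \<delta>"
  shows "y \<cdot> x = Zmor X A C"
proof -
  note d = triangleD[OF t]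
  obtain Z where Z: "zero_object X Z" using ex_zero_object by blast
  have tz: "triangle X A A Z (Ident X A) (Zmor X A Z) (null Z A)"
    by (rule triangle_ident_left) (use Z d in auto)
  obtain c where c: "c \<in> Hom X Z C" "y \<cdot> x = c \<cdot> Zmor X A Z"
    using ET3[OF tz t Ident_Hom triangle_Hom(1)[OF t]] d by blast
  then show ?thesis using HomD[OF c(1)] d by simp
qed

text \<open>A weak kernel property, without uniqueness of \<open>g'\<close>: the dual of (ET3) is
  applied to \<open>W = W -> 0\<close>, with \<open>g\<close> on middle terms and zero on third
  terms.\<close>

lemma factor_inflation:
  assumes t: "triangle X A B C x y \<delta>" and g: "g \<in> Hom X W B" "y \<cdot> g = Zmor X W C"
  obtains g' where "g' \<in> Hom X W A" "g = x \<cdot> g'"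
proof -
  note d = triangleD[OF t] HomD[OF g(1)]
  obtain Z where Z: "zero_object X Z" using ex_zero_object by blast
  then have oz: "Z \<in> Obj X" by (rule zero_object_Obj)
  have tz: "triangle X W W Z (Ident X W) (Zmor X W Z) (null Z W)"
    by (rule triangle_ident_left) (use Z d in auto)
  have "Zmor X Z C \<in> Hom X Z C" "y \<cdot> g = Zmor X Z C \<cdot> Zmor X W Z" using d oz g by (simp_all add: Hom_def)
  from ET3_op[OF tz t g(1) this] obtain a where "a \<in> Hom X W A" "g \<cdot> Ident X W = x \<cdot> a"
    by blast
  then show thesis using that d by simp
qed

text \<open>The vanishing of \<open>pull X A c \<delta>\<close> says exactly that
  \<open>(0, c)\<close> is a morphism from the null extension of \<open>W\<close> by the zero
  object; its realization is the lift.\<close>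

lemma lift_deflation:
  assumes t: "triangle X A B C x y \<delta>" and c: "c \<in> Hom X W C" "pull X A c \<delta> = null W A"
  obtains c' where "c' \<in> Hom X W B" "c = y \<cdot> c'"
proof -
  note d = triangleD[OF t] HomD[OF c(1)]
  obtain Z where Z: "zero_object X Z" using ex_zero_object by blast
  then have oz: "Z \<in> Obj X" by (rule zero_object_Obj)
  have tz: "triangle X Z W W (Zmor X Z W) (Ident X W) (null W Z)"
    by (rule triangle_ident_right) (use Z d in auto)
  have z: "Zmor X Z A \<in> Hom X Z A" using d oz by (simp add: Hom_def)
  have "ext_morphism X (Zmor X Z A) c (null W Z) \<delta>"
    unfolding ext_morphism_def using d oz c by simp
  from triangle_morphism[OF tz t z c(1) this] obtain b where "b \<in> Hom X W B" "y \<cdot> b = c \<cdot> Ident X W"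
    by blast
  then show thesis using that[of b] d by simp
qed

text \<open>Map \<open>0 -> B = B\<close> to the triangle by the identity of \<open>B\<close> and
  \<open>y\<close>. The dual of (ET3) makes this a morphism of extensions, whose defining equation
  equates the pullback with a pushed null class.\<close>

lemma pull_null:
  assumes t: "triangle X A B C x y \<delta>"
  shows "pull X A y \<delta> = null B A"
proof -
  note d = triangleD[OF t]
  obtain Z where Z: "zero_object X Z" using ex_zero_object by blast
  then have oz: "Z \<in> Obj X" by (rule zero_object_Obj)
  have tz: "triangle X Z B B (Zmor X Z B) (Ident X B) (null B Z)"
    by (rule triangle_ident_right) (use Z d in auto)
  obtain a where a: "a \<in> Hom X Z A" "ext_morphism X a y (null B Z) \<delta>"
    using ET3_op[OF tz t Ident_Hom triangle_Hom(2)[OF t]] d by blast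
  then show ?thesis using HomD[OF a(1)] d unfolding ext_morphism_def by simp
qed

lemma factor_deflation:
  assumes t: "triangle X A B C x y \<delta>" and g: "g \<in> Hom X B W" "g \<cdot> x = Zmor X A W"
  obtains g' where "g' \<in> Hom X C W" "g = g' \<cdot> y"
  using extriangulated_category.factor_inflation[OF extriangulated_category_op, of C B A y x \<delta> g W] t g
  by auto

lemma extend_inflation:
  assumes t: "triangle X A B C x y \<delta>" and a: "a \<in> Hom X A W" "push X C a \<delta> = null C W"
  obtains a' where "a' \<in> Hom X B W" "a = a' \<cdot> x"
  using extriangulated_category.lift_deflation[OF extriangulated_category_op, of C B A y x \<delta> a W] t a
  by auto

lemma push_null:
  assumes t: "triangle X A B C x y \<delta>"
  shows "push X C x \<delta> = null C B"
  using extriangulated_category.pull_null[OF extriangulated_category_op, of C B A y x \<delta>] t by simp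

text \<open>Realizing \<open>\<epsilon>\<close> and dividing by \<open>A\<close> with (ET4) gives a
  triangle on \<open>push X W y \<epsilon>\<close>. As this class is null, its deflation
  \<open>k\<close> has a section \<open>s\<close>; pulling the class of the composite inflation back
  along \<open>s\<close> yields the preimage.\<close>

lemma push_exact:
  assumes t: "triangle X A B C x y \<delta>" and W: "W \<in> Obj X"
    and e: "\<epsilon> \<in> carrier (Ext X W B)" "push X W y \<epsilon> = null W C"
  obtains \<epsilon>' where "\<epsilon>' \<in> carrier (Ext X W A)" "\<epsilon> = push X W x \<epsilon>'"
proof -
  note d = triangleD[OF t]
  obtain D g g' where t': "triangle X B D W g g' \<epsilon>" using triangle_ex W e d by metis
  note d = d triangleD[OF t']
  obtain E h' \<delta>'' c k where q: "triangle X A D E (g \<cdot> x) h' \<delta>''" "triangle X C E W c k (push X W y \<epsilon>)"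
    "push X E x \<delta>'' = pull X B k \<epsilon>" using ET4[OF t t'] by blast
  note d = d triangleD[OF q(1)] triangleD[OF q(2)]
  have "Ident X W \<in> Hom X W W" "pull X C (Ident X W) (push X W y \<epsilon>) = null W C"
    using d e(2) by (simp_all add: Hom_def)
  then obtain s where s: "s \<in> Hom X W E" "Ident X W = k \<cdot> s" using lift_deflation[OF q(2)] by metis
  note d = d HomD[OF s(1)]
  have "push X W x (pull X A s \<delta>'') = pull X B s (push X E x \<delta>'')" using d by simp
  also have "\<dots> = pull X B (k \<cdot> s) \<epsilon>" using d unfolding q(3) by simp
  also have "\<dots> = \<epsilon>" using d by (simp flip: s(2))
  finally show thesis using that[of "pull X A s \<delta>''"] d by simp
qed

lemma pull_exact:
  assumes t: "triangle X A B C x y \<delta>" and W: "W \<in> Obj X"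
    and e: "\<epsilon> \<in> carrier (Ext X B W)" "pull X W x \<epsilon> = null A W"
  obtains \<epsilon>' where "\<epsilon>' \<in> carrier (Ext X C W)" "\<epsilon> = pull X W y \<epsilon>'"
  using extriangulated_category.push_exact[OF extriangulated_category_op, of C B A y x \<delta> W \<epsilon>] t W e
  by auto

text \<open>The defect \<open>n = 1 - w\<close> kills \<open>y\<close> and pulls
  \<open>\<delta>\<close> back to the null class. The latter lets \<open>n\<close> factor through
  \<open>y\<close>, and the former then gives \<open>n \<cdot> n = 0\<close>.\<close>

lemma iso_third_endo:
  assumes t: "triangle X A B C x y \<delta>" and w: "w \<in> Hom X C C" "w \<cdot> y = y" "pull X A w \<delta> = \<delta>"
  shows "iso_arr X w"
proof -
  note d = triangleD[OF t] HomD[OF w(1)]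
  obtain n where n: "n \<in> Hom X C C" "Ident X C = w \<^bold>+ n"
    using difference[OF Ident_Hom w(1)] d by blast
  note d = d HomD[OF n(1)]
  have "y \<^bold>+ n \<cdot> y = (w \<^bold>+ n) \<cdot> y" using d w(2) by simp
  also have "\<dots> = y" using d by (simp flip: n(2))
  finally have ny: "n \<cdot> y = Zmor X B C" by (rule add_eq_self) (use d in auto)
  have "pull X A (w \<^bold>+ n) \<delta> = \<delta> \<otimes>\<^bsub>Ext X C A\<^esub> pull X A n \<delta>"
    using d w(3) by simp
  moreover have "pull X A (w \<^bold>+ n) \<delta> = \<delta>" using d by (simp flip: n(2))
  ultimately have "\<delta> \<otimes>\<^bsub>Ext X C A\<^esub> pull X A n \<delta> = \<delta> \<otimes>\<^bsub>Ext X C A\<^esub> null C A" using d by simp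
  from ext_cancel_left[OF _ _ _ _ _ this] have "pull X A n \<delta> = null C A" using d by simp
  then obtain k where k: "k \<in> Hom X C B" "n = y \<cdot> k" using lift_deflation[OF t n(1)] by metis
  have "n \<cdot> n = n \<cdot> (y \<cdot> k)" by (simp flip: k(2))
  also have "\<dots> = Zmor X C C" using d HomD[OF k(1)] comp_reduce[OF ny, of k] by simp
  finally show ?thesis by (rule iso_if_square_zero_defect[OF w(1) n])
qed

text \<open>The defect kills \<open>x\<close>, hence factors as \<open>k \<cdot> y\<close>, and it
  is killed by \<open>y\<close>; so its square vanishes.\<close>

lemma iso_mid_endo:
  assumes t: "triangle X A B C x y \<delta>" and w: "w \<in> Hom X B B" "w \<cdot> x = x" "y \<cdot> w = y"
  shows "iso_arr X w"
proof -
  note d = triangleD[OF t] HomD[OF w(1)]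
  obtain n where n: "n \<in> Hom X B B" "Ident X B = w \<^bold>+ n"
    using difference[OF Ident_Hom w(1)] d by blast
  note d = d HomD[OF n(1)]
  have "x \<^bold>+ n \<cdot> x = (w \<^bold>+ n) \<cdot> x" using d w(2) by simp
  also have "\<dots> = x" using d by (simp flip: n(2))
  finally have nx: "n \<cdot> x = Zmor X A B" by (rule add_eq_self) (use d in auto)
  have "y \<^bold>+ y \<cdot> n = y \<cdot> (w \<^bold>+ n)" using d w(3) by simp
  also have "\<dots> = y" using d by (simp flip: n(2))
  finally have yn: "y \<cdot> n = Zmor X B C" by (rule add_eq_self) (use d in auto)
  obtain k where k: "k \<in> Hom X C B" "n = k \<cdot> y" using factor_deflation[OF t n(1) nx] by metis
  note d = d HomD[OF k(1)]
  have "n \<cdot> n = (k \<cdot> y) \<cdot> n" by (simp flip: k(2))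
  also have "\<dots> = Zmor X B B" using d yn by simp
  finally show ?thesis by (rule iso_if_square_zero_defect[OF w(1) n])
qed

lemma cone_unique:
  assumes t: "triangle X A B C x y \<delta>" and t': "triangle X A B C' x y' \<delta>'"
  obtains c where "c \<in> Hom X C C'" "iso_arr X c" "c \<cdot> y = y'"
proof -
  note d = triangleD[OF t] triangleD[OF t']
  have i: "Ident X A \<in> Hom X A A" "Ident X B \<in> Hom X B B" "Ident X B \<cdot> x = x \<cdot> Ident X A"
    using d by (auto simp: Hom_def)
  obtain c where c: "c \<in> Hom X C C'" "ext_morphism X (Ident X A) c \<delta> \<delta>'" "y' \<cdot> Ident X B = c \<cdot> y"
    using ET3[OF t t' i] by blast
  obtain c' where c': "c' \<in> Hom X C' C" "ext_morphism X (Ident X A) c' \<delta>' \<delta>" "y \<cdot> Ident X B = c' \<cdot> y'"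
    using ET3[OF t' t i] by blast
  note d = d HomD[OF c(1)] HomD[OF c'(1)]
  have e: "c \<cdot> y = y'" "c' \<cdot> y' = y" "pull X A c \<delta>' = \<delta>" "pull X A c' \<delta> = \<delta>'"
    using d c c' unfolding ext_morphism_def by simp_all
  have "pull X A (c' \<cdot> c) \<delta> = pull X A c (pull X A c' \<delta>)" using d by simp
  then have p1: "pull X A (c' \<cdot> c) \<delta> = \<delta>" using e by simp
  have "pull X A (c \<cdot> c') \<delta>' = pull X A c' (pull X A c \<delta>')" using d by simp
  then have p2: "pull X A (c \<cdot> c') \<delta>' = \<delta>'" using e by simp
  have "iso_arr X (c' \<cdot> c)" "iso_arr X (c \<cdot> c')"
    by (rule iso_third_endo[OF t]; use d e p1 in \<open>simp add: Hom_def\<close>)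
       (rule iso_third_endo[OF t']; use d e p2 in \<open>simp add: Hom_def\<close>)
  then have "iso_arr X c" by (rule iso_if_inverses_of_composites[OF c(1) c'(1)])
  then show thesis using that c(1) e(1) by blast
qed

text \<open>A realization of the transported class may have another middle term. Comparison maps in
  both directions are isomorphisms by \<open>iso_mid_endo\<close>, and
  \<open>triangle_iso_mid\<close> moves the realization back to \<open>B\<close>.\<close>

lemma triangle_iso_third:
  assumes t: "triangle X A B C x y \<delta>" and c: "c \<in> Hom X C C'" "c' \<in> Hom X C' C"
    "c' \<cdot> c = Ident X C" "c \<cdot> c' = Ident X C'"
  shows "triangle X A B C' x (c \<cdot> y) (pull X A c' \<delta>)"
proof -
  note d = triangleD[OF t] HomD[OF c(1)] HomD[OF c(2)]
  have m: "pull X A c' \<delta> \<in> carrier (Ext X C' A)" using d by simp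
  obtain B' x' y' where t': "triangle X A B' C' x' y' (pull X A c' \<delta>)"
    using triangle_ex d m by metis
  note d = d triangleD[OF t']
  have i: "Ident X A \<in> Hom X A A" using d by (simp add: Hom_def)
  have "ext_morphism X (Ident X A) c \<delta> (pull X A c' \<delta>)" "ext_morphism X (Ident X A) c' (pull X A c' \<delta>) \<delta>"
    using d c(3) unfolding ext_morphism_def by simp_all
  from triangle_morphism[OF t t' i c(1) this(1)] triangle_morphism[OF t' t i c(2) this(2)]
  obtain b b' where b: "b \<in> Hom X B B'" "b \<cdot> x = x' \<cdot> Ident X A" "y' \<cdot> b = c \<cdot> y"
    and b': "b' \<in> Hom X B' B" "b' \<cdot> x' = x \<cdot> Ident X A" "y \<cdot> b' = c' \<cdot> y'" by metis
  note d = d HomD[OF b(1)] HomD[OF b'(1)]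
  have b2: "b \<cdot> x = x'" "b' \<cdot> x' = x" using b b' d by simp_all
  have "(b' \<cdot> b) \<cdot> x = x" "(b \<cdot> b') \<cdot> x' = x'" using d b2 by simp_all
  moreover have "y \<cdot> (b' \<cdot> b) = y" "y' \<cdot> (b \<cdot> b') = y'"
    using d comp_square[OF b'(3), of b] comp_square[OF b(3), of b']
    by (simp_all add: b(3) b'(3) comp_reduce[OF c(3)] comp_reduce[OF c(4)])
  ultimately have "iso_arr X (b' \<cdot> b)" "iso_arr X (b \<cdot> b')"
    using d iso_mid_endo[OF t, of "b' \<cdot> b"] iso_mid_endo[OF t', of "b \<cdot> b'"] by (auto simp: Hom_def)
  then have "iso_arr X b'" "iso_arr X b"
    using iso_if_inverses_of_composites[OF b'(1) b(1)] iso_if_inverses_of_composites[OF b(1) b'(1)] by auto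
  have "triangle X A B C' (b' \<cdot> x') (c \<cdot> y) (pull X A c' \<delta>)"
    by (rule triangle_iso_mid[OF t' \<open>iso_arr X b'\<close> b'(1)])
      (use d b'(3) comp_reduce[OF c(4), of y'] in \<open>auto simp: Hom_def\<close>)
  then show ?thesis using b2 by simp
qed

lemma split_biproduct:
  assumes t: "triangle X A B C x y (null C A)"
  obtains j p where "biproduct X A C B x j p y"
proof -
  note d = triangleD[OF t]
  obtain P i j p q where bp: "biproduct X A C P i j p q" using ex_biproduct d by blast
  obtain b where b: "b \<in> Hom X P B" "iso_arr X b" "b \<cdot> i = x" "y \<cdot> b = q"
    using triangle_mid_unique[OF split_triangle[OF bp] t] by metis
  show thesis using biproduct_iso[OF bp b(2,1) triangle_Hom(2)[OF t] b(4)] b(3) that by blast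
qed

text \<open>For an extension of \<open>C\<close> by \<open>A1 \<oplus> A2\<close>, (ET4) applied to the inclusion of \<open>A1\<close> exhibits
  the quotient of the middle term by \<open>A1\<close>.\<close>

lemma quotient_by_summand:
  assumes bp: "biproduct X A1 A2 Q s1 s2 r1 r2" and t: "triangle X Q M C h g \<theta>"
  obtains B2 m2 d e where "triangle X A1 M B2 (h \<cdot> s1) m2 (ExtMap X e r1 \<theta>)"
    "triangle X A2 B2 C d e (push X C r2 \<theta>)" "d \<cdot> r2 = m2 \<cdot> h" "e \<cdot> m2 = g"
proof -
  note d = biproductD[OF bp] triangleD[OF t]
  obtain B2 m2 \<delta>3 k e where q: "triangle X A1 M B2 (h \<cdot> s1) m2 \<delta>3" "k \<cdot> r2 = m2 \<cdot> h" "e \<cdot> m2 = g"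
    "triangle X A2 B2 C k e (push X C r2 \<theta>)" "push X B2 s1 \<delta>3 = pull X Q e \<theta>"
    using ET4[OF split_triangle[OF bp] t] by blast
  note d = d triangleD[OF q(1)] triangleD[OF q(4)]
  \<comment> \<open>\<open>r1 \<cdot> s1\<close> is the identity, so the (ET4) relation between
    \<open>\<delta>3\<close> and \<open>\<theta>\<close>, pushed along \<open>r1\<close>, determines
    \<open>\<delta>3\<close>.\<close>
  have "push X B2 r1 (push X B2 s1 \<delta>3) = \<delta>3" using d biproduct_eqs[OF bp] by simp
  then have "\<delta>3 = push X B2 r1 (pull X Q e \<theta>)" using q(5) by simp
  then have "\<delta>3 = ExtMap X e r1 \<theta>" using d by simp
  then show thesis using that q by blast
qed

subsection \<open>Weak pullbacks and octahedra\<close>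

text \<open>The quotient triangle from (ET4) and the prescribed one realize the same class, so the
  octahedron is carried over along the isomorphism of their middle terms. This lets two given
  triangles appear as the sides of one weak pullback.\<close>

lemma quotient_by_summand_given:
  assumes bp: "biproduct X A1 A2 Q s1 s2 r1 r2" and t: "triangle X Q M C h g \<theta>"
    and t2: "triangle X A2 B2 C x2 y2 (push X C r2 \<theta>)"
  obtains m2 where "triangle X A1 M B2 (h \<cdot> s1) m2 (pull X A1 y2 (push X C r1 \<theta>))"
    "m2 \<cdot> (h \<cdot> s2) = x2" "y2 \<cdot> m2 = g"
proof -
  obtain B m k e where q: "triangle X A1 M B (h \<cdot> s1) m (ExtMap X e r1 \<theta>)"
    "triangle X A2 B C k e (push X C r2 \<theta>)" "k \<cdot> r2 = m \<cdot> h" "e \<cdot> m = g"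
    using quotient_by_summand[OF bp t] by metis
  note d = biproductD[OF bp] triangleD[OF t] triangleD[OF t2] triangleD[OF q(1)] triangleD[OF q(2)]
  obtain b where b: "b \<in> Hom X B B2" "iso_arr X b" "b \<cdot> k = x2" "y2 \<cdot> b = e"
    using triangle_mid_unique[OF q(2) t2] by metis
  obtain c where c: "c \<in> Hom X B2 B" "c \<cdot> b = Ident X B" "b \<cdot> c = Ident X B2"
    using iso_arrE[OF b(2,1)] by metis
  note d = d HomD[OF b(1)] HomD[OF c(1)]
  have ec: "e \<cdot> c = y2" using d c(3) by (simp flip: b(4))
  have "pull X A1 c (ExtMap X e r1 \<theta>) = pull X A1 y2 (push X C r1 \<theta>)"
    using d ec by simp
  then have "triangle X A1 M B2 (h \<cdot> s1) (b \<cdot> m) (pull X A1 y2 (push X C r1 \<theta>))"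
    using triangle_iso_third[OF q(1) b(1) c] by simp
  moreover have "(b \<cdot> m) \<cdot> (h \<cdot> s2) = b \<cdot> (k \<cdot> r2) \<cdot> s2" using d by (simp add: q(3))
  then have "(b \<cdot> m) \<cdot> (h \<cdot> s2) = x2" using d b(3) biproduct_eqs[OF bp] by simp
  moreover have "y2 \<cdot> (b \<cdot> m) = g" using d comp_reduce[OF b(4), of m] q(4) by simp
  ultimately show thesis using that by blast
qed

lemma weak_pullback_with_extension:
  assumes t1: "triangle X A1 B1 C x1 y1 \<delta>1" and t2: "triangle X A2 B2 C x2 y2 \<delta>2"
  obtains Q s1 s2 r1 r2 M h g \<theta> m1 m2 where "biproduct X A1 A2 Q s1 s2 r1 r2" "triangle X Q M C h g \<theta>"
    "push X C r1 \<theta> = \<delta>1" "push X C r2 \<theta> = \<delta>2"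
    "triangle X A1 M B2 (h \<cdot> s1) m2 (pull X A1 y2 \<delta>1)" "triangle X A2 M B1 (h \<cdot> s2) m1 (pull X A2 y1 \<delta>2)"
    "m1 \<cdot> (h \<cdot> s1) = x1" "m2 \<cdot> (h \<cdot> s2) = x2" "y1 \<cdot> m1 = g" "y2 \<cdot> m2 = g"
proof -
  note d = triangleD[OF t1] triangleD[OF t2]
  obtain Q s1 s2 r1 r2 where bp: "biproduct X A1 A2 Q s1 s2 r1 r2" using ex_biproduct d by blast
  note d = d biproductD[OF bp]
  \<comment> \<open>The diagonal pullback of \<open>\<delta>1 \<oplus> \<delta>2\<close>, written
    through the inclusions of \<open>Q\<close>, so that no biproduct of \<open>C\<close> with itself
    has to be formed.\<close>
  define \<theta> where "\<theta> = push X C s1 \<delta>1 \<otimes>\<^bsub>Ext X C Q\<^esub> push X C s2 \<delta>2"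
  have th: "\<theta> \<in> carrier (Ext X C Q)" "push X C r1 \<theta> = \<delta>1" "push X C r2 \<theta> = \<delta>2"
    unfolding \<theta>_def using d biproduct_eqs[OF bp] by simp_all
  obtain M h g where t: "triangle X Q M C h g \<theta>" using triangle_ex[OF _ _ th(1)] d by metis
  obtain m2 where m2: "triangle X A1 M B2 (h \<cdot> s1) m2 (pull X A1 y2 \<delta>1)"
    "m2 \<cdot> (h \<cdot> s2) = x2" "y2 \<cdot> m2 = g"
    using quotient_by_summand_given[OF bp t, of B2 x2 y2] t2 th by metis
  obtain m1 where m1: "triangle X A2 M B1 (h \<cdot> s2) m1 (pull X A2 y1 \<delta>2)"
    "m1 \<cdot> (h \<cdot> s1) = x1" "y1 \<cdot> m1 = g"
    using quotient_by_summand_given[OF biproduct_swap[OF bp] t, of B1 x1 y1] t1 th by metis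
  show thesis using that[OF bp t th(2,3) m2(1) m1(1,2) m2(2) m1(3) m2(3)] .
qed

text \<open>For a pair \<open>(a, b)\<close> over \<open>C\<close>, the map
  \<open>y1 \<cdot> a = y2 \<cdot> b\<close> lifts through \<open>g\<close>, because the components
  of the pulled back class involve \<open>\<delta>1\<close> pulled along \<open>y1\<close> and
  \<open>\<delta>2\<close> pulled along \<open>y2\<close>, which are null. The lift matches
  \<open>a\<close> and \<open>b\<close> up to maps killed by \<open>y1\<close> and
  \<open>y2\<close>; these come from \<open>A1\<close> and \<open>A2\<close>, where they are
  corrected.\<close>

lemma weak_pullback:
  assumes t1: "triangle X A1 B1 C x1 y1 \<delta>1" and t2: "triangle X A2 B2 C x2 y2 \<delta>2"
  obtains M k1 k2 m1 m2 where
    "triangle X A1 M B2 k1 m2 (pull X A1 y2 \<delta>1)" "triangle X A2 M B1 k2 m1 (pull X A2 y1 \<delta>2)"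
    "m1 \<cdot> k1 = x1" "m2 \<cdot> k2 = x2" "y1 \<cdot> m1 = y2 \<cdot> m2"
    "\<And>W a b. \<lbrakk>a \<in> Hom X W B1; b \<in> Hom X W B2; y1 \<cdot> a = y2 \<cdot> b\<rbrakk>
       \<Longrightarrow> \<exists>l \<in> Hom X W M. m1 \<cdot> l = a \<and> m2 \<cdot> l = b"
proof -
  obtain Q s1 s2 r1 r2 M h g \<theta> m1 m2 where bp: "biproduct X A1 A2 Q s1 s2 r1 r2"
    and t: "triangle X Q M C h g \<theta>" and th: "push X C r1 \<theta> = \<delta>1" "push X C r2 \<theta> = \<delta>2"
    and m: "triangle X A1 M B2 (h \<cdot> s1) m2 (pull X A1 y2 \<delta>1)" "triangle X A2 M B1 (h \<cdot> s2) m1 (pull X A2 y1 \<delta>2)"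
    and e: "m1 \<cdot> (h \<cdot> s1) = x1" "m2 \<cdot> (h \<cdot> s2) = x2" "y1 \<cdot> m1 = g" "y2 \<cdot> m2 = g"
    using weak_pullback_with_extension[OF t1 t2] by metis
  note d0 = triangleD[OF t1] triangleD[OF t2] biproductD[OF bp] triangleD[OF t] triangleD[OF m(1)] triangleD[OF m(2)]
  have "\<exists>l \<in> Hom X W M. m1 \<cdot> l = a \<and> m2 \<cdot> l = b"
    if a: "a \<in> Hom X W B1" and b: "b \<in> Hom X W B2" and ab: "y1 \<cdot> a = y2 \<cdot> b" for W a b
  proof -
    note d = d0 HomD[OF a] HomD[OF b]
    have c: "y1 \<cdot> a \<in> Hom X W C" using d by (simp add: Hom_def)
    have "push X W r1 (pull X Q (y1 \<cdot> a) \<theta>) = pull X A1 (y1 \<cdot> a) (push X C r1 \<theta>)" using d by simp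
    also have "\<dots> = pull X A1 a (pull X A1 y1 \<delta>1)" unfolding th using d by simp
    also have "\<dots> = null W A1" using d by (simp add: pull_null[OF t1])
    finally have p1: "push X W r1 (pull X Q (y1 \<cdot> a) \<theta>) = null W A1" .
    have "push X W r2 (pull X Q (y1 \<cdot> a) \<theta>) = pull X A2 (y2 \<cdot> b) (push X C r2 \<theta>)" using d ab by simp
    also have "\<dots> = pull X A2 b (pull X A2 y2 \<delta>2)" unfolding th using d by simp
    also have "\<dots> = null W A2" using d by (simp add: pull_null[OF t2])
    finally have p2: "push X W r2 (pull X Q (y1 \<cdot> a) \<theta>) = null W A2" .
    have "pull X Q (y1 \<cdot> a) \<theta> = push X W (s1 \<cdot> r1 \<^bold>+ s2 \<cdot> r2) (pull X Q (y1 \<cdot> a) \<theta>)"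
      unfolding biproduct_eqs(5)[OF bp] using d by simp
    also have "\<dots> = push X W s1 (push X W r1 (pull X Q (y1 \<cdot> a) \<theta>)) \<otimes>\<^bsub>Ext X W Q\<^esub>
        push X W s2 (push X W r2 (pull X Q (y1 \<cdot> a) \<theta>))" using d by simp
    also have "\<dots> = null W Q" unfolding p1 p2 using d by simp
    finally obtain l0 where l0: "l0 \<in> Hom X W M" "y1 \<cdot> a = g \<cdot> l0"
      using lift_deflation[OF t c] by metis
    note d = d HomD[OF l0(1)]
    have h: "m1 \<cdot> l0 \<in> Hom X W B1" "m2 \<cdot> l0 \<in> Hom X W B2" using d by (simp_all add: Hom_def)
    obtain w1 where w1: "w1 \<in> Hom X W B1" "a = m1 \<cdot> l0 \<^bold>+ w1" using difference[OF a h(1)] by metis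
    obtain w2 where w2: "w2 \<in> Hom X W B2" "b = m2 \<cdot> l0 \<^bold>+ w2" using difference[OF b h(2)] by metis
    note d = d HomD[OF w1(1)] HomD[OF w2(1)]
    have g: "g \<cdot> l0 = y1 \<cdot> (m1 \<cdot> l0)" "g \<cdot> l0 = y2 \<cdot> (m2 \<cdot> l0)"
      using d comp_reduce[OF e(3), of l0] comp_reduce[OF e(4), of l0] by simp_all
    have "g \<cdot> l0 \<^bold>+ y1 \<cdot> w1 = y1 \<cdot> a" using d unfolding w1(2) g(1) by simp
    then have "y1 \<cdot> w1 = Zmor X W C" using l0(2) by (intro add_eq_self[of "g \<cdot> l0"]) (use d in auto)
    then obtain a' where a': "a' \<in> Hom X W A1" "w1 = x1 \<cdot> a'" using factor_inflation[OF t1 w1(1)] by metis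
    have "g \<cdot> l0 \<^bold>+ y2 \<cdot> w2 = y2 \<cdot> b" using d unfolding w2(2) g(2) by simp
    then have "y2 \<cdot> w2 = Zmor X W C" using l0(2) ab by (intro add_eq_self[of "g \<cdot> l0"]) (use d in auto)
    then obtain b' where b': "b' \<in> Hom X W A2" "w2 = x2 \<cdot> b'" using factor_inflation[OF t2 w2(1)] by metis
    note d = d HomD[OF a'(1)] HomD[OF b'(1)]
    \<comment> \<open>\<open>h \<cdot> s1\<close> lies over \<open>x1\<close> and vanishes in
      \<open>B2\<close>, \<open>h \<cdot> s2\<close> lies over \<open>x2\<close> and vanishes in
      \<open>B1\<close>; so the two corrections do not interfere.\<close>
    define l where "l = l0 \<^bold>+ (h \<cdot> s1 \<cdot> a' \<^bold>+ h \<cdot> s2 \<cdot> b')"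
    have hs: "m1 \<cdot> (h \<cdot> (s1 \<cdot> a')) = x1 \<cdot> a'" "m2 \<cdot> (h \<cdot> (s2 \<cdot> b')) = x2 \<cdot> b'"
      "m1 \<cdot> (h \<cdot> (s2 \<cdot> b')) = Zmor X W B1" "m2 \<cdot> (h \<cdot> (s1 \<cdot> a')) = Zmor X W B2"
      using d comp_reduce[OF e(1), of a'] comp_reduce[OF e(2), of b']
        comp_reduce[OF triangle_comp_zero[OF m(1)], of a'] comp_reduce[OF triangle_comp_zero[OF m(2)], of b']
      by simp_all
    have "l \<in> Hom X W M" unfolding l_def using d by (simp add: Hom_def)
    moreover have "m1 \<cdot> l = a" unfolding l_def w1(2) a'(2) using d hs by simp
    moreover have "m2 \<cdot> l = b" unfolding l_def w2(2) b'(2) using d hs by simp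
    ultimately show ?thesis by blast
  qed
  then show thesis using that[OF m e(1,2)] e by simp
qed

lemma weak_pushout:
  assumes t1: "triangle X C B1 A1 x1 y1 \<delta>1" and t2: "triangle X C B2 A2 x2 y2 \<delta>2"
  obtains M k1 k2 m1 m2 where
    "triangle X B2 M A1 m2 k1 (push X A1 x2 \<delta>1)" "triangle X B1 M A2 m1 k2 (push X A2 x1 \<delta>2)"
proof -
  interpret op: extriangulated_category "op_data X" by (rule extriangulated_category_op)
  obtain M k1 k2 m1 m2 where
    "triangle (op_data X) A1 M B2 k1 m2 (pull (op_data X) A1 x2 \<delta>1)"
    "triangle (op_data X) A2 M B1 k2 m1 (pull (op_data X) A2 x1 \<delta>2)"
    using op.weak_pullback[of A1 B1 C y1 x1 \<delta>1 A2 B2 y2 x2 \<delta>2] t1 t2 by (metis triangle_op)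
  then show thesis using that by simp
qed

text \<open>(ET4) compares cones along an inflation, whereas here \<open>\<pi>\<close> is a
  deflation. The class \<open>\<delta>p\<close> dies on \<open>A\<close>, hence comes from some
  \<open>\<theta>\<close> on \<open>E\<close>, and \<open>P\<close> is recognized as a weak pullback
  along \<open>y\<close>. Dividing it by \<open>A\<close> leaves an extension of \<open>E\<close> by
  \<open>K\<close>, whose middle term is \<open>D\<close>.\<close>

lemma cone_of_composite_with_deflation:
  assumes tu: "triangle X A P D u w \<delta>u" and tp: "triangle X K P M k \<pi> \<delta>p"
    and tj: "triangle X A M E (\<pi> \<cdot> u) y \<delta>j"
  obtains z \<theta> where "triangle X K D E (w \<cdot> k) z \<theta>" "z \<cdot> w = y \<cdot> \<pi>"
proof -
  note d = triangleD[OF tu] triangleD[OF tp] triangleD[OF tj]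
  have "pull X K (\<pi> \<cdot> u) \<delta>p = pull X K u (pull X K \<pi> \<delta>p)" using d by simp
  also have "\<dots> = null A K" using d by (simp add: pull_null[OF tp])
  finally obtain \<theta> where th: "\<theta> \<in> carrier (Ext X E K)" "\<delta>p = pull X K y \<theta>"
    using pull_exact[OF tj, of K \<delta>p] d by auto
  obtain D0 x0 y0 where t0: "triangle X K D0 E x0 y0 \<theta>" using triangle_ex[OF _ _ th(1)] d by metis
  obtain Q s1 s2 r1 r2 M' h g \<Theta> m1 m2 where bp: "biproduct X A K Q s1 s2 r1 r2"
    and t: "triangle X Q M' E h g \<Theta>" and m: "triangle X K M' M (h \<cdot> s2) m1 (pull X K y \<theta>)"
    "m1 \<cdot> (h \<cdot> s1) = \<pi> \<cdot> u" "y \<cdot> m1 = g"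
    using weak_pullback_with_extension[OF tj t0] by metis
  obtain b where b: "b \<in> Hom X M' P" "iso_arr X b" "b \<cdot> (h \<cdot> s2) = k" "\<pi> \<cdot> b = m1"
    using triangle_mid_unique[OF m(1)] tp th(2) by metis
  note d = d biproductD[OF bp] triangleD[OF t] triangleD[OF m(1)] HomD[OF b(1)]
  have hk: "u \<in> Hom X A P" "b \<cdot> (h \<cdot> s1) \<in> Hom X A P" using d by (auto simp: Hom_def)
  obtain v where v: "v \<in> Hom X A P" "u = b \<cdot> (h \<cdot> s1) \<^bold>+ v" using difference[OF hk] by metis
  note d = d HomD[OF v(1)]
  have "\<pi> \<cdot> u \<^bold>+ \<pi> \<cdot> v = \<pi> \<cdot> (b \<cdot> (h \<cdot> s1) \<^bold>+ v)"
    using d comp_reduce[OF b(4), of "h \<cdot> s1"] m(2) by simp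
  then have "\<pi> \<cdot> u \<^bold>+ \<pi> \<cdot> v = \<pi> \<cdot> u" by (simp flip: v(2))
  then have "\<pi> \<cdot> v = Zmor X A M" by (rule add_eq_self) (use d in auto)
  then obtain s where s: "s \<in> Hom X A K" "v = k \<cdot> s" using factor_inflation[OF tp v(1)] by metis
  note d = d HomD[OF s(1)]
  \<comment> \<open>\<open>u\<close> differs from the canonical
    \<open>b \<cdot> (h \<cdot> s1)\<close> by \<open>k \<cdot> s\<close>. Shearing the
    decomposition of \<open>Q\<close> by \<open>s\<close> makes \<open>u\<close> the map induced by
    the first inclusion; \<open>r2'\<close> is the matching projection.\<close>
  define s1' where "s1' = s1 \<^bold>+ s2 \<cdot> s"
  define r2' where "r2' = r2 \<^bold>+ neg (s \<cdot> r1)"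
  note be = biproduct_eqs[OF bp]
  have "s1' \<cdot> r1 \<^bold>+ s2 \<cdot> r2' = s1 \<cdot> r1 \<^bold>+ (s2 \<cdot> (s \<cdot> r1) \<^bold>+ (neg (s2 \<cdot> (s \<cdot> r1)) \<^bold>+ s2 \<cdot> r2))"
    unfolding s1'_def r2'_def using d by (simp add: add_assoc add_comm[of "s2 \<cdot> r2"])
  also have "\<dots> = s1 \<cdot> r1 \<^bold>+ s2 \<cdot> r2" using d by (simp flip: add_assoc)
  finally have "s1' \<cdot> r1 \<^bold>+ s2 \<cdot> r2' = Ident X Q" using be by simp
  moreover have "r2' \<cdot> s1' = Zmor X A K" "r2' \<cdot> s2 = Ident X K" "r1 \<cdot> s1' = Ident X A"
    unfolding s1'_def r2'_def using d be
    by (simp_all add: comp_reduce[OF be(1)] comp_reduce[OF be(2)] comp_reduce[OF be(3)] comp_reduce[OF be(4)])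
  ultimately have bp': "biproduct X A K Q s1' s2 r1 r2'"
    unfolding biproduct_def using d be(4) by (simp add: Hom_def s1'_def r2'_def)
  have t': "triangle X Q P E (b \<cdot> h) (y \<cdot> \<pi>) \<Theta>"
    by (rule triangle_iso_mid[OF t b(2,1)]) (use d m(3) b(4) in \<open>auto simp: Hom_def\<close>)
  obtain D' m' k' e where q: "triangle X A P D' (b \<cdot> h \<cdot> s1') m' (ExtMap X e r1 \<Theta>)"
    "triangle X K D' E k' e (push X E r2' \<Theta>)" "k' \<cdot> r2' = m' \<cdot> (b \<cdot> h)" "e \<cdot> m' = y \<cdot> \<pi>"
    using quotient_by_summand[OF bp' t'] by metis
  have "b \<cdot> h \<cdot> s1' = b \<cdot> (h \<cdot> s1) \<^bold>+ b \<cdot> (h \<cdot> s2) \<cdot> s" unfolding s1'_def using d by simp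
  also have "\<dots> = u" using v(2) s(2) b(3) by simp
  finally have "triangle X A P D' u m' (ExtMap X e r1 \<Theta>)" using q(1) by simp
  then obtain c where c: "c \<in> Hom X D' D" "iso_arr X c" "c \<cdot> m' = w" using cone_unique tu by metis
  obtain c' where c': "c' \<in> Hom X D D'" "c' \<cdot> c = Ident X D'" "c \<cdot> c' = Ident X D" using iso_arrE[OF c(2,1)] by metis
  note d = d biproductD[OF bp'] triangleD[OF q(1)] triangleD[OF q(2)] HomD[OF c(1)] HomD[OF c'(1)]
  have "k' = (k' \<cdot> r2') \<cdot> s2" using d biproduct_eqs[OF bp'] by simp
  then have "c \<cdot> k' = c \<cdot> (m' \<cdot> (b \<cdot> (h \<cdot> s2)))" using d by (simp add: q(3))
  then have ck: "c \<cdot> k' = w \<cdot> k" using d comp_reduce[OF c(3), of k] by (simp add: b(3))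
  have "triangle X K D E (c \<cdot> k') (e \<cdot> c') (push X E r2' \<Theta>)"
    by (rule triangle_iso_mid[OF q(2) c(2,1)]) (use d c'(2) in \<open>auto simp: Hom_def\<close>)
  moreover have "(e \<cdot> c') \<cdot> w = y \<cdot> \<pi>" using d comp_reduce[OF c'(2), of m'] q(4) by (simp flip: c(3))
  ultimately show thesis using that ck by simp
qed

lemma cocone_of_composite_with_inflation:
  assumes tu: "triangle X D P A w u \<delta>u" and tp: "triangle X M P K \<pi> k \<delta>p"
    and tj: "triangle X E M A y (u \<cdot> \<pi>) \<delta>j"
  obtains z \<theta> where "triangle X E D K z (k \<cdot> w) \<theta>" "w \<cdot> z = \<pi> \<cdot> y"
  using extriangulated_category.cone_of_composite_with_deflation[OF extriangulated_category_op,
      of A P D u w \<delta>u K M k \<pi> \<delta>p E y \<delta>j] assms by auto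

end

section \<open>Orthogonality and cotorsion pairs\<close>

lemma Ext_vanishes_op [simp]: "Ext_vanishes (op_data X) \<U> \<V> \<longleftrightarrow> Ext_vanishes X \<V> \<U>"
  unfolding Ext_vanishes_def by auto

lemma ex_biproduct_op:
  "(\<exists>i j p q. biproduct (op_data X) A B P i j p q) \<longleftrightarrow> (\<exists>i j p q. biproduct X A B P i j p q)"
proof
  assume "\<exists>i j p q. biproduct (op_data X) A B P i j p q"
  then show "\<exists>i j p q. biproduct X A B P i j p q" by (elim exE) (unfold biproduct_op, blast)
next
  assume "\<exists>i j p q. biproduct X A B P i j p q"
  then obtain i j p q where "biproduct X A B P i j p q" by blast
  then have "biproduct (op_data X) A B P p q i j" by simp
  then show "\<exists>i j p q. biproduct (op_data X) A B P i j p q" by blast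
qed

lemma ex_conflation_op:
  "(\<exists>x y. conflation (op_data X) A B C x y) \<longleftrightarrow> (\<exists>x y. conflation X C B A x y)"
proof
  assume "\<exists>x y. conflation (op_data X) A B C x y"
  then show "\<exists>x y. conflation X C B A x y" by (elim exE) (unfold conflation_op, blast)
next
  assume "\<exists>x y. conflation X C B A x y"
  then obtain x y where "conflation X C B A x y" by blast
  then have "conflation (op_data X) A B C y x" by simp
  then show "\<exists>x y. conflation (op_data X) A B C x y" by blast
qed

lemma is_Cone_op [simp]: "is_Cone (op_data X) f C \<longleftrightarrow> is_CoCone X f C"
  and is_CoCone_op [simp]: "is_CoCone (op_data X) f C \<longleftrightarrow> is_Cone X f C"
  unfolding is_Cone_def is_CoCone_def conflation_op by blast+

lemma inflations_with_Cone_in_op [simp]: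
  "inflations_with_Cone_in (op_data X) \<U> = deflations_with_CoCone_in X \<U>"
  unfolding inflations_with_Cone_in_def deflations_with_CoCone_in_def by simp

lemma deflations_with_CoCone_in_op [simp]:
  "deflations_with_CoCone_in (op_data X) \<U> = inflations_with_Cone_in X \<U>"
  unfolding inflations_with_Cone_in_def deflations_with_CoCone_in_def by simp

context extriangulated_category
begin

abbreviation orth :: "'o \<Rightarrow> 'o \<Rightarrow> bool" where
  "orth C A \<equiv> \<forall>\<epsilon> \<in> carrier (Ext X C A). \<epsilon> = null C A"

lemma Ext_vanishes_iff:
  assumes "\<U> \<subseteq> Obj X" "\<V> \<subseteq> Obj X"
  shows "Ext_vanishes X \<U> \<V> \<longleftrightarrow> (\<forall>U \<in> \<U>. \<forall>V \<in> \<V>. orth U V)"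
  unfolding Ext_vanishes_def using assms null_closed by blast

lemma orth_mid_left:
  assumes t: "triangle X A B C x y \<delta>" and "W \<in> Obj X" "orth A W" "orth C W"
  shows "orth B W"
proof
  fix \<epsilon> assume e: "\<epsilon> \<in> carrier (Ext X B W)"
  note d = triangleD[OF t]
  have "pull X W x \<epsilon> = null A W" using assms e d by simp
  then obtain \<epsilon>' where e': "\<epsilon>' \<in> carrier (Ext X C W)" "\<epsilon> = pull X W y \<epsilon>'"
    using pull_exact[OF t assms(2) e] by metis
  have "\<epsilon>' = null C W" using assms(4) e'(1) by blast
  then show "\<epsilon> = null B W" using assms(2) d e'(2) by simp
qed

lemma orth_mid_right:
  assumes t: "triangle X A B C x y \<delta>" and "W \<in> Obj X" "orth W A" "orth W C"
  shows "orth W B"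
  using extriangulated_category.orth_mid_left[OF extriangulated_category_op, of C B A y x \<delta> W] assms by simp

text \<open>The group E(S,T) is used twice. The class \<open>push X S u \<delta>\<close> dies in
  \<open>N\<close>, so it comes from E(S,T), and \<open>u\<close> extends over \<open>i\<close> to
  \<open>h1\<close>. The remaining error \<open>v - p \<cdot> h1\<close> kills \<open>i\<close>, so
  it factors through \<open>S\<close>, and there it lifts along \<open>p\<close> because the
  obstruction again lies in E(S,T).\<close>

lemma lifting_if_orth:
  assumes i: "triangle X A B S i j \<delta>" and p: "triangle X T M N k p \<epsilon>" and o: "orth S T"
    and u: "u \<in> Hom X A M" and v: "v \<in> Hom X B N" and sq: "p \<cdot> u = v \<cdot> i"
  obtains h where "h \<in> Hom X B M" "h \<cdot> i = u" "p \<cdot> h = v"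
proof -
  note d = triangleD[OF i] triangleD[OF p] HomD[OF u] HomD[OF v]
  have e: "push X S u \<delta> \<in> carrier (Ext X S M)" using d by simp
  have "push X S p (push X S u \<delta>) = push X S v (push X S i \<delta>)" using d sq by simp
  also have "\<dots> = null S N" using d by (simp add: push_null[OF i])
  finally obtain \<epsilon>' where e': "\<epsilon>' \<in> carrier (Ext X S T)" "push X S u \<delta> = push X S k \<epsilon>'"
    using push_exact[OF p _ e] d by metis
  have "\<epsilon>' = null S T" using o e'(1) by blast
  then have "push X S u \<delta> = null S M" using e'(2) d by simp
  then obtain h1 where h1: "h1 \<in> Hom X B M" "u = h1 \<cdot> i" using extend_inflation[OF i u] by metis
  note d = d HomD[OF h1(1)]
  have "p \<cdot> h1 \<in> Hom X B N" using d by (simp add: Hom_def)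
  then obtain w' where w': "w' \<in> Hom X B N" "v = p \<cdot> h1 \<^bold>+ w'" using difference[OF v] by metis
  note d = d HomD[OF w'(1)]
  have "p \<cdot> u \<^bold>+ w' \<cdot> i = v \<cdot> i" unfolding w'(2) h1(2) using d by simp
  then have "w' \<cdot> i = Zmor X A N" unfolding sq[symmetric] by (rule add_eq_self) (use d in auto)
  then obtain w where w: "w \<in> Hom X S N" "w' = w \<cdot> j" using factor_deflation[OF i w'(1)] by metis
  note d = d HomD[OF w(1)]
  have "pull X T w \<epsilon> \<in> carrier (Ext X S T)" using d by simp
  then have "pull X T w \<epsilon> = null S T" using o by blast
  then obtain w2 where w2: "w2 \<in> Hom X S M" "w = p \<cdot> w2" using lift_deflation[OF p w(1)] by metis
  note d = d HomD[OF w2(1)]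
  have "(h1 \<^bold>+ w2 \<cdot> j) \<cdot> i = u" using d h1(2) triangle_comp_zero[OF i] by simp
  moreover have "p \<cdot> (h1 \<^bold>+ w2 \<cdot> j) = v" unfolding w'(2) w(2) w2(2) using d by simp
  moreover have "h1 \<^bold>+ w2 \<cdot> j \<in> Hom X B M" using d by (simp add: Hom_def)
  ultimately show thesis using that by blast
qed

text \<open>\<open>c'\<close> only has to split \<open>c\<close> up to an automorphism, since (ET3)
  yields maps between cones whose composite is known to be invertible but not to be the
  identity.\<close>

lemma orth_retract:
  assumes c: "c \<in> Hom X C C'" "c' \<in> Hom X C' C" "iso_arr X (c' \<cdot> c)" and T: "T \<in> Obj X" "orth C' T"
  shows "orth C T"
proof
  fix \<epsilon> assume e: "\<epsilon> \<in> carrier (Ext X C T)"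
  note d = HomD[OF c(1)] HomD[OF c(2)]
  have "c' \<cdot> c \<in> Hom X C C" using d by (simp add: Hom_def)
  then obtain v where v: "v \<in> Hom X C C" "(c' \<cdot> c) \<cdot> v = Ident X C" using iso_arrE[OF c(3)] by metis
  note d = d HomD[OF v(1)]
  have "pull X T c' \<epsilon> \<in> carrier (Ext X C' T)" using T(1) d e by simp
  then have "pull X T c' \<epsilon> = null C' T" using T(2) by blast
  then have "pull X T (c \<cdot> v) (pull X T c' \<epsilon>) = null C T" using d T(1) by simp
  moreover have "pull X T (c \<cdot> v) (pull X T c' \<epsilon>) = pull X T ((c' \<cdot> c) \<cdot> v) \<epsilon>" using d T(1) e by simp
  ultimately show "\<epsilon> = null C T" using v(2) d T(1) e by simp
qed

lemma orth_section:
  assumes c: "c \<in> Hom X C C'" "c' \<in> Hom X C' C" "c' \<cdot> c = Ident X C" and T: "T \<in> Obj X" "orth C' T"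
  shows "orth C T"
  by (rule orth_retract[OF c(1,2) _ T]) (use c(3) HomD[OF c(1)] in simp)

text \<open>The maps on cones given by (ET3) are not functorial, but their composite fixes both
  \<open>y\<close> and \<open>\<delta>\<close>, so \<open>iso_third_endo\<close> makes it
  invertible.\<close>

lemma cone_retract_orth:
  assumes t: "triangle X A B C x y \<delta>" and t': "triangle X A' B' C' x' y' \<delta>'"
    and i: "i \<in> Hom X A A'" and r: "r \<in> Hom X A' A" "r \<cdot> i = Ident X A"
    and j: "j \<in> Hom X B B'" and s: "s \<in> Hom X B' B" "s \<cdot> j = Ident X B"
    and sq: "x' \<cdot> i = j \<cdot> x" "x \<cdot> r = s \<cdot> x'"
    and T: "T \<in> Obj X" "orth C' T"
  shows "orth C T"
proof -
  obtain c where c: "c \<in> Hom X C C'" "ext_morphism X i c \<delta> \<delta>'" "y' \<cdot> j = c \<cdot> y"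
    using ET3[OF t t' i j] sq by auto
  obtain c' where c': "c' \<in> Hom X C' C" "ext_morphism X r c' \<delta>' \<delta>" "y \<cdot> s = c' \<cdot> y'"
    using ET3[OF t' t r(1) s(1)] sq by auto
  note d = triangleD[OF t] triangleD[OF t'] HomD[OF i] HomD[OF r(1)] HomD[OF j] HomD[OF s(1)]
    HomD[OF c(1)] HomD[OF c'(1)]
  have m: "push X C i \<delta> = pull X A' c \<delta>'" "push X C' r \<delta>' = pull X A c' \<delta>"
    using c(2) c'(2) d unfolding ext_morphism_def by auto
  have "(c' \<cdot> c) \<cdot> y = c' \<cdot> (y' \<cdot> j)" using d by (simp add: c(3))
  also have "\<dots> = y" using d comp_square[OF c'(3), of j] by (simp add: s(2))
  finally have e1: "(c' \<cdot> c) \<cdot> y = y" .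
  have "pull X A (c' \<cdot> c) \<delta> = pull X A c (pull X A c' \<delta>)" using d by simp
  also have "\<dots> = push X C r (pull X A' c \<delta>')" unfolding m(2)[symmetric] using d by simp
  also have "\<dots> = \<delta>" unfolding m(1)[symmetric] using d r(2) by simp
  finally have e2: "pull X A (c' \<cdot> c) \<delta> = \<delta>" .
  have "iso_arr X (c' \<cdot> c)" by (rule iso_third_endo[OF t _ e1 e2]) (use d in \<open>simp add: Hom_def\<close>)
  from orth_retract[OF c(1) c'(1) this T] show ?thesis .
qed

lemma cone_orth_independent:
  assumes t: "triangle X A B C x y \<delta>" and t': "triangle X A B C' x y' \<delta>'" and T: "T \<in> Obj X" "orth C' T"
  shows "orth C T"
  by (rule cone_retract_orth[OF t t' Ident_Hom Ident_Hom _ Ident_Hom Ident_Hom _ _ _ T])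
    (use triangleD[OF t] in simp_all)

lemma orth_zero_left:
  assumes "zero_object X Z" "A \<in> Obj X" shows "orth Z A"
proof
  fix \<epsilon> assume e: "\<epsilon> \<in> carrier (Ext X Z A)"
  have z: "Z \<in> Obj X" using assms by (simp add: zero_object_Obj)
  have "\<epsilon> = pull X A (Zmor X Z Z) \<epsilon>" using z e assms by (simp flip: zero_object_ident)
  then show "\<epsilon> = null Z A" using z e assms by simp
qed

lemma biproduct_Hom:
  assumes "biproduct X A B P i j p q"
  shows "i \<in> Hom X A P" "j \<in> Hom X B P" "p \<in> Hom X P A" "q \<in> Hom X P B"
  using assms unfolding biproduct_def by blast+

lemma left_orthogonal_closure:
  assumes U: "\<U> = {C \<in> Obj X. \<forall>V \<in> \<V>. orth C V}" and V: "\<V> \<subseteq> Obj X"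
  shows "additive_subcategory X \<U>" "closed_under_isos X \<U>" "closed_under_summands X \<U>"
proof -
  obtain Z where Z: "zero_object X Z" using ex_zero_object by blast
  have "orth Z W" if "W \<in> \<V>" for W using orth_zero_left[OF Z] that V by blast
  then have "Z \<in> \<U>" unfolding U using zero_object_Obj[OF Z] by simp
  then have "\<exists>Z \<in> \<U>. zero_object X Z" using Z by blast
  moreover have "\<exists>P \<in> \<U>. \<exists>i j p q. biproduct X A B P i j p q" if AB: "A \<in> \<U>" "B \<in> \<U>" for A B
  proof -
    obtain P i j p q where bp: "biproduct X A B P i j p q" using ex_biproduct AB U by blast
    have "orth P W" if "W \<in> \<V>" for W
      by (rule orth_mid_left[OF split_triangle[OF bp]]) (use AB that V U in auto)
    then have "P \<in> \<U>" unfolding U using biproductD[OF bp] by simp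
    then show ?thesis using bp by blast
  qed
  ultimately show "additive_subcategory X \<U>" unfolding additive_subcategory_def using U by auto
  show "closed_under_isos X \<U>" unfolding closed_under_isos_def
  proof (intro allI impI)
    fix f assume f: "iso_arr X f \<and> Dom X f \<in> \<U>"
    then have a: "f \<in> Hom X (Dom X f) (Cod X f)" by (simp add: iso_arr_def Hom_def)
    then obtain g where g: "g \<in> Hom X (Cod X f) (Dom X f)" "f \<cdot> g = Ident X (Cod X f)"
      using iso_arrE f by metis
    have "orth (Cod X f) W" if "W \<in> \<V>" for W
      by (rule orth_section[OF g(1) a g(2)]) (use f that V U in auto)
    then show "Cod X f \<in> \<U>" unfolding U using HomD[OF a] by simp
  qed
  show "closed_under_summands X \<U>" unfolding closed_under_summands_def
  proof (intro allI impI)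
    fix A B P i j p q
    assume h: "A \<in> Obj X \<and> B \<in> Obj X \<and> biproduct X A B P i j p q \<and> P \<in> \<U>"
    then have bp: "biproduct X A B P i j p q" by blast
    have "orth A W" "orth B W" if "W \<in> \<V>" for W
      by (rule orth_section[OF biproduct_Hom(1,3)[OF bp] biproduct_eqs(1)[OF bp]]; use h that V U in auto)
         (rule orth_section[OF biproduct_Hom(2,4)[OF bp] biproduct_eqs(2)[OF bp]]; use h that V U in auto)
    then show "A \<in> \<U> \<and> B \<in> \<U>" unfolding U using h by simp
  qed
qed

lemma zero_object_op': "zero_object (op_data X) = zero_object X"
  by (rule ext) simp

lemma additive_subcategory_op [simp]: "additive_subcategory (op_data X) \<U> \<longleftrightarrow> additive_subcategory X \<U>"
  unfolding additive_subcategory_def ex_biproduct_op zero_object_op' by simp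

lemma closed_under_summands_op [simp]: "closed_under_summands (op_data X) \<U> \<longleftrightarrow> closed_under_summands X \<U>"
  unfolding closed_under_summands_def by (simp; metis)

lemma closed_under_isos_op [simp]: "closed_under_isos (op_data X) \<U> \<longleftrightarrow> closed_under_isos X \<U>"
proof -
  have "\<exists>g. iso_arr X g \<and> Dom X g = Cod X f \<and> Cod X g = Dom X f" if "iso_arr X f" for f
    using iso_arrE[OF that, of "Dom X f" "Cod X f"] that unfolding iso_arr_def Hom_def by blast
  then show ?thesis unfolding closed_under_isos_def by simp metis
qed

lemma cotorsion_pair_op [simp]: "cotorsion_pair (op_data X) (\<V>, \<U>) \<longleftrightarrow> cotorsion_pair X (\<U>, \<V>)"
  unfolding cotorsion_pair.simps ex_conflation_op additive_subcategory_op closed_under_isos_op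
    closed_under_summands_op Ext_vanishes_op op_data_simps
  by blast

lemma right_orthogonal_closure:
  assumes "\<V> = {A \<in> Obj X. \<forall>U \<in> \<U>. orth U A}" and "\<U> \<subseteq> Obj X"
  shows "additive_subcategory X \<V>" "closed_under_isos X \<V>" "closed_under_summands X \<V>"
  using extriangulated_category.left_orthogonal_closure[OF extriangulated_category_op, of \<V> \<U>] assms
  by simp_all

section \<open>Cotorsion pairs as pairs of mutual orthogonals\<close>

lemma cotorsion_pairD:
  assumes "cotorsion_pair X (\<U>, \<V>)"
  shows "\<U> \<subseteq> Obj X" "\<V> \<subseteq> Obj X" "closed_under_summands X \<U>" "Ext_vanishes X \<U> \<V>"
  using assms unfolding cotorsion_pair.simps additive_subcategory_def by blast+

lemma cotorsion_pair_approximations: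
  assumes cp: "cotorsion_pair X (\<U>, \<V>)" and C: "C \<in> Obj X"
  shows "\<exists>V U x y \<delta>. V \<in> \<V> \<and> U \<in> \<U> \<and> triangle X V U C x y \<delta>"
    "\<exists>V U x y \<delta>. V \<in> \<V> \<and> U \<in> \<U> \<and> triangle X C V U x y \<delta>"
proof -
  have "\<exists>V \<in> \<V>. \<exists>U \<in> \<U>. \<exists>x y. conflation X V U C x y" "\<exists>V \<in> \<V>. \<exists>U \<in> \<U>. \<exists>x y. conflation X C V U x y"
    using cp C unfolding cotorsion_pair.simps by blast+
  then show "\<exists>V U x y \<delta>. V \<in> \<V> \<and> U \<in> \<U> \<and> triangle X V U C x y \<delta>"
    "\<exists>V U x y \<delta>. V \<in> \<V> \<and> U \<in> \<U> \<and> triangle X C V U x y \<delta>"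
    unfolding conflation_def by blast+
qed

text \<open>If \<open>C\<close> is left orthogonal to \<open>\<V>\<close>, its approximation
  \<open>V -> U -> C\<close> splits and makes \<open>C\<close> a direct summand of
  \<open>U\<close>.\<close>

lemma cotorsion_pair_left:
  assumes cp: "cotorsion_pair X (\<U>, \<V>)"
  shows "\<U> = {C \<in> Obj X. \<forall>V \<in> \<V>. orth C V}"
proof -
  note sub = cotorsion_pairD(1,2)[OF cp]
  have "orth C V" if "C \<in> \<U>" "V \<in> \<V>" for C V
    using cotorsion_pairD(4)[OF cp] that unfolding Ext_vanishes_iff[OF sub] by blast
  moreover have "C \<in> \<U>" if C: "C \<in> Obj X" "\<forall>V \<in> \<V>. orth C V" for C
  proof -
    obtain V U x y \<delta> where t: "V \<in> \<V>" "U \<in> \<U>" "triangle X V U C x y \<delta>"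
      using cotorsion_pair_approximations(1)[OF cp C(1)] by blast
    then have "triangle X V U C x y (null C V)" using C triangleD[OF t(3)] by metis
    then obtain j p where "biproduct X V C U x j p y" using split_biproduct by metis
    then show ?thesis using cotorsion_pairD(3)[OF cp] t(2) triangleD[OF t(3)]
      unfolding closed_under_summands_def by blast
  qed
  ultimately show ?thesis using sub by blast
qed

lemma cotorsion_pair_right:
  assumes cp: "cotorsion_pair X (\<U>, \<V>)"
  shows "\<V> = {A \<in> Obj X. \<forall>U \<in> \<U>. orth U A}"
  using extriangulated_category.cotorsion_pair_left[OF extriangulated_category_op, of \<V> \<U>] cp
  unfolding cotorsion_pair_op by simp

section \<open>Lifting and factorization for a cotorsion pair\<close>

lemma mem_inflations_with_Cone_in:
  "f \<in> inflations_with_Cone_in X \<U> \<longleftrightarrow> (\<exists>A B C y \<delta>. C \<in> \<U> \<and> triangle X A B C f y \<delta>)"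
  unfolding inflations_with_Cone_in_def inflation_def is_Cone_def conflation_def
  using triangleD by blast

lemma mem_deflations_with_CoCone_in:
  "f \<in> deflations_with_CoCone_in X \<U> \<longleftrightarrow> (\<exists>A B C x \<delta>. A \<in> \<U> \<and> triangle X A B C x f \<delta>)"
  unfolding deflations_with_CoCone_in_def deflation_def is_CoCone_def conflation_def
  using triangleD by blast

lemma has_lifting_if_Ext_vanishes:
  assumes "\<And>U V. U \<in> \<U> \<Longrightarrow> V \<in> \<V> \<Longrightarrow> orth U V"
  shows "has_lifting X (inflations_with_Cone_in X \<U>) (deflations_with_CoCone_in X \<V>)"
  unfolding has_lifting_def
proof (intro ballI impI)
  fix i p u v
  assume ip: "i \<in> inflations_with_Cone_in X \<U>" "p \<in> deflations_with_CoCone_in X \<V>"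
    and u: "u \<in> Hom X (Dom X i) (Dom X p)" and v: "v \<in> Hom X (Cod X i) (Cod X p)" and sq: "p \<cdot> u = v \<cdot> i"
  obtain A B C y \<delta> where i: "C \<in> \<U>" "triangle X A B C i y \<delta>"
    using ip mem_inflations_with_Cone_in by blast
  obtain K M N k \<epsilon> where p: "K \<in> \<V>" "triangle X K M N k p \<epsilon>"
    using ip mem_deflations_with_CoCone_in by blast
  note d = triangleD[OF i(2)] triangleD[OF p(2)]
  have uv: "u \<in> Hom X A M" "v \<in> Hom X B N" using u v d by auto
  show "\<exists>h \<in> Hom X (Cod X i) (Dom X p). h \<cdot> i = u \<and> p \<cdot> h = v"
    using lifting_if_orth[OF i(2) p(2) assms[OF i(1) p(1)] uv sq] d by metis
qed

lemma WIC_inflation: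
  assumes "WIC X" "inflation X (g \<cdot> f)" "f \<in> Hom X A B" "g \<in> Hom X B C"
  obtains D y \<delta> where "triangle X A B D f y \<delta>"
proof -
  have "inflation X f" using assms unfolding WIC_def by blast
  then obtain A' B' D y \<delta> where t: "triangle X A' B' D f y \<delta>" unfolding inflation_def conflation_def by blast
  then show thesis using that triangleD[OF t] HomD[OF assms(3)] by metis
qed

lemma WIC_deflation:
  assumes "WIC X" "deflation X (g \<cdot> f)" "f \<in> Hom X A B" "g \<in> Hom X B C"
  obtains K x \<delta> where "triangle X K B C x g \<delta>"
proof -
  have "deflation X g" using assms unfolding WIC_def by blast
  then obtain K B' C' x \<delta> where t: "triangle X K B' C' x g \<delta>" unfolding deflation_def conflation_def by blast
  then show thesis using that triangleD[OF t] HomD[OF assms(4)] by metis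
qed

lemma inflationI: "triangle X A B C x y \<delta> \<Longrightarrow> inflation X x"
  and deflationI: "triangle X A B C x y \<delta> \<Longrightarrow> deflation X y"
  unfolding inflation_def deflation_def conflation_def by blast+

text \<open>Under (WIC), \<open>(f, a) : A \<rightarrow> B \<oplus> V\<close> is an inflation for every inflation \<open>a : A \<rightarrow> V\<close>;
  its cone is then corrected by pulling back along an approximation \<open>V' \<rightarrow> U' \<rightarrow> C\<close>.\<close>

lemma cotorsion_pair_factorization:
  assumes cp: "cotorsion_pair X (\<U>, \<V>)" and wic: "WIC X"
  shows "has_factorization X (inflations_with_Cone_in X \<U>) (deflations_with_CoCone_in X \<V>)"
  unfolding has_factorization_def
proof
  fix f assume f: "f \<in> Arr X"
  define A B where "A = Dom X f" and "B = Cod X f"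
  have o: "A \<in> Obj X" "B \<in> Obj X" using f Dom_Obj Cod_Obj A_def B_def by auto
  obtain V U a a' \<alpha> where a: "V \<in> \<V>" "U \<in> \<U>" "triangle X A V U a a' \<alpha>"
    using cotorsion_pair_approximations(2)[OF cp o(1)] by blast
  note d = triangleD[OF a(3)]
  obtain P iB iV pB pV where bp: "biproduct X B V P iB iV pB pV" using ex_biproduct d o by blast
  note d = d biproductD[OF bp] and be = biproduct_eqs[OF bp]
  define t where "t = iB \<cdot> f \<^bold>+ iV \<cdot> a"
  have t: "t \<in> Hom X A P" unfolding t_def using d f A_def B_def by (simp add: Hom_def)
  have pt: "pV \<cdot> t = a" "pB \<cdot> t = f" unfolding t_def using d f A_def B_def
    by (simp_all add: comp_reduce[OF be(1)] comp_reduce[OF be(2)] comp_reduce[OF be(3)] comp_reduce[OF be(4)])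
  have "inflation X (pV \<cdot> t)" using a(3) unfolding pt by (rule inflationI)
  then obtain C c \<gamma> where c: "triangle X A P C t c \<gamma>"
    using WIC_inflation[OF wic _ t biproduct_Hom(4)[OF bp]] by metis
  obtain V' U' v u \<beta> where v: "V' \<in> \<V>" "U' \<in> \<U>" "triangle X V' U' C v u \<beta>"
    using cotorsion_pair_approximations(1)[OF cp, of C] triangleD[OF c] by blast
  \<comment> \<open>Pulling back along \<open>u\<close> replaces the cone \<open>C\<close> by
    \<open>U'\<close>, at the cost of a deflation \<open>m1\<close> with kernel
    \<open>V'\<close>.\<close>
  obtain M k1 k2 m1 m2 where m: "triangle X A M U' k1 m2 (pull X A u \<gamma>)"
    "triangle X V' M P k2 m1 (pull X V' c \<beta>)" "m1 \<cdot> k1 = t"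
    using weak_pullback[OF c v(3)] by metis
  \<comment> \<open>The cocone of the composite of \<open>m1\<close> with the projection
    \<open>pB\<close> is an extension of \<open>V\<close> by \<open>V'\<close>.\<close>
  obtain E h' \<delta>'' k e \<zeta> where E: "triangle X E M B h' (pB \<cdot> m1) \<delta>''" "triangle X V' E V k e \<zeta>"
    using ET4_op[OF m(2) split_triangle[OF biproduct_swap[OF bp]]] by blast
  have "E \<in> \<V>"
  proof -
    have "orth W E" if "W \<in> \<U>" for W
      by (rule orth_mid_right[OF E(2)]) (use that a(1) v(1) cotorsion_pair_left[OF cp] in auto)
    then show ?thesis unfolding cotorsion_pair_right[OF cp] using triangleD[OF E(1)] by simp
  qed
  then have "pB \<cdot> m1 \<in> deflations_with_CoCone_in X \<V>" using E mem_deflations_with_CoCone_in by blast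
  moreover have "k1 \<in> inflations_with_Cone_in X \<U>" using m v mem_inflations_with_Cone_in by blast
  moreover have "f = (pB \<cdot> m1) \<cdot> k1" using d pt(2) m(3) triangleD[OF m(1)] triangleD[OF m(2)] by simp
  moreover have "Cod X k1 = Dom X (pB \<cdot> m1)" using d triangleD[OF m(1)] triangleD[OF m(2)] by simp
  ultimately show "\<exists>i \<in> inflations_with_Cone_in X \<U>. \<exists>p \<in> deflations_with_CoCone_in X \<V>.
      Cod X i = Dom X p \<and> f = p \<cdot> i" by blast
qed

end

lemma retract_ofE:
  assumes "retract_of X f g"
  obtains i r j s where "f \<in> Arr X" "g \<in> Arr X"
    "i \<in> Hom X (Dom X f) (Dom X g)" "r \<in> Hom X (Dom X g) (Dom X f)" "r \<cdot>\<^bsub>X\<^esub> i = Ident X (Dom X f)"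
    "j \<in> Hom X (Cod X f) (Cod X g)" "s \<in> Hom X (Cod X g) (Cod X f)" "s \<cdot>\<^bsub>X\<^esub> j = Ident X (Cod X f)"
    "g \<cdot>\<^bsub>X\<^esub> i = j \<cdot>\<^bsub>X\<^esub> f" "f \<cdot>\<^bsub>X\<^esub> r = s \<cdot>\<^bsub>X\<^esub> g"
  using assms unfolding retract_of_def by blast

lemma retract_ofI:
  "\<lbrakk>f \<in> Arr X; g \<in> Arr X; i \<in> Hom X (Dom X f) (Dom X g); r \<in> Hom X (Dom X g) (Dom X f);
    r \<cdot>\<^bsub>X\<^esub> i = Ident X (Dom X f); j \<in> Hom X (Cod X f) (Cod X g); s \<in> Hom X (Cod X g) (Cod X f);
    s \<cdot>\<^bsub>X\<^esub> j = Ident X (Cod X f); g \<cdot>\<^bsub>X\<^esub> i = j \<cdot>\<^bsub>X\<^esub> f; f \<cdot>\<^bsub>X\<^esub> r = s \<cdot>\<^bsub>X\<^esub> g\<rbrakk> \<Longrightarrow> retract_of X f g"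
  unfolding retract_of_def by blast

lemma retract_of_op [simp]: "retract_of (op_data X) f g \<longleftrightarrow> retract_of X f g"
proof
  assume "retract_of (op_data X) f g"
  then show "retract_of X f g"
  proof (rule retract_ofE)
    fix i r j s
    assume "f \<in> Arr (op_data X)" "g \<in> Arr (op_data X)"
      "i \<in> Hom (op_data X) (Dom (op_data X) f) (Dom (op_data X) g)"
      "r \<in> Hom (op_data X) (Dom (op_data X) g) (Dom (op_data X) f)"
      "r \<cdot>\<^bsub>op_data X\<^esub> i = Ident (op_data X) (Dom (op_data X) f)"
      "j \<in> Hom (op_data X) (Cod (op_data X) f) (Cod (op_data X) g)"
      "s \<in> Hom (op_data X) (Cod (op_data X) g) (Cod (op_data X) f)"
      "s \<cdot>\<^bsub>op_data X\<^esub> j = Ident (op_data X) (Cod (op_data X) f)"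
      "g \<cdot>\<^bsub>op_data X\<^esub> i = j \<cdot>\<^bsub>op_data X\<^esub> f" "f \<cdot>\<^bsub>op_data X\<^esub> r = s \<cdot>\<^bsub>op_data X\<^esub> g"
    then show "retract_of X f g" by (intro retract_ofI[of f X g s j r i]) simp_all
  qed
next
  assume "retract_of X f g"
  then show "retract_of (op_data X) f g"
  proof (rule retract_ofE)
    fix i r j s
    assume "f \<in> Arr X" "g \<in> Arr X"
      "i \<in> Hom X (Dom X f) (Dom X g)" "r \<in> Hom X (Dom X g) (Dom X f)" "r \<cdot>\<^bsub>X\<^esub> i = Ident X (Dom X f)"
      "j \<in> Hom X (Cod X f) (Cod X g)" "s \<in> Hom X (Cod X g) (Cod X f)" "s \<cdot>\<^bsub>X\<^esub> j = Ident X (Cod X f)"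
      "g \<cdot>\<^bsub>X\<^esub> i = j \<cdot>\<^bsub>X\<^esub> f" "f \<cdot>\<^bsub>X\<^esub> r = s \<cdot>\<^bsub>X\<^esub> g"
    then show "retract_of (op_data X) f g" by (intro retract_ofI[of f "op_data X" g s j r i]) simp_all
  qed
qed

lemma closed_under_retracts_op [simp]: "closed_under_retracts (op_data X) W \<longleftrightarrow> closed_under_retracts X W"
  unfolding closed_under_retracts_def by simp

section \<open>Closure properties of the two classes of morphisms of a cotorsion pair\<close>

context extriangulated_category
begin

lemma inflation_with_Cone_triangle:
  assumes "f \<in> inflations_with_Cone_in X \<U>"
  obtains C y \<delta> where "C \<in> \<U>" "triangle X (Dom X f) (Cod X f) C f y \<delta>"
proof -
  obtain A B C y \<delta> where t: "C \<in> \<U>" "triangle X A B C f y \<delta>"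
    using assms mem_inflations_with_Cone_in by blast
  then show thesis using that triangleD[OF t(2)] by metis
qed

lemma deflation_with_CoCone_triangle:
  assumes "f \<in> deflations_with_CoCone_in X \<V>"
  obtains K x \<delta> where "K \<in> \<V>" "triangle X K (Dom X f) (Cod X f) x f \<delta>"
proof -
  obtain A B C x \<delta> where t: "A \<in> \<V>" "triangle X A B C x f \<delta>"
    using assms mem_deflations_with_CoCone_in by blast
  then show thesis using that triangleD[OF t(2)] by metis
qed

lemma cotorsion_pair_orth: "\<lbrakk>cotorsion_pair X (\<U>, \<V>); A \<in> \<U>; B \<in> \<V>\<rbrakk> \<Longrightarrow> orth A B"
  using cotorsion_pair_left by blast

lemma cotorsion_pair_leftI:
  assumes "cotorsion_pair X (\<U>, \<V>)" "C \<in> Obj X" "\<And>B. B \<in> \<V> \<Longrightarrow> orth C B" shows "C \<in> \<U>"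
  unfolding cotorsion_pair_left[OF assms(1)] using assms(2,3) by blast

lemma left_extension_closed:
  assumes cp: "cotorsion_pair X (\<U>, \<V>)" and t: "triangle X A B C x y \<delta>" and "A \<in> \<U>" "C \<in> \<U>"
  shows "B \<in> \<U>"
proof (rule cotorsion_pair_leftI[OF cp])
  show "orth B W" if "W \<in> \<V>" for W
    using orth_mid_left[OF t _ cotorsion_pair_orth[OF cp assms(3) that] cotorsion_pair_orth[OF cp assms(4) that]]
      cotorsion_pairD(2)[OF cp] that by blast
qed (use triangleD[OF t] in simp)

lemma right_extension_closed:
  assumes cp: "cotorsion_pair X (\<U>, \<V>)" and t: "triangle X A B C x y \<delta>" and "A \<in> \<V>" "C \<in> \<V>"
  shows "B \<in> \<V>"
  using extriangulated_category.left_extension_closed[OF extriangulated_category_op, of \<V> \<U> C B A y x \<delta>]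
    assms unfolding cotorsion_pair_op by simp

text \<open>The class is defined by the existence of one good cone; vanishing of extensions does not
  depend on the chosen cone, so every cone is good.\<close>

lemma cone_in_left:
  assumes cp: "cotorsion_pair X (\<U>, \<V>)" and f: "f \<in> inflations_with_Cone_in X \<U>"
    and t: "triangle X A B C f y \<delta>"
  shows "C \<in> \<U>"
proof (rule cotorsion_pair_leftI[OF cp])
  obtain C' y' \<delta>' where t': "C' \<in> \<U>" "triangle X (Dom X f) (Cod X f) C' f y' \<delta>'"
    using inflation_with_Cone_triangle[OF f] by metis
  have "triangle X A B C' f y' \<delta>'" using t'(2) triangleD[OF t] by simp
  from cone_orth_independent[OF t this] show "orth C W" if "W \<in> \<V>" for W
    using cotorsion_pair_orth[OF cp t'(1) that] cotorsion_pairD(2)[OF cp] that by blast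
qed (use triangleD[OF t] in simp)

lemma cocone_in_right:
  assumes cp: "cotorsion_pair X (\<U>, \<V>)" and f: "f \<in> deflations_with_CoCone_in X \<V>"
    and t: "triangle X A B C x f \<delta>"
  shows "A \<in> \<V>"
  using extriangulated_category.cone_in_left[OF extriangulated_category_op, of \<V> \<U> f C B A x \<delta>]
    assms unfolding cotorsion_pair_op by simp

lemma inflations_with_Cone_in_comp:
  assumes cp: "cotorsion_pair X (\<U>, \<V>)" and f: "f \<in> inflations_with_Cone_in X \<U>"
    and g: "g \<in> inflations_with_Cone_in X \<U>" and fg: "Cod X f = Dom X g"
  shows "g \<cdot> f \<in> inflations_with_Cone_in X \<U>"
proof -
  obtain C y \<delta> where tf: "C \<in> \<U>" "triangle X (Dom X f) (Cod X f) C f y \<delta>"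
    using inflation_with_Cone_triangle[OF f] by metis
  obtain D z \<epsilon> where tg: "D \<in> \<U>" "triangle X (Cod X f) (Cod X g) D g z \<epsilon>"
    using inflation_with_Cone_triangle[OF g] fg by metis
  obtain E h' \<delta>'' d e where q: "triangle X (Dom X f) (Cod X g) E (g \<cdot> f) h' \<delta>''"
    "triangle X C E D d e (push X D y \<epsilon>)" using ET4[OF tf(2) tg(2)] by blast
  have "E \<in> \<U>" by (rule left_extension_closed[OF cp q(2) tf(1) tg(1)])
  then show ?thesis using q(1) mem_inflations_with_Cone_in by blast
qed

lemma deflations_with_CoCone_in_comp:
  assumes cp: "cotorsion_pair X (\<U>, \<V>)" and f: "f \<in> deflations_with_CoCone_in X \<V>"
    and g: "g \<in> deflations_with_CoCone_in X \<V>" and fg: "Cod X f = Dom X g"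
  shows "g \<cdot> f \<in> deflations_with_CoCone_in X \<V>"
  using extriangulated_category.inflations_with_Cone_in_comp[OF extriangulated_category_op, of \<V> \<U> g f]
    assms unfolding cotorsion_pair_op by simp

lemma WIC_section_inflation:
  assumes "WIC X" and i: "i \<in> Hom X A B" "r \<in> Hom X B A" "r \<cdot> i = Ident X A"
  obtains C y \<delta> where "triangle X A B C i y \<delta>"
proof -
  obtain Z where Z: "zero_object X Z" using ex_zero_object by blast
  have "triangle X A A Z (Ident X A) (Zmor X A Z) (null Z A)"
    by (rule triangle_ident_left) (use Z HomD[OF i(1)] in auto)
  then have "inflation X (r \<cdot> i)" unfolding i(3) by (rule inflationI)
  then show thesis using WIC_inflation[OF assms(1) _ i(1,2)] that by metis
qed

text \<open>By (WIC) the section \<open>i\<close> is an inflation, hence so is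
  \<open>g \<cdot> i = j \<cdot> f\<close> by (ET4), and (WIC) again reaches \<open>f\<close>. Its
  cone is then a retract, up to an automorphism, of the cone of \<open>g\<close>.\<close>

lemma inflations_with_Cone_in_retracts:
  assumes cp: "cotorsion_pair X (\<U>, \<V>)" and wic: "WIC X"
  shows "closed_under_retracts X (inflations_with_Cone_in X \<U>)"
  unfolding closed_under_retracts_def
proof (intro allI impI, elim conjE)
  fix f g assume rt: "retract_of X f g" and g: "g \<in> inflations_with_Cone_in X \<U>"
  obtain C' y' \<delta>' where tg: "C' \<in> \<U>" "triangle X (Dom X g) (Cod X g) C' g y' \<delta>'"
    using inflation_with_Cone_triangle[OF g] by metis
  obtain i r j s where f: "f \<in> Hom X (Dom X f) (Cod X f)"
    and i: "i \<in> Hom X (Dom X f) (Dom X g)" and r: "r \<in> Hom X (Dom X g) (Dom X f)" "r \<cdot> i = Ident X (Dom X f)"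
    and j: "j \<in> Hom X (Cod X f) (Cod X g)" and s: "s \<in> Hom X (Cod X g) (Cod X f)" "s \<cdot> j = Ident X (Cod X f)"
    and sq: "g \<cdot> i = j \<cdot> f" "f \<cdot> r = s \<cdot> g"
    using retract_ofE[OF rt] by (metis HomI)
  obtain D z \<epsilon> where ti: "triangle X (Dom X f) (Dom X g) D i z \<epsilon>"
    using WIC_section_inflation[OF wic i r] by metis
  obtain E h' \<delta>'' where "triangle X (Dom X f) (Cod X g) E (g \<cdot> i) h' \<delta>''" using ET4[OF ti tg(2)] by blast
  then have "inflation X (j \<cdot> f)" unfolding sq by (rule inflationI)
  then obtain C y \<delta> where tf: "triangle X (Dom X f) (Cod X f) C f y \<delta>"
    using WIC_inflation[OF wic _ f j] by metis
  have "C \<in> \<U>"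
  proof (rule cotorsion_pair_leftI[OF cp])
    show "orth C W" if "W \<in> \<V>" for W
      by (rule cone_retract_orth[OF tf tg(2) i r j s sq])
        (use that cotorsion_pairD(2)[OF cp] cotorsion_pair_orth[OF cp tg(1) that] in blast)+
  qed (use triangleD[OF tf] in simp)
  then show "f \<in> inflations_with_Cone_in X \<U>" using tf mem_inflations_with_Cone_in by blast
qed

lemma deflations_with_CoCone_in_retracts:
  assumes cp: "cotorsion_pair X (\<U>, \<V>)" and wic: "WIC X"
  shows "closed_under_retracts X (deflations_with_CoCone_in X \<V>)"
  using extriangulated_category.inflations_with_Cone_in_retracts[OF extriangulated_category_op, of \<V> \<U>]
    assms unfolding cotorsion_pair_op by simp

text \<open>\<open>K\<close> is the kernel of \<open>v = (p, i) : M \<oplus> B \<rightarrow> C\<close>; negating the \<open>B\<close>-component of the biproduct turns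
  \<open>p m + i e = 0\<close> into a commuting square. By (WIC), \<open>v\<close> is a deflation because \<open>p\<close> is one;
  \<open>weak_pullback\<close> would need \<open>i\<close> to be a deflation too.\<close>

lemma homotopy_pullback:
  assumes wic: "WIC X" and tp: "triangle X V M C k p \<delta>p" and ti: "triangle X B C S i y \<delta>i"
  obtains K z e \<epsilon> m y' \<epsilon>' where "triangle X V K B z e \<epsilon>" "triangle X K M S m y' \<epsilon>'"
    "\<And>A j q. \<lbrakk>j \<in> Hom X A M; q \<in> Hom X A B; p \<cdot> j = i \<cdot> q\<rbrakk> \<Longrightarrow> \<exists>u \<in> Hom X A K. m \<cdot> u = j \<and> e \<cdot> u = q"
proof -
  note d = triangleD[OF tp] triangleD[OF ti]
  obtain Q i1 i2 p1 p2 where bp: "biproduct X M B Q i1 i2 p1 p2" using ex_biproduct d by blast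
  note d = d biproductD[OF bp] and be = biproduct_eqs[OF bp]
  define v where "v = p \<cdot> p1 \<^bold>+ i \<cdot> p2"
  have v: "v \<in> Hom X Q C" "v \<cdot> i1 = p" "v \<cdot> i2 = i" unfolding v_def using d be by (simp_all add: Hom_def)
  have nbp: "biproduct X M B Q i1 (neg i2) p1 (neg p2)"
    unfolding biproduct_def using d be by (simp add: Hom_def)
  have "deflation X (v \<cdot> i1)" using tp unfolding v by (rule deflationI)
  then obtain K \<kappa> \<delta>v where tv: "triangle X K Q C \<kappa> v \<delta>v"
    using WIC_deflation[OF wic _ biproduct_Hom(1)[OF bp] v(1)] by metis
  have tp': "triangle X V M C k (v \<cdot> i1) \<delta>p" using tp v by simp
  have ti': "triangle X B C S (v \<cdot> i2) y \<delta>i" using ti v by simp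
  obtain z \<epsilon> where z: "triangle X V K B z (neg p2 \<cdot> \<kappa>) \<epsilon>"
    using cocone_of_composite_with_inflation[OF tv split_triangle[OF nbp] tp'] by metis
  obtain y' \<epsilon>' where y': "triangle X K M S (p1 \<cdot> \<kappa>) y' \<epsilon>'"
    using cone_of_composite_with_deflation[OF split_triangle[OF biproduct_swap[OF bp]] tv ti'] by metis
  have "\<exists>u \<in> Hom X A K. (p1 \<cdot> \<kappa>) \<cdot> u = j \<and> (neg p2 \<cdot> \<kappa>) \<cdot> u = q"
    if j: "j \<in> Hom X A M" and q: "q \<in> Hom X A B" and sq: "p \<cdot> j = i \<cdot> q" for A j q
  proof -
    note d = d HomD[OF j] HomD[OF q] HomD[OF v(1)] triangleD[OF tv]
    define t where "t = i1 \<cdot> j \<^bold>+ neg (i2 \<cdot> q)"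
    have t: "t \<in> Hom X A Q" unfolding t_def using d by (simp add: Hom_def)
    have "v \<cdot> t = p \<cdot> j \<^bold>+ neg (i \<cdot> q)" unfolding t_def
      using d by (simp add: comp_reduce[OF v(2)] comp_reduce[OF v(3)])
    then have "v \<cdot> t = Zmor X A C" unfolding sq using d by simp
    then obtain u where u: "u \<in> Hom X A K" "t = \<kappa> \<cdot> u" using factor_inflation[OF tv t] by metis
    note d = d HomD[OF u(1)]
    have pt: "p1 \<cdot> t = j" "p2 \<cdot> t = neg q" unfolding t_def using d
      by (simp_all add: comp_reduce[OF be(1)] comp_reduce[OF be(2)] comp_reduce[OF be(3)] comp_reduce[OF be(4)])
    have "(p1 \<cdot> \<kappa>) \<cdot> u = j" using d pt(1) by (simp add: u(2))
    moreover have "(neg p2 \<cdot> \<kappa>) \<cdot> u = neg (p2 \<cdot> t)" unfolding u(2) using d by simp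
    then have "(neg p2 \<cdot> \<kappa>) \<cdot> u = q" unfolding pt using d by simp
    ultimately show ?thesis using u(1) by blast
  qed
  then show thesis using that[OF z y'] by blast
qed

end

section \<open>The model structure of a Hovey twin cotorsion pair\<close>

text \<open>The third component of \<open>model_of_twin\<close>, isolated as a function of
  \<open>\<S>\<close> and \<open>\<V>\<close> so that its self-duality under exchanging them can be
  stated.\<close>

definition weak_equivalences :: "('o, 'm, 'e, 'x) extri_data_scheme \<Rightarrow> 'o set \<Rightarrow> 'o set \<Rightarrow> 'm set" where
  "weak_equivalences X \<S> \<V> = {p \<cdot>\<^bsub>X\<^esub> i | p i. i \<in> inflations_with_Cone_in X \<S> \<and>
     p \<in> deflations_with_CoCone_in X \<V> \<and> Cod X i = Dom X p}"

lemma weak_equivalences_op [simp]: "weak_equivalences (op_data X) \<V> \<S> = weak_equivalences X \<S> \<V>"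
  unfolding weak_equivalences_def by auto metis+

locale hovey_category = extriangulated_category X
  for X :: "('o, 'm, 'e, 'x) extri_data_scheme" (structure) +
  fixes S T U V :: "'o set"
  assumes wic: "WIC X" and hovey: "Hovey_twin_cotorsion_pair X ((S, T), (U, V))"
begin

abbreviation "N \<equiv> N_i X ((S, T), (U, V))"
abbreviation "AC \<equiv> inflations_with_Cone_in X S"
abbreviation "CO \<equiv> inflations_with_Cone_in X U"
abbreviation "FI \<equiv> deflations_with_CoCone_in X T"
abbreviation "AF \<equiv> deflations_with_CoCone_in X V"
abbreviation "W \<equiv> weak_equivalences X S V"

lemma N_f_eq: "N_f X ((S, T), (U, V)) = N"
  using hovey unfolding Hovey_twin_cotorsion_pair_def by blast

lemma cpS: "cotorsion_pair X (S, T)" and cpU: "cotorsion_pair X (U, V)"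
  using hovey unfolding Hovey_twin_cotorsion_pair_def twin_cotorsion_pair.simps by blast+

lemma sub: "S \<subseteq> Obj X" "T \<subseteq> Obj X" "U \<subseteq> Obj X" "V \<subseteq> Obj X"
  using cotorsion_pairD[OF cpS] cotorsion_pairD[OF cpU] by blast+

lemma vanishes: "Ext_vanishes X S V"
  using hovey unfolding Hovey_twin_cotorsion_pair_def twin_cotorsion_pair.simps by blast

lemma orth_SV: "\<lbrakk>A \<in> S; B \<in> V\<rbrakk> \<Longrightarrow> orth A B"
  using vanishes unfolding Ext_vanishes_iff[OF sub(1,4)] by blast

lemma N_op: "N_i (op_data X) ((V, U), (T, S)) = N"
proof -
  have "N_i (op_data X) ((V, U), (T, S)) = N_f X ((S, T), (U, V))"
    unfolding N_i.simps N_f.simps ex_conflation_op op_data_simps by blast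
  then show ?thesis using N_f_eq by simp
qed

text \<open>Duality exchanges \<open>AC\<close> with \<open>AF\<close> and \<open>CO\<close> with
  \<open>FI\<close>. The Hovey condition is what makes \<open>N\<close> self-dual, since reversing
  arrows turns one description of \<open>N\<close> into the other.\<close>

lemma hovey_op: "hovey_category (op_data X) V U T S"
proof -
  have "N_f (op_data X) ((V, U), (T, S)) = N"
    unfolding N_i.simps N_f.simps ex_conflation_op op_data_simps by blast
  then have "Hovey_twin_cotorsion_pair (op_data X) ((V, U), (T, S))"
    unfolding Hovey_twin_cotorsion_pair_def twin_cotorsion_pair.simps cotorsion_pair_op N_op Ext_vanishes_op
    using cpS cpU vanishes by blast
  then show ?thesis
    by (intro hovey_category.intro extriangulated_category_op hovey_category_axioms.intro) (simp add: wic)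
qed

section \<open>The class N of trivial objects\<close>

lemma S_le_U: "S \<subseteq> U"
  using sub orth_SV cotorsion_pair_leftI[OF cpU] by blast

lemma V_le_T: "V \<subseteq> T"
  using hovey_category.S_le_U[OF hovey_op] .

lemma N_iI: "\<lbrakk>triangle X B C A x y \<delta>; B \<in> V; C \<in> S\<rbrakk> \<Longrightarrow> A \<in> N"
  using triangleD unfolding N_i.simps conflation_def by blast

lemma N_fI: "\<lbrakk>triangle X A B C x y \<delta>; B \<in> V; C \<in> S\<rbrakk> \<Longrightarrow> A \<in> N"
  using triangleD unfolding N_f_eq[symmetric] N_f.simps conflation_def by blast

lemma N_iE:
  assumes "A \<in> N" obtains B C x y \<delta> where "B \<in> V" "C \<in> S" "triangle X B C A x y \<delta>"
  using assms unfolding N_i.simps conflation_def by blast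

lemma N_fE:
  assumes "A \<in> N" obtains B C x y \<delta> where "B \<in> V" "C \<in> S" "triangle X A B C x y \<delta>"
  using assms unfolding N_f_eq[symmetric] N_f.simps conflation_def by blast

lemma S_le_N: "S \<subseteq> N"
proof
  fix A assume A: "A \<in> S"
  obtain Z where Z: "Z \<in> V" "zero_object X Z" using cpU by (auto simp: additive_subcategory_def)
  have "triangle X Z A A (Zmor X Z A) (Ident X A) (null A Z)" using triangle_ident_right Z A sub by blast
  then show "A \<in> N" using N_iI A Z by blast
qed

lemma V_le_N: "V \<subseteq> N"
  using hovey_category.S_le_N[OF hovey_op] unfolding N_op .

text \<open>Since E(U,V) = 0, the conflation that exhibits \<open>A\<close> in \<open>N\<close> has
  a split deflation, so \<open>A\<close> is a retract of an object of \<open>S\<close>.\<close>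

lemma U_Int_N: assumes "A \<in> U" "A \<in> N" shows "A \<in> S"
proof -
  obtain B C x y \<delta> where t: "B \<in> V" "C \<in> S" "triangle X B C A x y \<delta>" using N_iE assms by metis
  note d = triangleD[OF t(3)]
  have "\<delta> = null A B" using cotorsion_pair_orth[OF cpU assms(1) t(1)] d by blast
  then have "pull X B (Ident X A) \<delta> = null A B" using d by simp
  then obtain c where c: "c \<in> Hom X A C" "Ident X A = y \<cdot> c" using lift_deflation[OF t(3) Ident_Hom] d by metis
  show ?thesis
  proof (rule cotorsion_pair_leftI[OF cpS])
    show "orth A W" if "W \<in> T" for W
      using orth_section[OF c(1) triangle_Hom(2)[OF t(3)] c(2)[symmetric]] that sub cotorsion_pair_orth[OF cpS t(2) that]
      by blast
  qed (use d in simp)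
qed

lemma T_Int_N: "\<lbrakk>A \<in> T; A \<in> N\<rbrakk> \<Longrightarrow> A \<in> V"
  using hovey_category.U_Int_N[OF hovey_op] unfolding N_op .

text \<open>Composing an approximation \<open>s -> B\<close> with \<open>y\<close> gives a deflation
  from an object of \<open>S\<close> onto \<open>C\<close>; its kernel is an extension of
  \<open>A\<close> by \<open>v\<close>, hence in \<open>V\<close>.\<close>

lemma N_cone_of_V: assumes t: "triangle X A B C x y \<delta>" and "A \<in> V" "B \<in> N" shows "C \<in> N"
proof -
  obtain v s p q \<beta> where b: "v \<in> V" "s \<in> S" "triangle X v s B p q \<beta>" using N_iE assms by metis
  obtain E h' \<delta>'' d e \<epsilon> where E: "triangle X E s C h' (y \<cdot> q) \<delta>''" "triangle X v E A d e \<epsilon>"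
    using ET4_op[OF b(3) t] by blast
  have "E \<in> V" using right_extension_closed[OF cpU E(2)] b assms by blast
  then show ?thesis using N_iI[OF E(1)] b by blast
qed

text \<open>E(S,V) = 0 splits the triangle, so it can be turned around and \<open>B\<close> maps
  onto \<open>A\<close>. Pulling back an approximation \<open>v -> s -> A\<close> covers
  \<open>B\<close> by an extension of \<open>s\<close> by \<open>C\<close>, with kernel
  \<open>v\<close>.\<close>

lemma N_extension_of_S_by_V: assumes t: "triangle X A B C x y \<delta>" and A: "A \<in> V" and C: "C \<in> S" shows "B \<in> N"
proof -
  have "\<delta> = null C A" using orth_SV[OF C A] triangleD[OF t] by blast
  then obtain j p where "biproduct X A C B x j p y" using split_biproduct t by metis
  then have t': "triangle X C B A j p (null A C)" using split_triangle biproduct_swap by blast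
  obtain v s a b \<beta> where b: "v \<in> V" "s \<in> S" "triangle X v s A a b \<beta>" using N_iE A V_le_N by blast
  obtain M k1 k2 m1 m2 \<epsilon> \<epsilon>' where m: "triangle X C M s k1 m2 \<epsilon>" "triangle X v M B k2 m1 \<epsilon>'"
    using weak_pullback[OF t' b(3)] by metis
  have "M \<in> S" using left_extension_closed[OF cpS m(1)] C b by blast
  then show ?thesis using N_iI[OF m(2)] b by blast
qed

text \<open>Pushing out along \<open>A -> v\<close> reduces to an extension \<open>M\<close> of an
  object of \<open>S\<close> by one of \<open>V\<close>. Then \<open>B\<close> sits in
  \<open>M\<close> with cone \<open>s\<close> and \<open>M\<close> in \<open>v'\<close> with cone
  \<open>s'\<close>, so the cone of \<open>B -> v'\<close> is an extension within
  \<open>S\<close>.\<close>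

lemma N_extension_of_S: assumes t: "triangle X A B C x y \<delta>" and A: "A \<in> N" and C: "C \<in> S" shows "B \<in> N"
proof -
  obtain v s a b \<beta> where b: "v \<in> V" "s \<in> S" "triangle X A v s a b \<beta>" using N_fE A by blast
  obtain M k1 k2 m1 m2 \<epsilon> \<epsilon>' where m: "triangle X v M C m2 k1 \<epsilon>" "triangle X B M s m1 k2 \<epsilon>'"
    using weak_pushout[OF t b(3)] by metis
  have "M \<in> N" using N_extension_of_S_by_V[OF m(1) b(1) C] .
  then obtain v' s' a' b' \<beta>' where b': "v' \<in> V" "s' \<in> S" "triangle X M v' s' a' b' \<beta>'" using N_fE by blast
  obtain E h' \<delta>'' d e \<epsilon>'' where E: "triangle X B v' E (a' \<cdot> m1) h' \<delta>''" "triangle X s E s' d e \<epsilon>''"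
    using ET4[OF m(2) b'(3)] by blast
  have "E \<in> S" using left_extension_closed[OF cpS E(2)] b b' by blast
  then show ?thesis using N_fI[OF E(1)] b' by blast
qed

text \<open>Pushing out along \<open>A -> v\<close> replaces \<open>A\<close> by an object of
  \<open>V\<close> without changing the cone, and replaces \<open>B\<close> by an extension of an
  object of \<open>S\<close> by \<open>B\<close>.\<close>

lemma N_cone: assumes t: "triangle X A B C x y \<delta>" and A: "A \<in> N" and B: "B \<in> N" shows "C \<in> N"
proof -
  obtain v s a b \<beta> where b: "v \<in> V" "s \<in> S" "triangle X A v s a b \<beta>" using N_fE A by blast
  obtain M k1 k2 m1 m2 \<epsilon> \<epsilon>' where m: "triangle X v M C m2 k1 \<epsilon>" "triangle X B M s m1 k2 \<epsilon>'"
    using weak_pushout[OF t b(3)] by metis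
  have "M \<in> N" using N_extension_of_S[OF m(2) B b(2)] .
  then show ?thesis using N_cone_of_V[OF m(1) b(1)] by blast
qed

section \<open>The classes of morphisms and two-out-of-three\<close>

lemma AC_le_CO: "AC \<subseteq> CO"
  using S_le_U unfolding inflations_with_Cone_in_def by blast

lemma AF_le_FI: "AF \<subseteq> FI"
  using V_le_T unfolding deflations_with_CoCone_in_def by blast

lemma ident_AF: assumes "A \<in> Obj X" shows "Ident X A \<in> AF"
proof -
  obtain Z where Z: "Z \<in> V" "zero_object X Z" using cpU by (auto simp: additive_subcategory_def)
  have "triangle X Z A A (Zmor X Z A) (Ident X A) (null A Z)" using triangle_ident_right Z assms by blast
  then show ?thesis using mem_deflations_with_CoCone_in Z by blast
qed

lemma AC_arr: "f \<in> AC \<Longrightarrow> f \<in> Arr X" and CO_arr: "f \<in> CO \<Longrightarrow> f \<in> Arr X"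
  and FI_arr: "f \<in> FI \<Longrightarrow> f \<in> Arr X" and AF_arr: "f \<in> AF \<Longrightarrow> f \<in> Arr X"
  unfolding inflations_with_Cone_in_def deflations_with_CoCone_in_def by simp_all

lemma W_I: "\<lbrakk>i \<in> AC; p \<in> AF; Cod X i = Dom X p\<rbrakk> \<Longrightarrow> p \<cdot> i \<in> W"
  unfolding weak_equivalences_def by blast

lemma W_E: assumes "f \<in> W" obtains i p where "i \<in> AC" "p \<in> AF" "Cod X i = Dom X p" "f = p \<cdot> i"
  using assms unfolding weak_equivalences_def by blast

lemma AC_le_W: "AC \<subseteq> W"
proof
  fix i assume i: "i \<in> AC"
  then have o: "Cod X i \<in> Obj X" "i \<in> Arr X" using Cod_Obj AC_arr by auto
  then have "Ident X (Cod X i) \<cdot> i \<in> W" using i ident_AF by (intro W_I) auto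
  then show "i \<in> W" using o by simp
qed

lemma cofibration_in_AC:
  assumes j: "j \<in> CO" and p: "p \<in> AF" and jp: "Cod X j = Dom X p"
    and i: "i \<in> AC" and q: "q \<in> AF" and iq: "Cod X i = Dom X q" and eq: "p \<cdot> j = q \<cdot> i"
  shows "j \<in> AC"
proof -
  have dj: "Dom X j = Dom X i" "Cod X p = Cod X q"
    using arg_cong[OF eq, of "Dom X"] arg_cong[OF eq, of "Cod X"] jp iq
      CO_arr[OF j] AF_arr[OF p] AC_arr[OF i] AF_arr[OF q] by simp_all
  obtain Uj yj \<delta>j where tj: "Uj \<in> U" "triangle X (Dom X i) (Cod X j) Uj j yj \<delta>j"
    using inflation_with_Cone_triangle[OF j] dj by metis
  obtain Si yi \<delta>i where ti: "Si \<in> S" "triangle X (Dom X i) (Cod X i) Si i yi \<delta>i"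
    using inflation_with_Cone_triangle[OF i] by metis
  obtain Vp kp \<delta>p where tp: "Vp \<in> V" "triangle X Vp (Cod X j) (Cod X q) kp p \<delta>p"
    using deflation_with_CoCone_triangle[OF p] dj jp by metis
  obtain Vq kq \<delta>q where tq: "Vq \<in> V" "triangle X Vq (Cod X i) (Cod X q) kq q \<delta>q"
    using deflation_with_CoCone_triangle[OF q] iq by metis
  obtain M k1 k2 m1 m2 \<epsilon> \<epsilon>' where m: "triangle X Vp M (Cod X i) k1 m2 \<epsilon>" "triangle X Vq M (Cod X j) k2 m1 \<epsilon>'"
    and l: "\<And>A a b. \<lbrakk>a \<in> Hom X A (Cod X j); b \<in> Hom X A (Cod X i); p \<cdot> a = q \<cdot> b\<rbrakk>
       \<Longrightarrow> \<exists>l \<in> Hom X A M. m1 \<cdot> l = a \<and> m2 \<cdot> l = b"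
    using weak_pullback[OF tp(2) tq(2)] by metis
  obtain u where u: "u \<in> Hom X (Dom X i) M" "m1 \<cdot> u = j" "m2 \<cdot> u = i"
    using l[OF triangle_Hom(1)[OF tj(2)] triangle_Hom(1)[OF ti(2)] eq] by blast
  \<comment> \<open>The existence of \<open>u\<close> suffices: (WIC) makes it an inflation, and its
    cone \<open>D\<close> is then compared with the cones of \<open>j\<close> and of
    \<open>i\<close> through the two projections.\<close>
  have "inflation X (m1 \<cdot> u)" unfolding u by (rule inflationI[OF tj(2)])
  then obtain D w \<delta>u where tu: "triangle X (Dom X i) M D u w \<delta>u"
    using WIC_inflation[OF wic _ u(1) triangle_Hom(2)[OF m(2)]] by metis
  obtain z1 \<theta>1 where z1: "triangle X Vq D Uj (w \<cdot> k2) z1 \<theta>1"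
    using cone_of_composite_with_deflation[OF tu m(2), of Uj yj \<delta>j] u tj by metis
  obtain z2 \<theta>2 where z2: "triangle X Vp D Si (w \<cdot> k1) z2 \<theta>2"
    using cone_of_composite_with_deflation[OF tu m(1), of Si yi \<delta>i] u ti by metis
  have "D \<in> N" using N_extension_of_S_by_V[OF z2 tp(1) ti(1)] .
  then have "Uj \<in> N" using N_cone_of_V[OF z1 tq(1)] by blast
  then have "Uj \<in> S" using U_Int_N tj(1) by blast
  then show ?thesis using tj(2) mem_inflations_with_Cone_in by blast
qed

lemma fibration_in_AF:
  assumes "p \<in> FI" "i \<in> AC" "Cod X i = Dom X p" "q \<in> AF" "j \<in> AC" "Cod X j = Dom X q" "p \<cdot> i = q \<cdot> j"
  shows "p \<in> AF"
  using hovey_category.cofibration_in_AC[OF hovey_op, of p i q j] assms by simp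

lemma CO_Int_W: "CO \<inter> W = AC"
proof
  show "CO \<inter> W \<subseteq> AC"
  proof
    fix j assume j: "j \<in> CO \<inter> W"
    then obtain i q where "i \<in> AC" "q \<in> AF" "Cod X i = Dom X q" "j = q \<cdot> i" using W_E by blast
    then show "j \<in> AC"
      using cofibration_in_AC[of j "Ident X (Cod X j)" i q] j ident_AF Cod_Obj CO_arr by simp
  qed
qed (use AC_le_CO AC_le_W in blast)

lemma FI_Int_W: "FI \<inter> W = AF"
  using hovey_category.CO_Int_W[OF hovey_op] by simp

text \<open>Write \<open>i \<cdot> q = p \<cdot> j\<close> with \<open>j\<close> a cofibration and
  compare the domain of \<open>q\<close> with the homotopy pullback \<open>K\<close> of
  \<open>p\<close> and \<open>i\<close> by \<open>u\<close>. Over the codomain of \<open>q\<close>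
  the kernels are \<open>Vq\<close> and \<open>Vp\<close>, so the cone \<open>D\<close> of
  \<open>u\<close> is a quotient of \<open>Vp\<close> by \<open>Vq\<close> and lies in
  \<open>N\<close>. The cone of \<open>j\<close> is then an extension of \<open>Si\<close> by
  \<open>D\<close>, hence in \<open>U\<close> and \<open>N\<close>.\<close>

lemma AC_after_AF_in_W:
  assumes q: "q \<in> AF" and i: "i \<in> AC" and qi: "Cod X q = Dom X i"
  shows "i \<cdot> q \<in> W"
proof -
  have arr: "q \<in> Arr X" "i \<in> Arr X" using AC_arr AF_arr i q by auto
  obtain j p where jp: "j \<in> CO" "p \<in> AF" "Cod X j = Dom X p" "i \<cdot> q = p \<cdot> j"
    using cotorsion_pair_factorization[OF cpU wic] arr qi unfolding has_factorization_def by fastforce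
  have dj: "Dom X j = Dom X q" "Cod X p = Cod X i"
    using arg_cong[OF jp(4), of "Dom X"] arg_cong[OF jp(4), of "Cod X"] jp(3) qi arr
      CO_arr[OF jp(1)] AF_arr[OF jp(2)] by simp_all
  obtain Uj yj \<delta>j where tj: "Uj \<in> U" "triangle X (Dom X q) (Cod X j) Uj j yj \<delta>j"
    using inflation_with_Cone_triangle[OF jp(1)] dj by metis
  obtain Si yi \<delta>i where ti: "Si \<in> S" "triangle X (Cod X q) (Cod X i) Si i yi \<delta>i"
    using inflation_with_Cone_triangle[OF i] qi by metis
  obtain Vp kp \<delta>p where tp: "Vp \<in> V" "triangle X Vp (Cod X j) (Cod X i) kp p \<delta>p"
    using deflation_with_CoCone_triangle[OF jp(2)] dj jp(3) by metis
  obtain Vq kq \<delta>q where tq: "Vq \<in> V" "triangle X Vq (Dom X q) (Cod X q) kq q \<delta>q"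
    using deflation_with_CoCone_triangle[OF q] by metis
  obtain K z e \<epsilon> m y' \<epsilon>' where K: "triangle X Vp K (Cod X q) z e \<epsilon>" "triangle X K (Cod X j) Si m y' \<epsilon>'"
    and l: "\<And>A j' q'. \<lbrakk>j' \<in> Hom X A (Cod X j); q' \<in> Hom X A (Cod X q); p \<cdot> j' = i \<cdot> q'\<rbrakk>
      \<Longrightarrow> \<exists>u \<in> Hom X A K. m \<cdot> u = j' \<and> e \<cdot> u = q'"
    using homotopy_pullback[OF wic tp(2) ti(2)] by metis
  obtain u where u: "u \<in> Hom X (Dom X q) K" "m \<cdot> u = j" "e \<cdot> u = q"
    using l[OF triangle_Hom(1)[OF tj(2)] triangle_Hom(2)[OF tq(2)]] jp(4) by metis
  have "inflation X (m \<cdot> u)" unfolding u by (rule inflationI[OF tj(2)])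
  then obtain D w \<delta>u where tu: "triangle X (Dom X q) K D u w \<delta>u"
    using WIC_inflation[OF wic _ u(1) triangle_Hom(1)[OF K(2)]] by metis
  have tq': "triangle X Vq (Dom X q) (Cod X q) kq (e \<cdot> u) \<delta>q" using tq u by simp
  obtain z' \<theta> where "triangle X Vq Vp D z' (w \<cdot> z) \<theta>"
    using cocone_of_composite_with_inflation[OF K(1) tu tq'] by metis
  then have D: "D \<in> N" using N_cone_of_V tq(1) tp(1) V_le_N by blast
  obtain E h' \<delta>'' d e' \<epsilon>'' where E: "triangle X (Dom X q) (Cod X j) E (m \<cdot> u) h' \<delta>''" "triangle X D E Si d e' \<epsilon>''"
    using ET4[OF tu K(2)] by blast
  have "E \<in> N" using N_extension_of_S[OF E(2) D ti(1)] .
  moreover have "E \<in> U" using cone_in_left[OF cpU jp(1)] E(1) u by metis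
  ultimately have "E \<in> S" using U_Int_N by blast
  then have "j \<in> AC" using E(1) u mem_inflations_with_Cone_in by metis
  then show ?thesis using jp W_I by simp
qed

text \<open>In \<open>q' i' q i\<close> the inner \<open>i' q\<close> is in the wrong order;
  rewriting it as \<open>p j\<close> leaves a composite of two maps in \<open>AF\<close> after two
  in \<open>AC\<close>.\<close>

lemma W_comp: assumes f: "f \<in> W" and g: "g \<in> W" and fg: "Cod X f = Dom X g" shows "g \<cdot> f \<in> W"
proof -
  obtain i q where f': "i \<in> AC" "q \<in> AF" "Cod X i = Dom X q" "f = q \<cdot> i" using W_E f by metis
  obtain i' q' where g': "i' \<in> AC" "q' \<in> AF" "Cod X i' = Dom X q'" "g = q' \<cdot> i'" using W_E g by metis
  note a = AC_arr[OF f'(1)] AF_arr[OF f'(2)] AC_arr[OF g'(1)] AF_arr[OF g'(2)]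
  have qi: "Cod X q = Dom X i'" using fg f' g' a by simp
  obtain j p where jp: "j \<in> AC" "p \<in> AF" "Cod X j = Dom X p" "i' \<cdot> q = p \<cdot> j"
    using W_E[OF AC_after_AF_in_W[OF f'(2) g'(1) qi]] by metis
  note a = a AC_arr[OF jp(1)] AF_arr[OF jp(2)]
  have dj: "Dom X j = Dom X q" "Cod X p = Cod X i'"
    using arg_cong[OF jp(4), of "Dom X"] arg_cong[OF jp(4), of "Cod X"] jp(3) qi a by simp_all
  have "(q' \<cdot> p) \<cdot> (j \<cdot> i) \<in> W"
    using inflations_with_Cone_in_comp[OF cpS f'(1) jp(1)] deflations_with_CoCone_in_comp[OF cpU jp(2) g'(2)]
      a dj f'(3) g'(3) jp(3) by (intro W_I) simp_all
  moreover have "(q' \<cdot> p) \<cdot> (j \<cdot> i) = q' \<cdot> ((p \<cdot> j) \<cdot> i)" using a dj f'(3) g'(3) jp(3) by simp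
  moreover have "\<dots> = g \<cdot> f" unfolding jp(4)[symmetric] f' g' using a qi f'(3) g'(3) by simp
  ultimately show ?thesis by simp
qed

text \<open>Factor \<open>h = p \<cdot> j\<close>. The hypothesis forces the cofibration
  \<open>j \<cdot> i\<close> into \<open>AC\<close>, and (ET4) exhibits the cone of \<open>j\<close>
  as the cone of an inflation between objects of \<open>S\<close>, so it lies in \<open>U\<close>
  and \<open>N\<close>.\<close>

lemma W_cancel_AC:
  assumes i: "i \<in> AC" and h: "h \<in> Arr X" "Cod X i = Dom X h" and hi: "h \<cdot> i \<in> W" shows "h \<in> W"
proof -
  obtain j p where jp: "j \<in> CO" "p \<in> AF" "Cod X j = Dom X p" "h = p \<cdot> j"
    using cotorsion_pair_factorization[OF cpU wic] h unfolding has_factorization_def by blast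
  obtain i' q' where g': "i' \<in> AC" "q' \<in> AF" "Cod X i' = Dom X q'" "h \<cdot> i = q' \<cdot> i'" using W_E hi by metis
  note a = AC_arr[OF i] CO_arr[OF jp(1)] AF_arr[OF jp(2)]
  have ij: "Cod X i = Dom X j" using h jp a by simp
  have ji: "j \<cdot> i \<in> CO" using inflations_with_Cone_in_comp[OF cpU _ jp(1) ij] AC_le_CO i by blast
  have "p \<cdot> (j \<cdot> i) = q' \<cdot> i'" using a jp ij g'(4) by simp
  then have AC: "j \<cdot> i \<in> AC" using cofibration_in_AC[OF ji jp(2) _ g'(1,2,3)] a ij jp(3) by simp
  obtain Si yi \<delta>i where ti: "Si \<in> S" "triangle X (Dom X i) (Cod X i) Si i yi \<delta>i"
    using inflation_with_Cone_triangle[OF i] by metis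
  obtain Uj yj \<delta>j where tj: "Uj \<in> U" "triangle X (Cod X i) (Cod X j) Uj j yj \<delta>j"
    using inflation_with_Cone_triangle[OF jp(1)] ij by metis
  obtain E h' \<delta>'' d e \<epsilon> where E: "triangle X (Dom X i) (Cod X j) E (j \<cdot> i) h' \<delta>''" "triangle X Si E Uj d e \<epsilon>"
    using ET4[OF ti(2) tj(2)] by blast
  have "E \<in> S" using cone_in_left[OF cpS AC E(1)] .
  then have "Uj \<in> S" using N_cone[OF E(2)] ti(1) tj(1) S_le_N U_Int_N by blast
  then have "j \<in> AC" using tj(2) mem_inflations_with_Cone_in by blast
  then show ?thesis using jp W_I by simp
qed

text \<open>This is not the dual of \<open>W_cancel_AC\<close>, since \<open>AF\<close> is now
  cancelled on the source side. Factor \<open>g = p \<cdot> j\<close> with \<open>j\<close> in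
  \<open>AC\<close> and move \<open>j\<close> past \<open>q\<close> as \<open>p' \<cdot> j'\<close>;
  then \<open>p \<cdot> p'\<close> is a fibration and the hypothesis forces it into
  \<open>AF\<close>. The dual of (ET4) presents the kernel of \<open>p\<close> as a quotient of
  objects of \<open>V\<close>, so it lies in \<open>T\<close> and \<open>N\<close>.\<close>

lemma W_cancel_AF:
  assumes q: "q \<in> AF" and g: "g \<in> Arr X" "Cod X q = Dom X g" and gq: "g \<cdot> q \<in> W" shows "g \<in> W"
proof -
  obtain j p where jp: "j \<in> AC" "p \<in> FI" "Cod X j = Dom X p" "g = p \<cdot> j"
    using cotorsion_pair_factorization[OF cpS wic] g unfolding has_factorization_def by blast
  note a = AF_arr[OF q] AC_arr[OF jp(1)] FI_arr[OF jp(2)]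
  have qj: "Cod X q = Dom X j" using g jp a by simp
  obtain j' p' where jp': "j' \<in> AC" "p' \<in> AF" "Cod X j' = Dom X p'" "j \<cdot> q = p' \<cdot> j'"
    using W_E[OF AC_after_AF_in_W[OF q jp(1) qj]] by metis
  obtain i'' q'' where g': "i'' \<in> AC" "q'' \<in> AF" "Cod X i'' = Dom X q''" "g \<cdot> q = q'' \<cdot> i''" using W_E gq by metis
  note a = a AC_arr[OF jp'(1)] AF_arr[OF jp'(2)]
  have dp: "Cod X p' = Dom X p" using arg_cong[OF jp'(4), of "Cod X"] jp(3) jp'(3) qj a by simp
  have pp: "p \<cdot> p' \<in> FI" using deflations_with_CoCone_in_comp[OF cpS _ jp(2) dp] AF_le_FI jp'(2) by blast
  have "(p \<cdot> p') \<cdot> j' = p \<cdot> (p' \<cdot> j')" using a dp jp'(3) by simp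
  also have "\<dots> = q'' \<cdot> i''" unfolding jp'(4)[symmetric] g'(4)[symmetric] jp(4) using a jp(3) qj by simp
  finally have AF: "p \<cdot> p' \<in> AF" using fibration_in_AF[OF pp jp'(1) _ g'(2,1,3)] a dp jp'(3) by simp
  obtain Vp kp \<delta>p where tp': "Vp \<in> V" "triangle X Vp (Dom X p') (Dom X p) kp p' \<delta>p"
    using deflation_with_CoCone_triangle[OF jp'(2)] dp by metis
  obtain Tp kp' \<delta>p' where tp: "Tp \<in> T" "triangle X Tp (Dom X p) (Cod X p) kp' p \<delta>p'"
    using deflation_with_CoCone_triangle[OF jp(2)] by metis
  obtain E h' \<delta>'' d e \<epsilon> where E: "triangle X E (Dom X p') (Cod X p) h' (p \<cdot> p') \<delta>''" "triangle X Vp E Tp d e \<epsilon>"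
    using ET4_op[OF tp'(2) tp(2)] by blast
  have "E \<in> V" using cocone_in_right[OF cpU AF E(1)] .
  then have "Tp \<in> V" using N_cone[OF E(2)] tp'(1) tp(1) V_le_N T_Int_N by blast
  then have "p \<in> AF" using tp(2) mem_deflations_with_CoCone_in by blast
  then show ?thesis using jp W_I by simp
qed

lemma W_cancel_right:
  assumes f: "f \<in> W" and g: "g \<in> Arr X" "Cod X f = Dom X g" and gf: "g \<cdot> f \<in> W" shows "g \<in> W"
proof -
  obtain i q where f': "i \<in> AC" "q \<in> AF" "Cod X i = Dom X q" "f = q \<cdot> i" using W_E f by metis
  note a = AC_arr[OF f'(1)] AF_arr[OF f'(2)]
  have "(g \<cdot> q) \<cdot> i \<in> W" using gf a g f' by simp
  then have "g \<cdot> q \<in> W" using W_cancel_AC[OF f'(1)] a f' g by simp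
  then show ?thesis using W_cancel_AF[OF f'(2) g(1)] a f' g by simp
qed

lemma W_cancel_left:
  assumes "g \<in> W" "f \<in> Arr X" "Cod X f = Dom X g" "g \<cdot> f \<in> W" shows "f \<in> W"
  using hovey_category.W_cancel_right[OF hovey_op, of g f] assms by simp

lemma two_out_of_three_W: "two_out_of_three X W"
  unfolding two_out_of_three_def
proof (intro allI impI, elim conjE)
  fix A B C f g assume f: "f \<in> Hom X A B" and g: "g \<in> Hom X B C"
  note d = HomD[OF f] HomD[OF g]
  show "(f \<in> W \<and> g \<in> W \<longrightarrow> g \<cdot> f \<in> W) \<and> (f \<in> W \<and> g \<cdot> f \<in> W \<longrightarrow> g \<in> W) \<and> (g \<in> W \<and> g \<cdot> f \<in> W \<longrightarrow> f \<in> W)"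
    using W_comp[of f g] W_cancel_right[of f g] W_cancel_left[of g f] d by simp
qed

end

lemma objects_to_zero_op [simp]: "objects_to_zero (op_data X) K = objects_from_zero X K"
  and objects_from_zero_op [simp]: "objects_from_zero (op_data X) K = objects_to_zero X K"
  unfolding objects_to_zero_def objects_from_zero_def by simp_all

lemma has_factorization_op [simp]: "has_factorization (op_data X) R L \<longleftrightarrow> has_factorization X L R"
  unfolding has_factorization_def op_data_simps by metis

section \<open>Retracts of weak equivalences and the model axioms\<close>

context hovey_category
begin

text \<open>E(U,V) = 0 lifts \<open>a\<close> along an approximation \<open>s -> B\<close> with
  \<open>s\<close> in \<open>S\<close>, and E(S,T) = 0 kills the class on \<open>s\<close>.\<close>

lemma pull_null_through_V:
  assumes C: "C \<in> U" and a: "a \<in> Hom X C B" "B \<in> V" and A: "A \<in> T"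
    and \<epsilon>: "\<epsilon> \<in> carrier (Ext X B A)"
  shows "pull X A a \<epsilon> = null C A"
proof -
  obtain v s x y \<delta> where t: "v \<in> V" "s \<in> S" "triangle X v s B x y \<delta>" using N_iE a(2) V_le_N by blast
  note d = triangleD[OF t(3)] HomD[OF a(1)]
  have "pull X v a \<delta> \<in> carrier (Ext X C v)" using d by simp
  then have "pull X v a \<delta> = null C v" using cotorsion_pair_orth[OF cpU C t(1)] by blast
  then obtain a' where a': "a' \<in> Hom X C s" "a = y \<cdot> a'" using lift_deflation[OF t(3) a(1)] by metis
  note d = d HomD[OF a'(1)]
  have o: "A \<in> Obj X" using A sub by blast
  then have "pull X A y \<epsilon> \<in> carrier (Ext X s A)" using d \<epsilon> by simp
  then have "pull X A y \<epsilon> = null s A" using cotorsion_pair_orth[OF cpS t(2) A] by blast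
  moreover have "pull X A a \<epsilon> = pull X A a' (pull X A y \<epsilon>)" unfolding a'(2) using d o \<epsilon> by simp
  ultimately show ?thesis using d o by simp
qed

text \<open>The retraction only lifts to an endomorphism of the cone \<open>C\<close> of the cofibration part of \<open>f\<close>,
  which factors through \<open>S\<close>; its defect \<open>n\<close> need not vanish, but \<open>n\<^sup>2\<close> factors through \<open>V\<close>.\<close>

lemma W_retracts: "closed_under_retracts X W"
  unfolding closed_under_retracts_def
proof (intro allI impI, elim conjE)
  fix f g assume rt: "retract_of X f g" and g: "g \<in> W"
  obtain i r j0 s0 where f: "f \<in> Arr X"
    and i: "i \<in> Hom X (Dom X f) (Dom X g)" and r: "r \<in> Hom X (Dom X g) (Dom X f)" "r \<cdot> i = Ident X (Dom X f)"
    and j0: "j0 \<in> Hom X (Cod X f) (Cod X g)" and s0: "s0 \<in> Hom X (Cod X g) (Cod X f)" "s0 \<cdot> j0 = Ident X (Cod X f)"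
    and sq: "g \<cdot> i = j0 \<cdot> f" "f \<cdot> r = s0 \<cdot> g"
    using retract_ofE[OF rt] by metis
  obtain k q where g': "k \<in> AC" "q \<in> AF" "Cod X k = Dom X q" "g = q \<cdot> k" using W_E g by metis
  obtain j p where f': "j \<in> CO" "p \<in> AF" "Cod X j = Dom X p" "f = p \<cdot> j"
    using cotorsion_pair_factorization[OF cpU wic] f unfolding has_factorization_def by blast
  note a = AC_arr[OF g'(1)] AF_arr[OF g'(2)] CO_arr[OF f'(1)] AF_arr[OF f'(2)]
  have dc: "Dom X g = Dom X k" "Cod X g = Cod X q" "Dom X f = Dom X j" "Cod X f = Cod X p"
    using a g' f' by simp_all
  obtain C yj \<delta>j where tj: "C \<in> U" "triangle X (Dom X j) (Cod X j) C j yj \<delta>j"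
    using inflation_with_Cone_triangle[OF f'(1)] by metis
  obtain D yk \<delta>k where tk: "D \<in> S" "triangle X (Dom X k) (Cod X k) D k yk \<delta>k"
    using inflation_with_Cone_triangle[OF g'(1)] by metis
  obtain Vp kp \<delta>p where tp: "Vp \<in> V" "triangle X Vp (Cod X j) (Cod X p) kp p \<delta>p"
    using deflation_with_CoCone_triangle[OF f'(2)] f'(3) by metis
  obtain Vq kq \<delta>q where tq: "Vq \<in> V" "triangle X Vq (Cod X k) (Cod X q) kq q \<delta>q"
    using deflation_with_CoCone_triangle[OF g'(2)] g'(3) by metis
  note d = a triangleD[OF tj(2)] triangleD[OF tk(2)] triangleD[OF tp(2)] triangleD[OF tq(2)]
    HomD[OF i, unfolded dc] HomD[OF r(1), unfolded dc] HomD[OF j0, unfolded dc] HomD[OF s0(1), unfolded dc]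
  have sq1: "q \<cdot> (k \<cdot> i) = j0 \<cdot> p \<cdot> j" "p \<cdot> (j \<cdot> r) = s0 \<cdot> q \<cdot> k"
  proof -
    have "(q \<cdot> k) \<cdot> i = j0 \<cdot> (p \<cdot> j)" "(p \<cdot> j) \<cdot> r = s0 \<cdot> (q \<cdot> k)"
      using sq unfolding f'(4) g'(4) by simp_all
    then show "q \<cdot> (k \<cdot> i) = j0 \<cdot> p \<cdot> j" "p \<cdot> (j \<cdot> r) = s0 \<cdot> q \<cdot> k" using d by simp_all
  qed
  have h1: "k \<cdot> i \<in> Hom X (Dom X j) (Cod X k)" "j0 \<cdot> p \<in> Hom X (Cod X j) (Cod X q)"
    and h2: "j \<cdot> r \<in> Hom X (Dom X k) (Cod X j)" "s0 \<cdot> q \<in> Hom X (Cod X k) (Cod X p)"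
    using d by (simp_all add: Hom_def)
  \<comment> \<open>The retract diagram has no maps between the middle objects of the
    factorizations; they are obtained by lifting \<open>j\<close> against \<open>q\<close> and
    \<open>k\<close> against \<open>p\<close>.\<close>
  obtain \<phi>1 where \<phi>1: "\<phi>1 \<in> Hom X (Cod X j) (Cod X k)" "\<phi>1 \<cdot> j = k \<cdot> i" "q \<cdot> \<phi>1 = j0 \<cdot> p"
    using lifting_if_orth[OF tj(2) tq(2) cotorsion_pair_orth[OF cpU tj(1) tq(1)] h1 sq1(1)] by metis
  obtain \<phi>2 where \<phi>2: "\<phi>2 \<in> Hom X (Cod X k) (Cod X j)" "\<phi>2 \<cdot> k = j \<cdot> r" "p \<cdot> \<phi>2 = s0 \<cdot> q"
    using lifting_if_orth[OF tk(2) tp(2) orth_SV[OF tk(1) tp(1)] h2 sq1(2)] by metis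
  obtain c1 where c1: "c1 \<in> Hom X C D" "ext_morphism X i c1 \<delta>j \<delta>k" "yk \<cdot> \<phi>1 = c1 \<cdot> yj"
    using ET3[OF tj(2) tk(2) i[unfolded dc] \<phi>1(1,2)] by metis
  obtain c2 where c2: "c2 \<in> Hom X D C" "ext_morphism X r c2 \<delta>k \<delta>j" "yj \<cdot> \<phi>2 = c2 \<cdot> yk"
    using ET3[OF tk(2) tj(2) r(1)[unfolded dc] \<phi>2(1,2)] by metis
  note d = d HomD[OF \<phi>1(1)] HomD[OF \<phi>2(1)] HomD[OF c1(1)] HomD[OF c2(1)]
  define \<phi> where "\<phi> = \<phi>2 \<cdot> \<phi>1"
  define \<omega> where "\<omega> = c2 \<cdot> c1"
  have ty: "\<phi> \<in> Hom X (Cod X j) (Cod X j)" "\<omega> \<in> Hom X C C" unfolding \<phi>_def \<omega>_def using d by (simp_all add: Hom_def)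
  have "\<omega> \<cdot> yj = c2 \<cdot> (yk \<cdot> \<phi>1)" unfolding \<omega>_def using d by (simp add: c1(3))
  also have "\<dots> = yj \<cdot> \<phi>" unfolding \<phi>_def using d comp_square[OF c2(3), of \<phi>1] by simp
  finally have \<omega>y: "\<omega> \<cdot> yj = yj \<cdot> \<phi>" .
  have m: "push X C i \<delta>j = pull X (Dom X k) c1 \<delta>k" "push X D r \<delta>k = pull X (Dom X j) c2 \<delta>j"
    using c1(2) c2(2) d unfolding ext_morphism_def by auto
  have "pull X (Dom X j) \<omega> \<delta>j = pull X (Dom X j) c1 (pull X (Dom X j) c2 \<delta>j)" unfolding \<omega>_def using d by simp
  also have "\<dots> = push X C r (pull X (Dom X k) c1 \<delta>k)" unfolding m(2)[symmetric] using d by simp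
  also have "\<dots> = \<delta>j" unfolding m(1)[symmetric] using d r(2) dc by simp
  finally have \<omega>\<delta>: "pull X (Dom X j) \<omega> \<delta>j = \<delta>j" .
  have "p \<cdot> \<phi> = s0 \<cdot> (q \<cdot> \<phi>1)" unfolding \<phi>_def using d comp_square[OF \<phi>2(3), of \<phi>1] by simp
  also have "\<dots> = p" using d s0(2) dc comp_reduce[OF s0(2), of p] by (simp add: \<phi>1(3))
  finally have p\<phi>: "p \<cdot> \<phi> = p" .
  obtain n where n: "n \<in> Hom X C C" "Ident X C = \<omega> \<^bold>+ n" using difference[OF Ident_Hom ty(2)] d by blast
  obtain e where e: "e \<in> Hom X (Cod X j) (Cod X j)" "Ident X (Cod X j) = \<phi> \<^bold>+ e"
    using difference[OF Ident_Hom ty(1)] d by blast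
  note d = d HomD[OF n(1)] HomD[OF e(1)] HomD[OF ty(1)] HomD[OF ty(2)]
  have "yj \<cdot> \<phi> \<^bold>+ n \<cdot> yj = (\<omega> \<^bold>+ n) \<cdot> yj" using d by (simp add: \<omega>y)
  also have "\<dots> = yj \<cdot> (\<phi> \<^bold>+ e)" unfolding n(2)[symmetric] e(2)[symmetric] using d by simp
  also have "\<dots> = yj \<cdot> \<phi> \<^bold>+ yj \<cdot> e" using d by simp
  finally have ny: "n \<cdot> yj = yj \<cdot> e" by (rule add_cancel) (use d in auto)
  \<comment> \<open>Since \<open>s0 \<cdot> j0\<close> is the identity, \<open>p\<close> kills the
    defect \<open>e\<close> of \<open>\<phi>\<close>, which therefore passes through the kernel
    \<open>Vp\<close> of \<open>p\<close>.\<close>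
  have "p \<^bold>+ p \<cdot> e = p \<cdot> (\<phi> \<^bold>+ e)" using d by (simp add: p\<phi>)
  also have "\<dots> = p" unfolding e(2)[symmetric] using d by simp
  finally have "p \<cdot> e = Zmor X (Cod X j) (Cod X p)" by (rule add_eq_self) (use d in auto)
  then obtain l where l: "l \<in> Hom X (Cod X j) Vp" "e = kp \<cdot> l" using factor_inflation[OF tp(2) e(1)] by metis
  have "pull X (Dom X j) (\<omega> \<^bold>+ n) \<delta>j = \<delta>j \<otimes>\<^bsub>Ext X C (Dom X j)\<^esub> pull X (Dom X j) n \<delta>j"
    using d \<omega>\<delta> by simp
  moreover have "pull X (Dom X j) (\<omega> \<^bold>+ n) \<delta>j = \<delta>j" unfolding n(2)[symmetric] using d by simp
  ultimately have "\<delta>j \<otimes>\<^bsub>Ext X C (Dom X j)\<^esub> pull X (Dom X j) n \<delta>j =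
      \<delta>j \<otimes>\<^bsub>Ext X C (Dom X j)\<^esub> null C (Dom X j)" using d by simp
  from ext_cancel_left[OF _ _ _ _ _ this] have "pull X (Dom X j) n \<delta>j = null C (Dom X j)" using d by simp
  then obtain \<kappa> where \<kappa>: "\<kappa> \<in> Hom X C (Cod X j)" "n = yj \<cdot> \<kappa>" using lift_deflation[OF tj(2) n(1)] by metis
  note d = d HomD[OF l(1)] HomD[OF \<kappa>(1)]
  \<comment> \<open>One factor \<open>n\<close> is lifted through \<open>yj\<close>; the other moves
    across \<open>yj\<close>, where it becomes \<open>e\<close>. Hence the square passes through
    \<open>Vp\<close>.\<close>
  have "n \<cdot> n = n \<cdot> (yj \<cdot> \<kappa>)" unfolding \<kappa>(2)[symmetric] ..
  also have "\<dots> = yj \<cdot> (e \<cdot> \<kappa>)" using d comp_square[OF ny, of \<kappa>] by simp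
  finally have nn: "n \<cdot> n = yj \<cdot> (kp \<cdot> (l \<cdot> \<kappa>))" unfolding l(2) using d by simp
  have "C \<in> S"
  proof (rule cotorsion_pair_leftI[OF cpS])
    fix B assume B: "B \<in> T"
    then have o: "B \<in> Obj X" using sub by blast
    show "orth C B"
    proof
      fix \<epsilon> assume \<epsilon>: "\<epsilon> \<in> carrier (Ext X C B)"
      have "pull X B c2 \<epsilon> \<in> carrier (Ext X D B)" using d o \<epsilon> by simp
      then have "pull X B c2 \<epsilon> = null D B" using cotorsion_pair_orth[OF cpS tk(1) B] by blast
      then have "pull X B c1 (pull X B c2 \<epsilon>) = null C B" using d o by simp
      then have "pull X B \<omega> \<epsilon> = null C B" unfolding \<omega>_def using d o \<epsilon> by simp
      then have "pull X B (\<omega> \<^bold>+ n) \<epsilon> = pull X B n \<epsilon>" using d o \<epsilon> by simp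
      \<comment> \<open>\<open>\<omega>\<close> factors through \<open>D\<close> in
        \<open>S\<close>, so only \<open>n\<close> acts on \<open>\<epsilon>\<close>; letting it act
        twice brings in \<open>n \<cdot> n\<close> and with it \<open>Vp\<close>.\<close>
      then have 1: "\<epsilon> = pull X B n \<epsilon>" unfolding n(2)[symmetric] using d o \<epsilon> by simp
      have lk: "l \<cdot> \<kappa> \<in> Hom X C Vp" using d by (simp add: Hom_def)
      have "pull X B n (pull X B n \<epsilon>) = pull X B (n \<cdot> n) \<epsilon>" using d o \<epsilon> by simp
      also have "\<dots> = pull X B (l \<cdot> \<kappa>) (pull X B (yj \<cdot> kp) \<epsilon>)" unfolding nn using d o \<epsilon> by simp
      also have "\<dots> = null C B" by (rule pull_null_through_V[OF tj(1) lk tp(1) B]) (use d o \<epsilon> in simp)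
      finally show "\<epsilon> = null C B" using 1 by simp
    qed
  qed (use d in simp)
  then have "j \<in> AC" using tj(2) mem_inflations_with_Cone_in by blast
  then show "f \<in> W" using f' W_I by simp
qed

lemma model_structure_W: "model_structure X (FI, CO, W)"
proof -
  have "has_lifting X AC FI" "has_lifting X CO AF"
    by (intro has_lifting_if_Ext_vanishes cotorsion_pair_orth[OF cpS] cotorsion_pair_orth[OF cpU]; assumption)+
  moreover have "FI \<subseteq> Arr X" "CO \<subseteq> Arr X" using FI_arr CO_arr by blast+
  moreover have "W \<subseteq> Arr X"
  proof
    fix f assume "f \<in> W"
    then obtain i p where "i \<in> AC" "p \<in> AF" "Cod X i = Dom X p" "f = p \<cdot> i" using W_E by metis
    then show "f \<in> Arr X" using AC_arr AF_arr by simp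
  qed
  ultimately show ?thesis
    unfolding model_structure.simps CO_Int_W FI_Int_W
    using two_out_of_three_W W_retracts deflations_with_CoCone_in_retracts[OF cpS wic]
      inflations_with_Cone_in_retracts[OF cpU wic] cotorsion_pair_factorization[OF cpS wic]
      cotorsion_pair_factorization[OF cpU wic] by blast
qed

end

section \<open>The correspondence\<close>

context extriangulated_category
begin

lemma zero_arrow_inflation:
  assumes "zero_object X Z" "C \<in> Obj X" "C \<in> \<U>"
  shows "Zmor X Z C \<in> inflations_with_Cone_in X \<U>"
  using triangle_ident_right[OF assms(2,1)] assms(3) mem_inflations_with_Cone_in by blast

lemma zero_arrow_deflation:
  assumes "zero_object X Z" "C \<in> Obj X" "C \<in> \<V>"
  shows "Zmor X C Z \<in> deflations_with_CoCone_in X \<V>"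
  using triangle_ident_left[OF assms(2,1)] assms(3) mem_deflations_with_CoCone_in by blast

text \<open>The cone \<open>D\<close> of \<open>0 -> C\<close> need not be \<open>C\<close> itself,
  but \<open>C\<close> is an extension of \<open>D\<close> by a zero object, which gives the
  orthogonality.\<close>

lemma objects_from_zero_inflations:
  assumes cp: "cotorsion_pair X (\<U>, \<V>)"
  shows "objects_from_zero X (inflations_with_Cone_in X \<U>) = \<U>"
proof (intro equalityI subsetI)
  fix C assume "C \<in> objects_from_zero X (inflations_with_Cone_in X \<U>)"
  then obtain Z f where Z: "zero_object X Z" "f \<in> Hom X Z C" "f \<in> inflations_with_Cone_in X \<U>"
    unfolding objects_from_zero_def by blast
  obtain D y \<delta> where t: "D \<in> \<U>" "triangle X Z C D f y \<delta>"
    using inflation_with_Cone_triangle[OF Z(3)] HomD[OF Z(2)] by metis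
  show "C \<in> \<U>"
  proof (rule cotorsion_pair_leftI[OF cp])
    fix B assume B: "B \<in> \<V>"
    then have "B \<in> Obj X" using cotorsion_pairD(2)[OF cp] by blast
    then show "orth C B"
      using orth_mid_left[OF t(2) _ orth_zero_left[OF Z(1)] cotorsion_pair_orth[OF cp t(1) B]] by blast
  qed (use HomD[OF Z(2)] in simp)
next
  fix C assume C: "C \<in> \<U>"
  then have o: "C \<in> Obj X" using cotorsion_pairD(1)[OF cp] by blast
  obtain Z where Z: "zero_object X Z" using ex_zero_object by blast
  have "Zmor X Z C \<in> Hom X Z C" using o zero_object_Obj[OF Z] by (simp add: Hom_def)
  then show "C \<in> objects_from_zero X (inflations_with_Cone_in X \<U>)"
    unfolding objects_from_zero_def using o Z zero_arrow_inflation[OF Z o C] by blast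
qed

lemma objects_to_zero_deflations:
  assumes cp: "cotorsion_pair X (\<U>, \<V>)"
  shows "objects_to_zero X (deflations_with_CoCone_in X \<V>) = \<V>"
  using extriangulated_category.objects_from_zero_inflations[OF extriangulated_category_op, of \<V> \<U>]
    assms unfolding cotorsion_pair_op by simp

text \<open>Retract argument: factor \<open>0 \<rightarrow> C\<close> and split the deflation obtained.\<close>

lemma from_zero_if_left_orthogonal:
  assumes fac: "has_factorization X L R" and ret: "closed_under_retracts X L"
    and R: "R = deflations_with_CoCone_in X \<V>" and LA: "L \<subseteq> Arr X"
    and C: "C \<in> Obj X" "\<And>A. A \<in> \<V> \<Longrightarrow> orth C A"
  shows "C \<in> objects_from_zero X L"
proof -
  obtain Z where Z: "zero_object X Z" using ex_zero_object by blast
  have oz: "Z \<in> Obj X" by (rule zero_object_Obj[OF Z])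
  have "Zmor X Z C \<in> Arr X" using oz C by simp
  then obtain i p where ip: "i \<in> L" "p \<in> R" "Cod X i = Dom X p" "Zmor X Z C = p \<cdot> i"
    using fac unfolding has_factorization_def by blast
  obtain K x \<delta> where t0: "K \<in> \<V>" "triangle X K (Dom X p) (Cod X p) x p \<delta>"
    using deflation_with_CoCone_triangle ip(2) R by metis
  have iA: "i \<in> Arr X" using ip(1) LA by blast
  note d = triangleD[OF t0(2)]
  have dm: "Dom X i = Z" "Cod X p = C"
    using arg_cong[OF ip(4), of "Dom X"] arg_cong[OF ip(4), of "Cod X"] iA ip(3) d oz C by simp_all
  have t: "triangle X K (Dom X p) C x p \<delta>" using t0(2) dm by simp
  note d = triangleD[OF t]
  have "\<delta> = null C K" using C(2)[OF t0(1)] d by blast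
  then have "pull X K (Ident X C) \<delta> = null C K" using d by simp
  then obtain h where h: "h \<in> Hom X C (Dom X p)" "Ident X C = p \<cdot> h"
    using lift_deflation[OF t Ident_Hom] C by metis
  note d = d HomD[OF h(1)]
  have iz: "i = Zmor X Z (Dom X p)" by (rule zero_object_from[OF Z]) (use iA dm ip(3) in \<open>simp add: Hom_def\<close>)
  have "retract_of X (Zmor X Z C) i"
    by (rule retract_ofI[of _ _ _ "Ident X Z" "Ident X Z" h p])
      (use d oz C iA dm ip(3) in \<open>simp_all add: Hom_def iz h(2)[symmetric]\<close>)
  then have "Zmor X Z C \<in> L" using ret ip(1) unfolding closed_under_retracts_def by blast
  moreover have "Zmor X Z C \<in> Hom X Z C" using oz C by (simp add: Hom_def)
  ultimately show ?thesis unfolding objects_from_zero_def using Z C by blast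
qed

lemma to_zero_if_right_orthogonal:
  assumes "has_factorization X L R" "closed_under_retracts X R" "L = inflations_with_Cone_in X \<U>" "R \<subseteq> Arr X"
    "C \<in> Obj X" "\<And>A. A \<in> \<U> \<Longrightarrow> orth A C"
  shows "C \<in> objects_to_zero X R"
  using extriangulated_category.from_zero_if_left_orthogonal[OF extriangulated_category_op, of R L \<U> C] assms
  by simp

text \<open>Lifting \<open>0 -> C\<close> against the deflation that realizes
  \<open>\<epsilon>\<close> produces a section of it, and a class whose deflation splits is
  null.\<close>

lemma from_zero_orth_to_zero:
  assumes lift: "has_lifting X L R" and R: "R = deflations_with_CoCone_in X \<V>"
    and A: "A \<in> \<V>" "A \<in> Obj X" and C: "C \<in> objects_from_zero X L"
  shows "orth C A"
proof
  fix \<epsilon> assume e: "\<epsilon> \<in> carrier (Ext X C A)"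
  obtain Z f where Z: "zero_object X Z" "f \<in> Hom X Z C" "f \<in> L"
    using C unfolding objects_from_zero_def by blast
  have f0: "f = Zmor X Z C" by (rule zero_object_from[OF Z(1,2)])
  obtain B x y where t: "triangle X A B C x y \<epsilon>" using triangle_ex[OF _ A(2) e] HomD[OF Z(2)] by metis
  note d = HomD[OF Z(2)] triangleD[OF t]
  have "y \<in> R" unfolding R using t A mem_deflations_with_CoCone_in by blast
  moreover have "Zmor X Z B \<in> Hom X (Dom X f) (Dom X y)" "Ident X C \<in> Hom X (Cod X f) (Cod X y)"
    "y \<cdot> Zmor X Z B = Ident X C \<cdot> f" using d f0 by (simp_all add: Hom_def)
  ultimately obtain h where h: "h \<in> Hom X (Cod X f) (Dom X y)" "y \<cdot> h = Ident X C"
    using lift Z(3) unfolding has_lifting_def by blast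
  note d = d HomD[OF h(1)]
  have "\<epsilon> = pull X A (y \<cdot> h) \<epsilon>" using d by (simp add: h(2))
  also have "\<dots> = pull X A h (pull X A y \<epsilon>)" using d by simp
  also have "\<dots> = null C A" using d by (simp add: pull_null[OF t])
  finally show "\<epsilon> = null C A" .
qed

text \<open>The approximation onto \<open>C\<close> comes from factoring \<open>0 -> C\<close>, the
  one out of \<open>C\<close> from factoring \<open>C -> 0\<close>. Once both classes are known to
  be orthogonals of each other, the closure conditions are automatic.\<close>

lemma cotorsion_pair_of_factorization_system:
  assumes fac: "has_factorization X L R" and lift: "has_lifting X L R"
    and ret: "closed_under_retracts X L" "closed_under_retracts X R"
    and L: "L = inflations_with_Cone_in X \<U>" and R: "R = deflations_with_CoCone_in X \<V>"
    and \<U>: "\<U> = objects_from_zero X L" and \<V>: "\<V> = objects_to_zero X R"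
  shows "cotorsion_pair X (\<U>, \<V>)"
proof -
  have sub: "\<U> \<subseteq> Obj X" "\<V> \<subseteq> Obj X"
    unfolding \<U> \<V> objects_from_zero_def objects_to_zero_def by blast+
  have arr: "L \<subseteq> Arr X" "R \<subseteq> Arr X"
    unfolding L R inflations_with_Cone_in_def deflations_with_CoCone_in_def by blast+
  have o: "orth C A" if "C \<in> \<U>" "A \<in> \<V>" for C A
    using from_zero_orth_to_zero[OF lift R that(2)] that sub \<U> by blast
  have l: "\<U> = {C \<in> Obj X. \<forall>A \<in> \<V>. orth C A}"
  proof (intro equalityI subsetI)
    fix C assume "C \<in> {C \<in> Obj X. \<forall>A \<in> \<V>. orth C A}"
    then have c: "C \<in> Obj X" "\<And>A. A \<in> \<V> \<Longrightarrow> orth C A" by blast+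
    show "C \<in> \<U>" unfolding \<U> by (rule from_zero_if_left_orthogonal[OF fac ret(1) R arr(1) c])
  qed (use o sub in blast)
  have r: "\<V> = {A \<in> Obj X. \<forall>C \<in> \<U>. orth C A}"
  proof (intro equalityI subsetI)
    fix A assume "A \<in> {A \<in> Obj X. \<forall>C \<in> \<U>. orth C A}"
    then have c: "A \<in> Obj X" "\<And>C. C \<in> \<U> \<Longrightarrow> orth C A" by blast+
    show "A \<in> \<V>" unfolding \<V> by (rule to_zero_if_right_orthogonal[OF fac ret(2) L arr(2) c])
  qed (use o sub in blast)
  obtain Z where Z: "zero_object X Z" using ex_zero_object by blast
  have oz: "Z \<in> Obj X" by (rule zero_object_Obj[OF Z])
  have ap1: "\<exists>A \<in> \<V>. \<exists>B \<in> \<U>. \<exists>x y. conflation X A B C x y" if C: "C \<in> Obj X" for C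
  proof -
    have "Zmor X Z C \<in> Arr X" using oz C by simp
    then obtain i p where ip: "i \<in> L" "p \<in> R" "Cod X i = Dom X p" "Zmor X Z C = p \<cdot> i"
      using fac unfolding has_factorization_def by blast
    have a: "i \<in> Arr X" "p \<in> Arr X" using ip arr by blast+
    have dm: "Dom X i = Z" "Cod X p = C"
      using arg_cong[OF ip(4), of "Dom X"] arg_cong[OF ip(4), of "Cod X"] a ip(3) oz C by simp_all
    obtain K x \<delta> where t: "K \<in> \<V>" "triangle X K (Dom X p) C x p \<delta>"
      using deflation_with_CoCone_triangle ip(2) R dm by metis
    have "i \<in> Hom X Z (Dom X p)" using a dm ip(3) by (simp add: Hom_def)
    then have "Dom X p \<in> \<U>" unfolding \<U> objects_from_zero_def using Z ip(1) triangleD[OF t(2)] by blast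
    then show ?thesis using t unfolding conflation_def by blast
  qed
  have ap2: "\<exists>A \<in> \<V>. \<exists>B \<in> \<U>. \<exists>x y. conflation X C A B x y" if C: "C \<in> Obj X" for C
  proof -
    have "Zmor X C Z \<in> Arr X" using oz C by simp
    then obtain i p where ip: "i \<in> L" "p \<in> R" "Cod X i = Dom X p" "Zmor X C Z = p \<cdot> i"
      using fac unfolding has_factorization_def by blast
    have a: "i \<in> Arr X" "p \<in> Arr X" using ip arr by blast+
    have dm: "Dom X i = C" "Cod X p = Z"
      using arg_cong[OF ip(4), of "Dom X"] arg_cong[OF ip(4), of "Cod X"] a ip(3) oz C by simp_all
    obtain D y \<delta> where t: "D \<in> \<U>" "triangle X C (Cod X i) D i y \<delta>"
      using inflation_with_Cone_triangle ip(1) L dm by metis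
    have "p \<in> Hom X (Cod X i) Z" using a dm ip(3) by (simp add: Hom_def)
    then have "Cod X i \<in> \<V>" unfolding \<V> objects_to_zero_def using Z ip(2) triangleD[OF t(2)] by blast
    then show ?thesis using t unfolding conflation_def by blast
  qed
  have v: "Ext_vanishes X \<U> \<V>" unfolding Ext_vanishes_iff[OF sub] using o by blast
  show ?thesis
    unfolding cotorsion_pair.simps
    using left_orthogonal_closure[OF l sub(2)] right_orthogonal_closure[OF r sub(1)] v ap1 ap2 by blast
qed

lemma Hovey_twin_of_admissible_model:
  assumes adm: "admissible_model_structure X (Fib, Cof, We)"
  shows "Hovey_twin_cotorsion_pair X (twin_of_model X (Fib, Cof, We))"
    and "model_of_twin X (twin_of_model X (Fib, Cof, We)) = (Fib, Cof, We)"
proof -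
  define S T U V where defs: "S = objects_from_zero X (Cof \<inter> We)" "T = objects_to_zero X Fib"
    "U = objects_from_zero X Cof" "V = objects_to_zero X (Fib \<inter> We)"
  have tw: "twin_of_model X (Fib, Cof, We) = ((S, T), (U, V))" by (simp add: defs)
  have ms: "model_structure X (Fib, Cof, We)"
    and cl: "Cof \<inter> We = inflations_with_Cone_in X S" "Fib = deflations_with_CoCone_in X T"
      "Cof = inflations_with_Cone_in X U" "Fib \<inter> We = deflations_with_CoCone_in X V"
    using adm unfolding admissible_model_structure.simps tw prod.case by blast+
  have sub: "Fib \<subseteq> Arr X" "Cof \<subseteq> Arr X" "We \<subseteq> Arr X" and tt: "two_out_of_three X We"
    and ret: "closed_under_retracts X Fib" "closed_under_retracts X Cof" "closed_under_retracts X We"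
    and lift: "has_lifting X (Cof \<inter> We) Fib" "has_lifting X Cof (Fib \<inter> We)"
    and fac: "has_factorization X (Cof \<inter> We) Fib" "has_factorization X Cof (Fib \<inter> We)"
    using ms unfolding model_structure.simps by blast+
  have retI: "closed_under_retracts X (Cof \<inter> We)" "closed_under_retracts X (Fib \<inter> We)"
    using ret unfolding closed_under_retracts_def by blast+
  have tot: "(f \<in> We \<and> g \<in> We \<longrightarrow> g \<cdot> f \<in> We) \<and> (f \<in> We \<and> g \<cdot> f \<in> We \<longrightarrow> g \<in> We) \<and>
      (g \<in> We \<and> g \<cdot> f \<in> We \<longrightarrow> f \<in> We)"
    if "f \<in> Arr X" "g \<in> Arr X" "Cod X f = Dom X g" for f g
  proof -
    have "f \<in> Hom X (Dom X f) (Cod X f) \<and> g \<in> Hom X (Cod X f) (Cod X g)" using that by (simp add: Hom_def)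
    then show ?thesis using tt unfolding two_out_of_three_def by blast
  qed
  have cpS: "cotorsion_pair X (S, T)"
    by (rule cotorsion_pair_of_factorization_system[OF fac(1) lift(1) retI(1) ret(1) cl(1,2) defs(1,2)])
  have cpU: "cotorsion_pair X (U, V)"
    by (rule cotorsion_pair_of_factorization_system[OF fac(2) lift(2) ret(2) retI(2) cl(3,4) defs(3,4)])
  have SU: "S \<subseteq> U" unfolding defs objects_from_zero_def by blast
  have v: "Ext_vanishes X S V" using cotorsion_pairD(4)[OF cpU] SU unfolding Ext_vanishes_def by blast
  have obs: "S \<subseteq> Obj X" "V \<subseteq> Obj X" using cotorsion_pairD[OF cpS] cotorsion_pairD[OF cpU] by blast+
  have facW: "\<exists>i \<in> inflations_with_Cone_in X S. \<exists>p \<in> deflations_with_CoCone_in X V. Cod X i = Dom X p \<and> f = p \<cdot> i"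
    if f: "f \<in> We" for f
  proof -
    \<comment> \<open>The second factor is only known to be a fibration; two-out-of-three makes it a
      weak equivalence.\<close>
    obtain i p where ip: "i \<in> Cof \<inter> We" "p \<in> Fib" "Cod X i = Dom X p" "f = p \<cdot> i"
      using fac(1) f sub unfolding has_factorization_def by blast
    then have "p \<in> We" using tot[of i p] f sub by blast
    then show ?thesis using ip cl by blast
  qed
  have compW: "p \<cdot> i \<in> We" if "i \<in> inflations_with_Cone_in X S" "p \<in> deflations_with_CoCone_in X V" "Cod X i = Dom X p" for i p
  proof -
    have "i \<in> Cof \<inter> We" "p \<in> Fib \<inter> We" using that(1,2) cl by simp_all
    then show ?thesis using tot[of i p] that(3) sub by blast
  qed
  obtain Z where Z: "zero_object X Z" using ex_zero_object by blast
  have oz: "Z \<in> Obj X" by (rule zero_object_Obj[OF Z])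
  \<comment> \<open>Identities in \<open>We\<close> are not among the axioms. For a zero object, the
    identity is the zero arrow into an object of \<open>S\<close>.\<close>
  have iZ: "Ident X Z \<in> We"
  proof -
    have "Z \<in> S" by (rule cotorsion_pair_leftI[OF cpS oz]) (use orth_zero_left[OF Z] cotorsion_pairD(2)[OF cpS] in blast)
    then have "Zmor X Z Z \<in> inflations_with_Cone_in X S" by (rule zero_arrow_inflation[OF Z oz])
    then have "Zmor X Z Z \<in> We" unfolding cl(1)[symmetric] by blast
    then show ?thesis using zero_object_ident[OF Z] by simp
  qed
  \<comment> \<open>\<open>0 -> A -> 0\<close> composes to the identity of \<open>Z\<close>, so each
    of its arrows is a weak equivalence if the other is. This is what identifies the two
    descriptions of trivial objects.\<close>
  have sym: "Zmor X Z A \<in> We \<longleftrightarrow> Zmor X A Z \<in> We" if A: "A \<in> Obj X" for A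
  proof -
    have "Zmor X A Z \<cdot> Zmor X Z A = Ident X Z" using A oz zero_object_ident[OF Z] by simp
    then show ?thesis using tot[of "Zmor X Z A" "Zmor X A Z"] A oz iZ by auto
  qed
  have Ni: "A \<in> N_i X ((S, T), (U, V)) \<longleftrightarrow> Zmor X Z A \<in> We" if A: "A \<in> Obj X" for A
  proof
    assume "A \<in> N_i X ((S, T), (U, V))"
    then obtain B C x y \<delta> where t: "B \<in> V" "C \<in> S" "triangle X B C A x y \<delta>"
      unfolding N_i.simps conflation_def by blast
    have "Zmor X Z C \<in> inflations_with_Cone_in X S" using zero_arrow_inflation[OF Z _ t(2)] obs t(2) by blast
    moreover have "y \<in> deflations_with_CoCone_in X V" using t mem_deflations_with_CoCone_in by blast
    ultimately have "y \<cdot> Zmor X Z C \<in> We"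
      by (rule compW) (use triangleD[OF t(3)] oz in simp)
    then show "Zmor X Z A \<in> We" using triangleD[OF t(3)] oz by simp
  next
    assume "Zmor X Z A \<in> We"
    then obtain i p where ip: "i \<in> inflations_with_Cone_in X S" "p \<in> deflations_with_CoCone_in X V"
      "Cod X i = Dom X p" "Zmor X Z A = p \<cdot> i" using facW by blast
    obtain K x \<delta> where t: "K \<in> V" "triangle X K (Dom X p) (Cod X p) x p \<delta>"
      using deflation_with_CoCone_triangle[OF ip(2)] by metis
    have a: "i \<in> Arr X" "i \<in> Cof \<inter> We" using ip(1) unfolding cl(1)[symmetric] using sub by blast+
    have dm: "Dom X i = Z" "Cod X p = A"
      using arg_cong[OF ip(4), of "Dom X"] arg_cong[OF ip(4), of "Cod X"] a triangleD[OF t(2)] ip(3) oz A by simp_all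
    have "i \<in> Hom X Z (Dom X p)" using a dm ip(3) by (simp add: Hom_def)
    then have "Dom X p \<in> S" unfolding defs(1) objects_from_zero_def using Z a(2) triangleD[OF t(2)] by blast
    then show "A \<in> N_i X ((S, T), (U, V))" unfolding N_i.simps conflation_def using t dm A by blast
  qed
  have Nf: "A \<in> N_f X ((S, T), (U, V)) \<longleftrightarrow> Zmor X A Z \<in> We" if A: "A \<in> Obj X" for A
  proof
    assume "A \<in> N_f X ((S, T), (U, V))"
    then obtain B C x y \<delta> where t: "B \<in> V" "C \<in> S" "triangle X A B C x y \<delta>"
      unfolding N_f.simps conflation_def by blast
    have "x \<in> inflations_with_Cone_in X S" using t mem_inflations_with_Cone_in by blast
    moreover have "Zmor X B Z \<in> deflations_with_CoCone_in X V"
      using zero_arrow_deflation[OF Z _ t(1)] obs t(1) by blast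
    ultimately have "Zmor X B Z \<cdot> x \<in> We"
      by (rule compW) (use triangleD[OF t(3)] oz in simp)
    then show "Zmor X A Z \<in> We" using triangleD[OF t(3)] oz by simp
  next
    assume "Zmor X A Z \<in> We"
    then obtain i p where ip: "i \<in> inflations_with_Cone_in X S" "p \<in> deflations_with_CoCone_in X V"
      "Cod X i = Dom X p" "Zmor X A Z = p \<cdot> i" using facW by blast
    obtain C y \<delta> where t: "C \<in> S" "triangle X (Dom X i) (Cod X i) C i y \<delta>"
      using inflation_with_Cone_triangle[OF ip(1)] by metis
    have a: "p \<in> Arr X" "p \<in> Fib \<inter> We" using ip(2) unfolding cl(4)[symmetric] using sub by blast+
    have dm: "Dom X i = A" "Cod X p = Z"
      using arg_cong[OF ip(4), of "Dom X"] arg_cong[OF ip(4), of "Cod X"] a triangleD[OF t(2)] ip(3) oz A by simp_all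
    have "p \<in> Hom X (Cod X i) Z" using a dm ip(3) by (simp add: Hom_def)
    then have "Cod X i \<in> V" unfolding defs(4) objects_to_zero_def using Z a(2) triangleD[OF t(2)] by blast
    then show "A \<in> N_f X ((S, T), (U, V))" unfolding N_f.simps conflation_def using t dm A by blast
  qed
  have "N_i X ((S, T), (U, V)) \<subseteq> Obj X" "N_f X ((S, T), (U, V)) \<subseteq> Obj X"
    unfolding N_i.simps N_f.simps by blast+
  then have "N_i X ((S, T), (U, V)) = N_f X ((S, T), (U, V))" using Ni Nf sym by blast
  then show "Hovey_twin_cotorsion_pair X (twin_of_model X (Fib, Cof, We))"
    unfolding tw Hovey_twin_cotorsion_pair_def twin_cotorsion_pair.simps using cpS cpU v by blast
  have "We = {p \<cdot> i | p i. i \<in> inflations_with_Cone_in X S \<and> p \<in> deflations_with_CoCone_in X V \<and> Cod X i = Dom X p}"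
    using facW compW by blast
  then show "model_of_twin X (twin_of_model X (Fib, Cof, We)) = (Fib, Cof, We)"
    unfolding tw model_of_twin.simps using cl by simp
qed

text \<open>By \<open>CO_Int_W\<close> and \<open>FI_Int_W\<close>, intersecting with
  \<open>W\<close> gives back the classes defined by \<open>S\<close> and \<open>V\<close>, so each
  of the four object classes is recovered from its own class of morphisms.\<close>

lemma admissible_model_of_Hovey_twin:
  assumes wic: "WIC X" and hovey: "Hovey_twin_cotorsion_pair X ((S, T), (U, V))"
  shows "admissible_model_structure X (model_of_twin X ((S, T), (U, V)))"
    and "twin_of_model X (model_of_twin X ((S, T), (U, V))) = ((S, T), (U, V))"
proof -
  interpret hovey_category X S T U V by unfold_locales (rule wic, rule hovey)
  have m: "model_of_twin X ((S, T), (U, V)) = (FI, CO, W)"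
    by (simp add: weak_equivalences_def)
  have tw: "twin_of_model X (FI, CO, W) = ((S, T), (U, V))"
    unfolding twin_of_model.simps CO_Int_W FI_Int_W
    using objects_from_zero_inflations[OF cpS] objects_from_zero_inflations[OF cpU]
      objects_to_zero_deflations[OF cpS] objects_to_zero_deflations[OF cpU] by simp
  then show "twin_of_model X (model_of_twin X ((S, T), (U, V))) = ((S, T), (U, V))" unfolding m .
  show "admissible_model_structure X (model_of_twin X ((S, T), (U, V)))"
    unfolding m admissible_model_structure.simps tw prod.case CO_Int_W FI_Int_W
    using model_structure_W by blast
qed

end

theorem mainTheorem1:
  fixes X :: "('o, 'm, 'e, 'x) extri_data_scheme"
  assumes "extriangulated_category X" and "WIC X"
  shows "bij_betw (twin_of_model X)
           {M. admissible_model_structure X M} {P. Hovey_twin_cotorsion_pair X P} \<and>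
         (\<forall>M. admissible_model_structure X M \<longrightarrow>
            Hovey_twin_cotorsion_pair X (twin_of_model X M) \<and>
            model_of_twin X (twin_of_model X M) = M) \<and>
         (\<forall>P. Hovey_twin_cotorsion_pair X P \<longrightarrow>
            admissible_model_structure X (model_of_twin X P) \<and>
            twin_of_model X (model_of_twin X P) = P)"
proof -
  have 1: "Hovey_twin_cotorsion_pair X (twin_of_model X M) \<and> model_of_twin X (twin_of_model X M) = M"
    if "admissible_model_structure X M" for M
    using extriangulated_category.Hovey_twin_of_admissible_model[OF assms(1)] that by (cases M) blast
  have 2: "admissible_model_structure X (model_of_twin X P) \<and> twin_of_model X (model_of_twin X P) = P"
    if "Hovey_twin_cotorsion_pair X P" for P
  proof -
    obtain S T U V where "P = ((S, T), (U, V))" by (metis surj_pair)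
    then show ?thesis
      using extriangulated_category.admissible_model_of_Hovey_twin[OF assms] that by blast
  qed
  have "bij_betw (twin_of_model X) {M. admissible_model_structure X M} {P. Hovey_twin_cotorsion_pair X P}"
    by (rule bij_betw_byWitness[where f' = "model_of_twin X"]) (use 1 2 in blast)+
  then show ?thesis using 1 2 by blast
qed

end
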